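(* Let $L$ be a constructible $d$-dimensional tropical linear space in $n$-space. Then for every integer $i\ge 1$, the number of $i$-dimensional bounded faces of $L$ equals $\binom{n-2i}{d-i}\binom{n-i-1}{i-1}$.
   Context: For $I\subseteq[n]=\{1,\dots,n\}$ write $\binom{[n]}{d}$ for the $d$-element subsets. A function $p:\binom{[n]}{d}\to\mathbb{R}$ is a tropical Plücker vector if for every $S\in\binom{[n]}{d-2}$ and all distinct $i,j,k,l\in[n]\setminus S$, the minimum of the three numbers $p_{S\cup\{i,j\}}+p_{S\cup\{k,l\}}$, $p_{S\cup\{i,k\}}+p_{S\cup\{j,l\}}$, $p_{S\cup\{i,l\}}+p_{S\cup\{j,k\}}$ is attained at least twice. Its tropical linear space is $L(p)=\{x\in\mathbb{R}^n:$ for every $J\in\binom{[n]}{d+1}$ the minimum over $j\in J$ of $p_{J\setminus\{j\}}+x_j$ is attained at least twice$\}$; such a set is a $d$-dimensional tropical linear space in $n$-space. For $w\in\mathbb{R}^n$ let $M_w$ be the set of $I\in\binom{[n]}{d}$ minimizing $p_I-\sum_{i\in I}w_i$. The sets $\{w: M_w=\mathcal{M}\}$ are relatively open polyhedra partitioning $\mathbb{R}^n$; a face of $L(p)$ is the closure of such a set that is contained in $L(p)$. The dimension of a face is the dimension of its affine hull in $\mathbb{R}^n$, and a face is bounded if its image in $\mathbb{R}^n/\mathbb{R}(1,\dots,1)$ is bounded. Dual: for $p$ on $\binom{[n]}{d}$ define $p^\perp$ on $\binom{[n]}{n-d}$ by $p^\perp_I=p_{[n]\setminus I}$ (again a tropical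 Plücker vector) and $L(p)^\perp=L(p^\perp)$. Stable intersection: for tropical Plücker vectors $p$ on $\binom{[n]}{d}$, $p'$ on $\binom{[n]}{d'}$ with $d+d'\ge n$, define $q$ on $\binom{[n]}{d+d'-n}$ by $q_J=\min\{p_I+p'_{I'}: |I|=d,|I'|=d', I\cap I'=J\}$; $q$ is a tropical Plücker vector. Two tropical linear spaces $L,L'$ in $n$-space meet transversely if whenever faces $F$ of $L$ and $F'$ of $L'$ have intersecting relative interiors, the direction spaces of their affine hulls together span $\mathbb{R}^n$; in that case (with $d+d'\ge n$) $L(p)\cap L(p')=L(q)$. A tropical hyperplane is an $(n-1)$-dimensional tropical linear space in $n$-space (for any $n$). The class of constructible tropical linear spaces is the smallest class containing all tropical hyperplanes and closed under $L\mapsto L^\perp$ and under $(L,L')\mapsto L\cap L'$ whenever $L,L'$ are tropical linear spaces in the same $\mathbb{R}^n$ of dimensions $d,d'$ with $d+d'\ge n$ that meet transversely (the intersection being the tropical linear space $L(q)$). *)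

theory Defs
  imports "HOL-Analysis.Analysis"
begin

text \<open>
  The finite type \<^typ>\<open>'n\<close> plays the role of \<open>[n]\<close>, so \<open>n = CARD('n)\<close> and \<open>n \<ge> 1\<close>.
  A function on the \<open>d\<close>-element subsets of \<open>[n]\<close> is a function \<open>'n set \<Rightarrow> real\<close>
  of which only the values at sets of cardinality \<open>d\<close> are ever used.
\<close>

definition min_attained_twice :: "('a \<Rightarrow> real) \<Rightarrow> 'a set \<Rightarrow> bool" where
  "min_attained_twice f A \<longleftrightarrow>
     (\<exists>a\<in>A. \<exists>b\<in>A. a \<noteq> b \<and> f a = f b \<and> (\<forall>c\<in>A. f a \<le> f c))"

definition tropical_pluecker :: "nat \<Rightarrow> ('n::finite set \<Rightarrow> real) \<Rightarrow> bool" where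
  "tropical_pluecker d p \<longleftrightarrow> d \<le> CARD('n) \<and>
     (\<forall>S i j k l. card S + 2 = d \<longrightarrow> distinct [i, j, k, l] \<longrightarrow> {i, j, k, l} \<inter> S = {} \<longrightarrow>
        min_attained_twice
          (\<lambda>m. [p (S \<union> {i, j}) + p (S \<union> {k, l}),
                p (S \<union> {i, k}) + p (S \<union> {j, l}),
                p (S \<union> {i, l}) + p (S \<union> {j, k})] ! m) {..<3})"

definition tropical_linear_space :: "nat \<Rightarrow> ('n::finite set \<Rightarrow> real) \<Rightarrow> (real ^ 'n) set" where
  "tropical_linear_space d p =
     {x. \<forall>J. card J = d + 1 \<longrightarrow> min_attained_twice (\<lambda>j. p (J - {j}) + x $ j) J}"

definition initial_bases :: "nat \<Rightarrow> ('n::finite set \<Rightarrow> real) \<Rightarrow> real ^ 'n \<Rightarrow> 'n set set" where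
  "initial_bases d p w =
     {I. is_arg_min (\<lambda>I. p I - (\<Sum>i\<in>I. w $ i)) (\<lambda>I. card I = d) I}"

definition tropical_cell :: "nat \<Rightarrow> ('n::finite set \<Rightarrow> real) \<Rightarrow> 'n set set \<Rightarrow> (real ^ 'n) set" where
  "tropical_cell d p M = {w. initial_bases d p w = M}"

definition tropical_faces :: "nat \<Rightarrow> ('n::finite set \<Rightarrow> real) \<Rightarrow> (real ^ 'n) set set" where
  "tropical_faces d p =
     {closure (tropical_cell d p M) | M.
        tropical_cell d p M \<noteq> {} \<and> closure (tropical_cell d p M) \<subseteq> tropical_linear_space d p}"

text \<open>
  Boundedness of the image in \<open>\<real>\<^sup>n / \<real>(1,\<dots>,1)\<close>: the quotient norm of the class of \<open>x\<close> is the
  minimum over \<open>t\<close> of \<open>norm (x - t (1,\<dots>,1))\<close>.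
\<close>

definition bounded_mod_ones :: "(real ^ 'n::finite) set \<Rightarrow> bool" where
  "bounded_mod_ones F \<longleftrightarrow> (\<exists>B. \<forall>x\<in>F. \<exists>t. norm (x - t *\<^sub>R vec 1) \<le> B)"

definition dual_pluecker :: "('n::finite set \<Rightarrow> real) \<Rightarrow> 'n set \<Rightarrow> real" where
  "dual_pluecker p I = p (- I)"

definition direction_space :: "(real ^ 'n::finite) set \<Rightarrow> (real ^ 'n) set" where
  "direction_space F = {x - y | x y. x \<in> affine hull F \<and> y \<in> affine hull F}"

definition meet_transversely ::
    "nat \<Rightarrow> ('n::finite set \<Rightarrow> real) \<Rightarrow> nat \<Rightarrow> ('n set \<Rightarrow> real) \<Rightarrow> bool" where
  "meet_transversely d p d' p' \<longleftrightarrow>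
     (\<forall>F \<in> tropical_faces d p. \<forall>F' \<in> tropical_faces d' p'.
        rel_interior F \<inter> rel_interior F' \<noteq> {} \<longrightarrow>
        span (direction_space F \<union> direction_space F') = UNIV)"

text \<open>
  \<open>constructible d L\<close>: the set \<open>L\<close> is a constructible tropical linear space of dimension \<open>d\<close> in
  \<open>\<real>\<^sup>n\<close>. No operation changes \<open>n\<close>, so the class splits over the ambient spaces. The dual and
  the faces of a tropical linear space are defined through a tropical Pluecker vector, which the
  space determines up to an additive constant; the rules accept any such vector.
\<close>

inductive constructible :: "nat \<Rightarrow> (real ^ 'n::finite) set \<Rightarrow> bool" where
  hyperplane:
    "tropical_pluecker (CARD('n) - 1) p \<Longrightarrow>
     constructible (CARD('n) - 1) (tropical_linear_space (CARD('n) - 1) p)"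
| dual:
    "tropical_pluecker d p \<Longrightarrow>
     constructible d (tropical_linear_space d p) \<Longrightarrow>
     constructible (CARD('n) - d) (tropical_linear_space (CARD('n) - d) (dual_pluecker p))"
| transverse_intersection:
    "tropical_pluecker d p \<Longrightarrow> tropical_pluecker d' p' \<Longrightarrow>
     constructible d (tropical_linear_space d p) \<Longrightarrow>
     constructible d' (tropical_linear_space d' p') \<Longrightarrow>
     CARD('n) \<le> d + d' \<Longrightarrow>
     meet_transversely d p d' p' \<Longrightarrow>
     constructible (d + d' - CARD('n)) (tropical_linear_space d p \<inter> tropical_linear_space d' p')"

text \<open>
  Binomial coefficients with integer entries: \<open>0\<close> for a negative lower entry, and a negative upper
  entry is read as \<open>0\<close>. For \<open>0 < d < n\<close> the product of binomial coefficients in the theorem has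
  the same value under every usual convention. The degenerate dimension \<open>d = n\<close> also occurs, and
  there the term \<open>i = n\<close> is \<open>binom (-n) 0 * binom (-1) (n - 1)\<close>, which has to be \<open>1\<close> for \<open>n = 1\<close>
  and \<open>0\<close> for \<open>n \<ge> 2\<close>.
\<close>

definition binom :: "int \<Rightarrow> int \<Rightarrow> nat" where
  "binom m k = (if k < 0 then 0 else nat m choose nat k)"

end

theory Submission
  imports Defs "HOL-Computational_Algebra.Polynomial"
begin

text \<open>The cells of \<open>L(p)\<close> are indexed by the set families \<open>M_w\<close> of bases of matroids. For a
  constructible \<open>L\<close> all of these matroids are direct sums of series-parallel ones. This holds for
  hyperplanes and is stable under duality. At a point of a transverse intersection the initial
  matroid is the family of all \<open>I \<inter> I'\<close> with \<open>I \<union> I' = [n]\<close>; a dimension count shows that one of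
  the two matroids has a parallel pair that meets, or a series pair that lies in, the coloops of the
  other, and reducing this pair gives an induction. Conversely, if every \<open>M_w\<close> is series-parallel, the cells can be counted.
  Let \<open>F(K, L)\<close> be the sum of \<open>t\<close> to the power of the dimension over the cells with coloops
  \<open>K\<close> and loops \<open>L\<close>. Sorting cells by the face on which \<open>w_e - w_f\<close> is minimal, and
  again by the face on which it is maximal, compares two sums which are termwise proportional by a
  local symmetry of series-parallel matroids. The result is a recursion for \<open>F\<close> which is that of the
  Delannoy numbers, so that \<open>F({}, {})\<close> does not depend on \<open>p\<close>; its coefficients are the numbers
  claimed, as a cell is a bounded face of \<open>L(p)\<close> iff it has neither coloops nor loops.\<close>

section \<open>Series-parallel set families\<close>

text \<open>On a cell where \<open>e\<close> is no loop and \<open>f\<close> no coloop,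
  \<open>w_e - w_f\<close> is bounded below, even if \<open>e\<close> is a coloop or
  \<open>f\<close> a loop. Sorting by the minimum can therefore take in four classes of cells at
  once, according to whether \<open>e\<close> joins the coloops \<open>K\<close> and
  \<open>f\<close> joins the loops \<open>L\<close>, and the minimal faces still have coloops
  \<open>K\<close> and loops \<open>L\<close>. Sorting by the maximum is applied to the cells with
  coloops \<open>K\<close> and loops \<open>L\<close> alone. Over each minimal face the four classes
  together weigh \<open>1 + t\<close> times the single one, and this is the recursion. The recursion
  visits cells with loops, which lie outside \<open>L(p)\<close>, whereas transversality speaks only
  of points of the spaces. Raising the coordinate of a loop until it enters a basis closes this gap,
  because deletion preserves the series-parallel property. A second obstacle is that
  constructibility is a property of the set \<open>L\<close>, while the cells are defined by
  \<open>p\<close>; so \<open>p\<close> must be recovered from \<open>L\<close> up to a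
  constant.\<close>

definition wt :: "real ^ 'n::finite \<Rightarrow> 'n set \<Rightarrow> real" where
  "wt u I = (\<Sum>i\<in>I. u $ i)"

lemma wt_add: "wt (u + v) I = wt u I + wt v I"
  by (simp add: wt_def sum.distrib)

lemma wt_diff: "wt (u - v) I = wt u I - wt v I"
  by (simp add: wt_def sum_subtractf)

lemma wt_scaleR: "wt (c *\<^sub>R u) I = c * wt u I"
  by (simp add: wt_def sum_distrib_left)

lemma wt_uminus: "wt (- u) I = - wt u I"
  by (simp add: wt_def sum_negf)

lemma wt_zero [simp]: "wt 0 I = 0"
  by (simp add: wt_def)

lemma wt_axis: "wt (axis z c) I = (if z \<in> I then c else 0)"
  by (simp add: wt_def axis_def sum.delta' if_distrib cong: if_cong)

lemma wt_compl: "wt u (- I) = wt u UNIV - wt u I"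
  unfolding wt_def by (metis Compl_eq_Diff_UNIV finite_class.finite_UNIV subset_UNIV sum_diff)

lemma wt_exchange:
  assumes "y \<in> I" "x \<notin> I"
  shows "wt u (insert x (I - {y})) = wt u I - u $ y + u $ x"
proof -
  have "wt u (insert x (I - {y})) = u $ x + wt u (I - {y})"
    using assms by (simp add: wt_def)
  moreover have "wt u I = u $ y + wt u (I - {y})"
    unfolding wt_def using assms by (simp add: sum.remove)
  ultimately show ?thesis by simp
qed

text \<open>\<open>ppair B x y\<close>: \<open>x\<close> and \<open>y\<close> are parallel elements of the matroid with bases \<open>B\<close>, and not loops;
  \<open>spair\<close> is the dual notion. Only these two exchange properties are used, so \<open>B\<close> need not
  be assumed to be a matroid.\<close>

definition ppair :: "'n set set \<Rightarrow> 'n \<Rightarrow> 'n \<Rightarrow> bool" where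
  "ppair B x y \<longleftrightarrow> x \<noteq> y \<and> x \<in> \<Union>B \<and> (\<forall>I\<in>B. \<not> (x \<in> I \<and> y \<in> I)) \<and>
     (\<forall>I\<in>B. x \<in> I \<longrightarrow> insert y (I - {x}) \<in> B) \<and>
     (\<forall>I\<in>B. y \<in> I \<longrightarrow> insert x (I - {y}) \<in> B)"

definition spair :: "'n set set \<Rightarrow> 'n \<Rightarrow> 'n \<Rightarrow> bool" where
  "spair B x y \<longleftrightarrow> x \<noteq> y \<and> (\<exists>I\<in>B. x \<notin> I) \<and> (\<forall>I\<in>B. x \<in> I \<or> y \<in> I) \<and>
     (\<forall>I\<in>B. x \<notin> I \<longrightarrow> insert x (I - {y}) \<in> B) \<and>
     (\<forall>I\<in>B. y \<notin> I \<longrightarrow> insert y (I - {x}) \<in> B)"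

text \<open>The ground set never shrinks: a deleted element remains as a loop, and a contracted one
  remains in every set as a coloop. All minors thus have lineality spaces in the same vector space,
  and their dimensions can be compared.\<close>

abbreviation del :: "'n \<Rightarrow> 'n set set \<Rightarrow> 'n set set" where
  "del x B \<equiv> {I \<in> B. x \<notin> I}"

abbreviation con :: "'n \<Rightarrow> 'n set set \<Rightarrow> 'n set set" where
  "con x B \<equiv> {I \<in> B. x \<in> I}"

text \<open>Loops and coloops are allowed, so that \<open>sp\<close> describes direct sums of series-parallel matroids.\<close>

inductive sp :: "'n set set \<Rightarrow> bool" where
  single: "sp {K}"
| parallel: "ppair B x y \<Longrightarrow> sp (del x B) \<Longrightarrow> sp B"
| series: "spair B x y \<Longrightarrow> sp (con x B) \<Longrightarrow> sp B"

lemma ppair_sym: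
  assumes "ppair B x y"
  shows "ppair B y x"
proof -
  obtain I where "I \<in> B" "x \<in> I" using assms unfolding ppair_def by auto
  then have "insert y (I - {x}) \<in> B" using assms unfolding ppair_def by simp
  then have "y \<in> \<Union>B" by (meson UnionI insertI1)
  moreover have "y \<noteq> x" using assms unfolding ppair_def by metis
  ultimately show ?thesis using assms unfolding ppair_def by (simp add: conj_commute)
qed

lemma spair_sym:
  assumes "spair B x y"
  shows "spair B y x"
proof -
  have ne: "y \<noteq> x" using assms unfolding spair_def by metis
  obtain I where I: "I \<in> B" "x \<notin> I" using assms unfolding spair_def by auto
  then have "insert x (I - {y}) \<in> B" "y \<notin> insert x (I - {y})" using assms ne unfolding spair_def by simp_all
  then have "\<exists>I\<in>B. y \<notin> I" by meson
  then show ?thesis using assms ne unfolding spair_def by (simp add: disj_commute)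
qed

lemma ppair_dual: "ppair (uminus ` B) x y \<longleftrightarrow> spair B x y"
proof -
  have a: "insert y (- I - {x}) \<in> uminus ` B \<longleftrightarrow> insert x (I - {y}) \<in> B" if "x \<noteq> y" for x y I
  proof -
    have "insert y (- I - {x}) = - insert x (I - {y})" using that by auto
    then show ?thesis by (metis (no_types, lifting) double_complement image_iff)
  qed
  show ?thesis
  proof (cases "x = y")
    case True
    then show ?thesis by (simp add: ppair_def spair_def)
  next
    case False
    show ?thesis
      unfolding ppair_def spair_def using False a[OF False] a[OF False[symmetric]] by simp blast
  qed
qed

lemma uminus_uminus_image [simp]: "uminus ` uminus ` B = (B :: 'n set set)"
  by (simp add: image_image)

lemma spair_dual: "spair (uminus ` B) x y \<longleftrightarrow> ppair B x y"
  using ppair_dual[of "uminus ` B"] by simp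

lemma con_dual: "con x (uminus ` B) = uminus ` del x B"
  unfolding Compr_image_eq by simp

lemma del_dual: "del x (uminus ` B) = uminus ` con x B"
  unfolding Compr_image_eq by simp

lemma sp_dual: "sp B \<Longrightarrow> sp (uminus ` B)"
proof (induction rule: sp.induct)
  case (single K)
  then show ?case by (simp add: sp.single)
next
  case (parallel B x y)
  then show ?case using sp.series[of "uminus ` B" x y] unfolding spair_dual con_dual by iprover
next
  case (series B x y)
  then show ?case using sp.parallel[of "uminus ` B" x y] unfolding ppair_dual del_dual by iprover
qed

lemma sp_nonempty: "sp B \<Longrightarrow> B \<noteq> {}"
  by (induction rule: sp.induct) auto

lemma sp_image:
  assumes "sp B" "bij \<pi>"
  shows "sp ((`) \<pi> ` B)"
  using assms(1)
proof (induction rule: sp.induct)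
  case (single K)
  then show ?case by (simp add: sp.single)
next
  have inj: "inj \<pi>" using assms(2) by (simp add: bij_is_inj)
  have m: "\<pi> x \<in> \<pi> ` I \<longleftrightarrow> x \<in> I" for x I using inj by (simp add: inj_image_mem_iff)
  have s: "insert (\<pi> y) (\<pi> ` I - {\<pi> x}) = \<pi> ` insert y (I - {x})" for x y I
    using inj by (simp add: image_set_diff)
  have m2: "\<pi> ` I \<in> (`) \<pi> ` B \<longleftrightarrow> I \<in> B" for I B
    using inj by (simp add: inj_image_eq_iff image_iff)
  case (parallel B x y)
  have pp: "ppair ((`) \<pi> ` B) (\<pi> x) (\<pi> y)"
    using parallel(1) inj unfolding ppair_def by (simp add: m m2 s inj_eq del: image_insert) 
  have e: "del (\<pi> x) ((`) \<pi> ` B) = (`) \<pi> ` del x B" using m by (auto simp: inj_eq[OF inj])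
  show ?case by (rule sp.parallel[OF pp]) (unfold e, rule parallel.IH)
next
  have inj: "inj \<pi>" using assms(2) by (simp add: bij_is_inj)
  have m: "\<pi> x \<in> \<pi> ` I \<longleftrightarrow> x \<in> I" for x I using inj by (simp add: inj_image_mem_iff)
  have s: "insert (\<pi> y) (\<pi> ` I - {\<pi> x}) = \<pi> ` insert y (I - {x})" for x y I
    using inj by (simp add: image_set_diff)
  have m2: "\<pi> ` I \<in> (`) \<pi> ` B \<longleftrightarrow> I \<in> B" for I B
    using inj by (simp add: inj_image_eq_iff image_iff)
  case (series B x y)
  have pp: "spair ((`) \<pi> ` B) (\<pi> x) (\<pi> y)"
    using series(1) inj unfolding spair_def by (simp add: m m2 s inj_eq del: image_insert) 
  have e: "con (\<pi> x) ((`) \<pi> ` B) = (`) \<pi> ` con x B" using m by (auto simp: inj_eq[OF inj])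
  show ?case by (rule sp.series[OF pp]) (unfold e, rule series.IH)
qed

lemma transpose_image_in:
  assumes "x \<in> I" "y \<notin> I"
  shows "Transposition.transpose x y ` I = insert y (I - {x})"
  using assms by (auto simp: Transposition.transpose_def image_iff split: if_splits) 

lemma transpose_image_notin:
  assumes "x \<notin> I" "y \<notin> I"
  shows "Transposition.transpose x y ` I = I"
  using assms by (auto simp: Transposition.transpose_def image_iff split: if_splits) 

text \<open>Parallel elements are interchangeable: the swap of \<open>x\<close> and \<open>y\<close>
  carries one deletion to the other, so both are series-parallel as soon as one is.\<close>

lemma ppair_del_transpose:
  assumes "ppair B x y"
  shows "del y B = (`) (Transposition.transpose x y) ` del x B"
proof -
  have t: "Transposition.transpose x y ` I = (if y \<in> I then insert x (I - {y}) else I)" if "I \<in> del x B" for I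
    using that transpose_image_in[of y I x] transpose_image_notin[of x I y]
    by (auto simp: Transposition.transpose_commute)
  show ?thesis
  proof (intro equalityI subsetI)
    fix I assume I: "I \<in> del y B"
    show "I \<in> (`) (Transposition.transpose x y) ` del x B"
    proof (cases "x \<in> I")
      case True
      have i: "insert y (I - {x}) \<in> del x B" using I True assms by (auto simp: ppair_def)
      have "Transposition.transpose x y ` insert y (I - {x}) = I" using t[OF i] I True by auto
      then show ?thesis using i by (intro image_eqI[of _ _ "insert y (I - {x})"]) simp_all
    next
      case False
      then show ?thesis using t[of I] I by (intro image_eqI[of _ _ I]) simp_all
    qed
  next
    fix I assume "I \<in> (`) (Transposition.transpose x y) ` del x B"
    then obtain J where J: "J \<in> del x B" "I = Transposition.transpose x y ` J" by blast
    then show "I \<in> del y B" using t[OF J(1)] assms by (auto simp: ppair_def split: if_splits)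
  qed
qed

text \<open>A parallel pair survives deletion or contraction of a third element unless
  \<open>x\<close> becomes a loop, and then the minor is already a minor of \<open>del x B\<close>.
  Minors at \<open>x\<close> are carried over from minors at \<open>y\<close> by the transposition.
  Deletion and contraction are treated together because complementation reduces the series step to
  the parallel step and exchanges the two.\<close>

lemma sp_del_con:
  "sp B \<Longrightarrow> (del z B \<noteq> {} \<longrightarrow> sp (del z B)) \<and> (con z B \<noteq> {} \<longrightarrow> sp (con z B))"
proof -
  have A: "sp (del z B)" if h: "ppair B x y" "sp (del x B)"
    "\<And>z. (del z (del x B) \<noteq> {} \<longrightarrow> sp (del z (del x B))) \<and> (con z (del x B) \<noteq> {} \<longrightarrow> sp (con z (del x B)))"
    and ne: "del z B \<noteq> {}" for B :: "'a set set" and x y z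
  proof (cases "z = x \<or> z = y")
    case True
    then show ?thesis
      using h ppair_del_transpose[OF h(1)] sp_image[OF h(2) bij_transpose] by auto
  next
    case False
    then have zx: "z \<noteq> x" "z \<noteq> y" by auto
    have sw: "I \<in> del z B \<Longrightarrow> x \<in> I \<Longrightarrow> insert y (I - {x}) \<in> del z (del x B)" for I
      using h(1) zx by (auto simp: ppair_def)
    obtain I where I: "I \<in> del z B" using ne by blast
    have ne2: "del z (del x B) \<noteq> {}"
    proof (cases "x \<in> I")
      case True
      show ?thesis using sw[OF I True] by (rule ex_in_conv[THEN iffD1, OF exI])
    qed (use I in blast)
    have e: "del x (del z B) = del z (del x B)" by auto
    show ?thesis
    proof (cases "x \<in> \<Union>(del z B)")
      case True
      have pp: "ppair (del z B) x y" using h(1) True zx unfolding ppair_def by auto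
      show ?thesis by (rule sp.parallel[OF pp]) (unfold e, use h(3)[of z] ne2 in blast)
    next
      case False
      then have e': "del z B = del z (del x B)" by auto
      show ?thesis unfolding e' using h(3)[of z] ne2 by blast
    qed
  qed
  have C: "sp (con z B)" if h: "ppair B x y" "sp (del x B)"
    "\<And>z. (del z (del x B) \<noteq> {} \<longrightarrow> sp (del z (del x B))) \<and> (con z (del x B) \<noteq> {} \<longrightarrow> sp (con z (del x B)))"
    and ne: "con z B \<noteq> {}" for B :: "'a set set" and x y z
  proof -
    have cy: "con y B = con y (del x B)" using h(1) by (auto simp: ppair_def)
    have cyne: "con y B \<noteq> {}" using h(1) by (auto simp: ppair_def)
    have cysp: "sp (con y B)" using cyne h(3)[of y] unfolding cy by blast
    consider "z = x" | "z = y" | "z \<noteq> x" "z \<noteq> y" by blast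
    then show ?thesis
    proof cases
      case 1
      have "con x B = (`) (Transposition.transpose x y) ` con y B"
      proof (intro equalityI subsetI)
        fix I assume I: "I \<in> con x B"
        have i: "insert y (I - {x}) \<in> con y B" "x \<notin> insert y (I - {x})" "y \<notin> I"
          using I h(1) by (auto simp: ppair_def)
        have "Transposition.transpose x y ` insert y (I - {x}) = I"
          using transpose_image_in[of y "insert y (I - {x})" x] i I by (auto simp: Transposition.transpose_commute)
        then show "I \<in> (`) (Transposition.transpose x y) ` con y B" using i by (intro image_eqI[of _ _ "insert y (I - {x})"]) simp_all
      next
        fix I assume "I \<in> (`) (Transposition.transpose x y) ` con y B"
        then obtain J where J: "J \<in> con y B" "I = Transposition.transpose x y ` J" by blast
        then have "I = insert x (J - {y})"
          using transpose_image_in[of y J x] h(1) by (auto simp: Transposition.transpose_commute ppair_def)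
        then show "I \<in> con x B" using J h(1) by (auto simp: ppair_def)
      qed
      then show ?thesis using 1 sp_image[OF cysp bij_transpose[of x y]] by simp
    next
      case 2 then show ?thesis using cysp by simp
    next
      case 3
      have sw: "I \<in> con z B \<Longrightarrow> x \<in> I \<Longrightarrow> insert y (I - {x}) \<in> con z (del x B)" for I
        using h(1) 3 by (auto simp: ppair_def)
      obtain I where I: "I \<in> con z B" using ne by blast
      have ne2: "con z (del x B) \<noteq> {}"
      proof (cases "x \<in> I")
        case True
        show ?thesis using sw[OF I True] by (rule ex_in_conv[THEN iffD1, OF exI])
      qed (use I in blast)
      have e: "del x (con z B) = con z (del x B)" by auto
      show ?thesis
      proof (cases "x \<in> \<Union>(con z B)")
        case True
        have pp: "ppair (con z B) x y" using h(1) True 3 unfolding ppair_def by auto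
        show ?thesis by (rule sp.parallel[OF pp]) (unfold e, use h(3)[of z] ne2 in blast)
      next
        case False
        then have e': "con z B = con z (del x B)" by auto
        show ?thesis unfolding e' using h(3)[of z] ne2 by blast
      qed
    qed
  qed
  show "sp B \<Longrightarrow> (del z B \<noteq> {} \<longrightarrow> sp (del z B)) \<and> (con z B \<noteq> {} \<longrightarrow> sp (con z B))"
  proof (induction arbitrary: z rule: sp.induct)
    case (single K)
    have "del z {K} = (if z \<in> K then {} else {K})" "con z {K} = (if z \<in> K then {K} else {})" by auto
    then show ?case by (simp only: sp.single split: if_split) simp
  next
    case (parallel B x y)
    show ?case
      using A[OF parallel(1,2) parallel.IH, of z] C[OF parallel(1,2) parallel.IH, of z]
      by simp
  next
    case (series B x y)
    let ?U = "uminus ` B"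
    have p: "ppair ?U x y" "sp (del x ?U)"
      using series(1) sp_dual[OF series(2)] unfolding ppair_dual del_dual by simp_all
    have ih: "(del z (del x ?U) \<noteq> {} \<longrightarrow> sp (del z (del x ?U))) \<and> (con z (del x ?U) \<noteq> {} \<longrightarrow> sp (con z (del x ?U)))" for z
      unfolding del_dual con_dual using series.IH[of z] sp_dual[of "con z (con x B)"] sp_dual[of "del z (con x B)"]
      by blast
    have "del z ?U \<noteq> {} \<longrightarrow> sp (del z ?U)" "con z ?U \<noteq> {} \<longrightarrow> sp (con z ?U)"
      using A[OF p ih, of z] C[OF p ih, of z] by simp_all
    then have "con z B \<noteq> {} \<longrightarrow> sp (uminus ` con z B)" "del z B \<noteq> {} \<longrightarrow> sp (uminus ` del z B)"
      unfolding del_dual con_dual by simp_all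
    then show ?case using sp_dual[of "uminus ` con z B"] sp_dual[of "uminus ` del z B"]
      unfolding uminus_uminus_image by iprover
  qed
qed

lemma sp_del:
  assumes "sp B" "I \<in> B" "z \<notin> I"
  shows "sp (del z B)"
proof -
  have "I \<in> del z B" using assms by simp
  then have "del z B \<noteq> {}" by (rule ex_in_conv[THEN iffD1, OF exI])
  then show ?thesis using sp_del_con[OF assms(1), of z] by (rule_tac mp[OF conjunct1])
qed

lemma sp_con:
  assumes "sp B" "I \<in> B" "z \<in> I"
  shows "sp (con z B)"
proof -
  have "I \<in> con z B" using assms by simp
  then have "con z B \<noteq> {}" by (rule ex_in_conv[THEN iffD1, OF exI])
  then show ?thesis using sp_del_con[OF assms(1), of z] by (rule_tac mp[OF conjunct2])
qed

text \<open>A loop is no member of any parallel or series pair, so every pair of \<open>B\<close>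
  stays a pair. This serves where an element has to be removed from play without leaving a loop
  behind, as in \<open>meet_sp\<close>.\<close>

lemma sp_insert_coloop:
  assumes "sp B"
  shows "z \<notin> \<Union>B \<Longrightarrow> sp (insert z ` B)"
  using assms
proof (induction rule: sp.induct)
  case (single K)
  then show ?case by (simp add: sp.single)
next
  case (parallel B x y)
  have xy: "x \<in> \<Union>B" "y \<in> \<Union>B"
    using parallel(1) ppair_sym[OF parallel(1)] unfolding ppair_def by simp_all
  then have z: "z \<noteq> x" "z \<noteq> y" using parallel(4) by blast+
  have sw: "insert b (insert z I - {a}) = insert z (insert b (I - {a}))" if "z \<noteq> a" for a b and I :: "'a set"
    using that by auto
  have ne: "B \<noteq> {}" using xy by auto
  have pp: "ppair (insert z ` B) x y"
    using parallel(1) z ne unfolding ppair_def by (simp add: sw)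
  have e: "del x (insert z ` B) = insert z ` del x B" using z by auto
  have "z \<notin> \<Union>(del x B)" using parallel(4) by blast
  then have "sp (insert z ` del x B)" by (rule parallel.IH)
  then show ?case by (intro sp.parallel[OF pp]) (unfold e)
next
  case (series B x y)
  obtain I where I: "I \<in> B" "x \<notin> I" using series(1) unfolding spair_def by blast
  have yI: "y \<in> I" using series(1) I unfolding spair_def by blast
  have "insert x (I - {y}) \<in> B" using series(1) I unfolding spair_def by blast
  then have z: "z \<noteq> x" "z \<noteq> y" using series(4) I(1) yI by (metis UnionI insertI1, metis UnionI)
  have sw: "insert b (insert z I - {a}) = insert z (insert b (I - {a}))" if "z \<noteq> a" for a b and I :: "'a set"
    using that by auto
  have pp: "spair (insert z ` B) x y"
    using series(1) z I(1) unfolding spair_def by (simp add: sw)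
  have e: "con x (insert z ` B) = insert z ` con x B" using z by auto
  have "z \<notin> \<Union>(con x B)" using series(4) by blast
  then have "sp (insert z ` con x B)" by (rule series.IH)
  then show ?case by (intro sp.series[OF pp]) (unfold e)
qed

lemma sp_remove_coloop:
  assumes "sp B" "z \<in> \<Inter>B"
  shows "sp ((\<lambda>I. I - {z}) ` B)"
proof -
  have "sp (insert z ` uminus ` B)" using assms by (intro sp_insert_coloop sp_dual) auto
  then have "sp (uminus ` insert z ` uminus ` B)" by (rule sp_dual)
  moreover have "uminus ` insert z ` uminus ` B = (\<lambda>I. I - {z}) ` B"
    unfolding image_image by (rule image_cong) auto
  ultimately show ?thesis by simp
qed

section \<open>Faces of a set family in a direction\<close>

text \<open>If \<open>D\<close> is the family of bases at \<open>w\<close>, this is the family at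
  \<open>w + s u\<close> for small \<open>s > 0\<close> (\<open>initial_bases_small_step\<close>).
  The faces of \<open>D\<close> are thus the cells whose closure contains \<open>w\<close>.\<close>

definition max_face :: "'n::finite set set \<Rightarrow> real ^ 'n \<Rightarrow> 'n set set" where
  "max_face D u = {I \<in> D. \<forall>J\<in>D. wt u J \<le> wt u I}"

text \<open>The direction space of the cell with family \<open>D\<close>; its dimension is the
  dimension of the cell (\<open>aff_dim_region\<close>).\<close>

definition lineal :: "'n::finite set set \<Rightarrow> (real ^ 'n) set" where
  "lineal D = {v. \<forall>I\<in>D. \<forall>J\<in>D. wt v I = wt v J}"

lemma max_face_subset: "max_face D u \<subseteq> D"
  by (auto simp: max_face_def)

lemma max_face_nonempty:
  assumes "D \<noteq> {}"
  shows "max_face D u \<noteq> {}"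
proof -
  have "finite (wt u ` D)" "wt u ` D \<noteq> {}" using assms by auto
  then obtain I where I: "I \<in> D" "wt u I = Max (wt u ` D)" using Max_in by (metis imageE)
  have "\<forall>J\<in>D. wt u J \<le> wt u I" using I by simp
  then have "I \<in> max_face D u" using I by (simp add: max_face_def)
  then show ?thesis by (rule ex_in_conv[THEN iffD1, OF exI])
qed

lemma max_face_eq_iff: "max_face D u = D \<longleftrightarrow> u \<in> lineal D"
proof
  assume h: "max_face D u = D"
  have le: "wt u J \<le> wt u I" if "I \<in> D" "J \<in> D" for I J
  proof -
    have "I \<in> max_face D u" using that h by simp
    then show ?thesis using that by (simp add: max_face_def)
  qed
  have "wt u I = wt u J" if "I \<in> D" "J \<in> D" for I J
    using le[OF that] le[OF that(2) that(1)] by linarith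
  then show "u \<in> lineal D" unfolding lineal_def mem_Collect_eq by (intro ballI)
next
  assume "u \<in> lineal D"
  then have e: "\<forall>I\<in>D. \<forall>J\<in>D. wt u I = wt u J" unfolding lineal_def mem_Collect_eq .
  have "I \<in> max_face D u" if "I \<in> D" for I
    unfolding max_face_def mem_Collect_eq using that e by (metis order_refl)
  then show "max_face D u = D" using max_face_subset by blast
qed

lemma max_face_zero: "max_face D 0 = D"
  by (simp add: max_face_def)

lemma linealD: "v \<in> lineal D \<Longrightarrow> I \<in> D \<Longrightarrow> J \<in> D \<Longrightarrow> wt v I = wt v J"
  unfolding lineal_def mem_Collect_eq by (drule bspec, assumption, drule bspec, assumption)

lemma linealI: "(\<And>I J. I \<in> D \<Longrightarrow> J \<in> D \<Longrightarrow> wt v I = wt v J) \<Longrightarrow> v \<in> lineal D"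
  unfolding lineal_def mem_Collect_eq by (intro ballI)

lemma subspace_lineal: "subspace (lineal D)"
proof (rule subspaceI)
  show "0 \<in> lineal D" by (rule linealI) simp
next
  fix u v assume h: "u \<in> lineal D" "v \<in> lineal D"
  show "u + v \<in> lineal D"
    by (rule linealI) (unfold wt_add, intro arg_cong2[of _ _ _ _ "(+)"] linealD[OF h(1)] linealD[OF h(2)])
next
  fix c v assume h: "v \<in> lineal D"
  show "c *\<^sub>R v \<in> lineal D"
    by (rule linealI) (unfold wt_scaleR, intro arg_cong[of _ _ "\<lambda>z. c * z"] linealD[OF h])
qed

lemma lineal_antimono: "C \<subseteq> D \<Longrightarrow> lineal D \<subseteq> lineal C"
  by (intro subsetI linealI) (rule linealD[of _ D], auto)

lemma max_face_dual: "max_face (uminus ` D) u = uminus ` max_face D (- u)"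
  unfolding max_face_def Compr_image_eq by (simp add: wt_compl wt_uminus)

lemma lineal_dual: "lineal (uminus ` D) = lineal D"
  unfolding lineal_def ball_simps wt_compl by simp

lemma max_face_cong_coord:
  assumes "x \<notin> \<Union>D" "\<And>i. i \<noteq> x \<Longrightarrow> u $ i = v $ i"
  shows "max_face D u = max_face D v"
proof -
  have "wt u I = wt v I" if "I \<in> D" for I
    unfolding wt_def
  proof (rule sum.cong[OF refl])
    fix i assume "i \<in> I"
    then have "i \<noteq> x" using assms(1) that by auto
    then show "u $ i = v $ i" by (rule assms(2))
  qed
  then show ?thesis by (auto simp: max_face_def)
qed

section \<open>Parallel extensions and their faces\<close>

definition par :: "'n set set \<Rightarrow> 'n \<Rightarrow> 'n \<Rightarrow> 'n set set" where
  "par B y x = B \<union> (\<lambda>I. insert x (I - {y})) ` con y B"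

lemma mem_par: "J \<in> par B y x \<longleftrightarrow> J \<in> B \<or> (\<exists>I\<in>B. y \<in> I \<and> J = insert x (I - {y}))"
  by (auto simp: par_def)

lemma ball_par: "(\<forall>J\<in>par B y x. P J) \<longleftrightarrow> (\<forall>I\<in>B. P I \<and> (y \<in> I \<longrightarrow> P (insert x (I - {y}))))"
  by (auto simp: par_def)

lemma par_mono: "B \<subseteq> C \<Longrightarrow> par B y x \<subseteq> par C y x"
  by (auto simp: par_def)

lemma subset_par: "B \<subseteq> par B y x"
  by (auto simp: par_def)

text \<open>A parallel pair presents \<open>D\<close> as a parallel extension of the strictly
  smaller family \<open>del x D\<close>; this is the form in which the inductions on the number of
  sets use it.\<close>

lemma ppair_par:
  assumes "ppair D x y"
  shows "D = par (del x D) y x" "x \<notin> \<Union>(del x D)" "y \<in> \<Union>(del x D)" "card (del x D) < card (D :: 'n::finite set set)"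
proof -
  obtain I where I: "I \<in> D" "x \<in> I" using assms unfolding ppair_def by auto
  have sw: "insert y (J - {x}) \<in> del x D" if "J \<in> D" "x \<in> J" for J
    using assms that unfolding ppair_def by simp
  show "D = par (del x D) y x"
  proof (intro equalityI subsetI)
    fix J assume J: "J \<in> D"
    show "J \<in> par (del x D) y x"
    proof (cases "x \<in> J")
      case True
      then have "y \<notin> J" using J assms unfolding ppair_def by simp
      then have "J = insert x (insert y (J - {x}) - {y})" using True by auto
      then show ?thesis unfolding mem_par using sw[OF J True] by (meson insertI1)
    next
      case False
      then show ?thesis using J unfolding mem_par by simp
    qed
  next
    fix J assume "J \<in> par (del x D) y x"
    then show "J \<in> D" using assms unfolding mem_par ppair_def by (elim disjE) auto
  qed
  show "x \<notin> \<Union>(del x D)" by simp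
  show "y \<in> \<Union>(del x D)" using sw[OF I] by (meson UnionI insertI1)
  have "del x D \<subset> D" using I by auto
  then show "card (del x D) < card D" by (intro psubset_card_mono) simp_all
qed

text \<open>Since \<open>x\<close> is a loop of the smaller family, coordinate \<open>x\<close> has
  no influence there and may be chosen freely. Setting it equal to coordinate \<open>y\<close>, or
  below it, selects the type of face cut out of the extension.\<close>

definition reset :: "'n::finite \<Rightarrow> real \<Rightarrow> real ^ 'n \<Rightarrow> real ^ 'n" where
  "reset x c u = (\<chi> i. if i = x then c else u $ i)"

lemma reset_nth [simp]: "reset x c u $ i = (if i = x then c else u $ i)"
  by (simp add: reset_def)

lemma max_face_reset: "x \<notin> \<Union>D \<Longrightarrow> max_face D (reset x c u) = max_face D u"
  by (rule max_face_cong_coord) auto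

text \<open>The faces of the extension fall into three types. If \<open>u_x = u_y\<close> the face
  is the extension of a face of \<open>D0\<close>, if \<open>u_x < u_y\<close> it is a face of
  \<open>D0\<close> itself, and if \<open>u_x > u_y\<close> the element \<open>y\<close> becomes a
  loop.\<close>

locale par_ext =
  fixes D0 :: "'n::finite set set" and x y :: 'n
  assumes x_loop: "x \<notin> \<Union>D0" and y_nonloop: "y \<in> \<Union>D0"
begin

abbreviation "D \<equiv> par D0 y x"

lemma xy: "x \<noteq> y"
  using x_loop y_nonloop by auto

lemma wt_swap: "I \<in> D0 \<Longrightarrow> y \<in> I \<Longrightarrow> wt u (insert x (I - {y})) = wt u I - u $ y + u $ x"
  using x_loop by (intro wt_exchange) auto

lemma max_face_eq:
  assumes "u $ x = u $ y"
  shows "max_face D u = par (max_face D0 u) y x"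
proof -
  have w: "wt u (insert x (I - {y})) = wt u I" if "I \<in> D0" "y \<in> I" for I
    using wt_swap[OF that] assms by simp
  have a: "(\<forall>J\<in>D. wt u J \<le> c) \<longleftrightarrow> (\<forall>J\<in>D0. wt u J \<le> c)" for c
    unfolding ball_par using w by auto
  show ?thesis
  proof (intro set_eqI)
    fix J
    have "J \<in> max_face D u \<longleftrightarrow> (J \<in> D0 \<or> (\<exists>I\<in>D0. y \<in> I \<and> J = insert x (I - {y}))) \<and> (\<forall>J'\<in>D0. wt u J' \<le> wt u J)"
      by (simp add: max_face_def mem_par[symmetric] a)
    also have "\<dots> \<longleftrightarrow> J \<in> par (max_face D0 u) y x"
      unfolding mem_par max_face_def using w by auto
    finally show "J \<in> max_face D u \<longleftrightarrow> J \<in> par (max_face D0 u) y x" .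
  qed
qed

lemma max_face_less:
  assumes "u $ x < u $ y"
  shows "max_face D u = max_face D0 u"
proof -
  have w: "wt u (insert x (I - {y})) < wt u I" if "I \<in> D0" "y \<in> I" for I
    using wt_swap[OF that] assms by simp
  have a: "(\<forall>J\<in>D. wt u J \<le> c) \<longleftrightarrow> (\<forall>J\<in>D0. wt u J \<le> c)" for c
    unfolding ball_par using w by (meson less_imp_le order_trans)
  show ?thesis
  proof (intro set_eqI)
    fix J
    have "J \<in> max_face D u \<longleftrightarrow> (J \<in> D0 \<or> (\<exists>I\<in>D0. y \<in> I \<and> J = insert x (I - {y}))) \<and> (\<forall>J'\<in>D0. wt u J' \<le> wt u J)"
      by (simp add: max_face_def mem_par[symmetric] a)
    also have "\<dots> \<longleftrightarrow> J \<in> max_face D0 u"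
      unfolding max_face_def using w by (auto simp: not_less[symmetric])
    finally show "J \<in> max_face D u \<longleftrightarrow> J \<in> max_face D0 u" .
  qed
qed

lemma x_notin: "I \<in> D0 \<Longrightarrow> x \<notin> I"
  using x_loop by auto

lemma y_not_in_swapped: "y \<notin> insert x (I - {y})"
  using xy by auto

lemma y_in_imp: "I \<in> D \<Longrightarrow> y \<in> I \<Longrightarrow> I \<in> D0"
  unfolding mem_par using y_not_in_swapped by auto

lemma max_face_greater:
  assumes "u $ y < u $ x" "I \<in> max_face D u"
  shows "y \<notin> I"
proof
  assume y: "y \<in> I"
  have I: "I \<in> D0" using y y_in_imp assms(2) max_face_subset by blast
  have "insert x (I - {y}) \<in> D" unfolding mem_par using I y by blast
  then have "wt u (insert x (I - {y})) \<le> wt u I" using assms(2) by (simp add: max_face_def)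
  then show False using wt_swap[OF I y] assms by simp
qed

lemma par_inj:
  assumes "C \<subseteq> D0" "C' \<subseteq> D0" "par C y x = par C' y x"
  shows "C = C'"
proof -
  have "C = {I \<in> par C y x. x \<notin> I}" if "C \<subseteq> D0" for C
    using that x_notin by (auto simp: mem_par)
  then show ?thesis using assms by metis
qed

lemma par_max_face_iff:
  assumes "C0 \<subseteq> D0" "y \<in> \<Union>C0"
  shows "par C0 y x \<subseteq> max_face D u \<longleftrightarrow> u $ x = u $ y \<and> C0 \<subseteq> max_face D0 u"
proof
  assume h: "par C0 y x \<subseteq> max_face D u"
  obtain I where I: "I \<in> C0" "y \<in> I" using assms by auto
  have "I \<in> max_face D u" "insert x (I - {y}) \<in> max_face D u"
    using h I subset_par[of C0 y x] by (auto simp: mem_par subset_iff)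
  then have "wt u I = wt u (insert x (I - {y}))" unfolding max_face_def by (auto intro!: antisym)
  then have e: "u $ x = u $ y" using wt_swap[of I u] I assms by auto
  have "C0 \<subseteq> max_face D0 u"
  proof
    fix J assume J: "J \<in> C0"
    then have "J \<in> par (max_face D0 u) y x" using h max_face_eq[OF e] subset_par[of C0 y x] by auto
    moreover have "x \<notin> J" using J assms x_notin by auto
    ultimately show "J \<in> max_face D0 u" by (auto simp: mem_par)
  qed
  then show "u $ x = u $ y \<and> C0 \<subseteq> max_face D0 u" using e by simp
next
  assume h: "u $ x = u $ y \<and> C0 \<subseteq> max_face D0 u"
  then show "par C0 y x \<subseteq> max_face D u" using max_face_eq par_mono[of C0 "max_face D0 u" y x] by simp
qed

lemma lineal_par:
  assumes "C0 \<subseteq> D0" "y \<in> \<Union>C0"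
  shows "lineal (par C0 y x) = {v \<in> lineal C0. v $ x = v $ y}"
proof (intro set_eqI iffI)
  fix v assume v: "v \<in> lineal (par C0 y x)"
  obtain I where I: "I \<in> C0" "y \<in> I" using assms by auto
  have "I \<in> par C0 y x" "insert x (I - {y}) \<in> par C0 y x" unfolding mem_par using I by blast+
  then have "wt v I = wt v (insert x (I - {y}))" using linealD[OF v] by blast
  then have "v $ x = v $ y" using wt_swap[of I v] I assms by auto
  then show "v \<in> {v \<in> lineal C0. v $ x = v $ y}" using v lineal_antimono[OF subset_par[of C0 y x]] by auto
next
  fix v assume v: "v \<in> {v \<in> lineal C0. v $ x = v $ y}"
  have w: "wt v (insert x (I - {y})) = wt v I" if "I \<in> C0" "y \<in> I" for I
    using wt_swap[of I v] that assms v by auto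
  have "\<exists>I'\<in>C0. wt v I = wt v I'" if "I \<in> par C0 y x" for I
    using that w unfolding mem_par by auto
  moreover have "wt v I = wt v J" if "I \<in> C0" "J \<in> C0" for I J using linealD[of v C0] v that by blast
  ultimately show "v \<in> lineal (par C0 y x)" by (intro linealI) metis
qed

text \<open>The axis of the loop \<open>x\<close> belongs to the lineality space of
  \<open>C0\<close> but violates \<open>v_x = v_y\<close>, so the extension costs exactly one
  dimension.\<close>

lemma dim_lineal_par:
  assumes "C0 \<subseteq> D0" "y \<in> \<Union>C0"
  shows "dim (lineal C0) = Suc (dim (lineal (par C0 y x)))"
proof -
  let ?P = "lineal (par C0 y x)"
  have ax: "axis x 1 \<in> lineal C0" using assms x_notin by (simp add: lineal_def wt_axis subset_iff)
  have "lineal C0 = span (insert (axis x 1) ?P)"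
  proof (intro equalityI subsetI)
    fix v assume v: "v \<in> lineal C0"
    let ?c = "v $ x - v $ y"
    have "v - ?c *\<^sub>R axis x 1 \<in> lineal C0" using v ax subspace_lineal subspace_diff subspace_mul by metis
    moreover have "(v - ?c *\<^sub>R axis x 1) $ x = (v - ?c *\<^sub>R axis x 1) $ y"
      using xy by (simp add: axis_def)
    ultimately have "v - ?c *\<^sub>R axis x 1 \<in> ?P" using lineal_par[OF assms] by blast
    then show "v \<in> span (insert (axis x 1) ?P)" by (meson span_breakdown_eq span_base)
  next
    fix v assume "v \<in> span (insert (axis x 1) ?P)"
    moreover have "span (insert (axis x 1) ?P) \<subseteq> lineal C0"
      using ax lineal_antimono[OF subset_par[of C0 y x]] subspace_lineal by (intro span_minimal) auto
    ultimately show "v \<in> lineal C0" by blast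
  qed
  then have "dim (lineal C0) = dim (insert (axis x 1) ?P)" by simp
  moreover have "axis x 1 \<notin> span ?P"
  proof -
    have "span ?P = ?P" using subspace_lineal span_eq_iff by metis
    moreover have "axis x 1 \<notin> ?P" unfolding lineal_par[OF assms] using xy by (simp add: axis_def)
    ultimately show ?thesis by metis
  qed
  ultimately show ?thesis by (simp add: dim_insert)
qed

lemma Union_par: "y \<in> \<Union>C0 \<Longrightarrow> \<Union>(par C0 y x) = insert x (\<Union>C0)"
  unfolding par_def by auto

end

section \<open>Balance of series-parallel families\<close>

text \<open>The region of a face \<open>C\<close> of \<open>D\<close> has the region of \<open>D\<close> as a face; \<open>pos D C e f\<close> says that the minimum
  of \<open>u_e - u_f\<close> on the former is attained exactly on the latter.\<close>

definition pos :: "'n::finite set set \<Rightarrow> 'n set set \<Rightarrow> 'n \<Rightarrow> 'n \<Rightarrow> bool" where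
  "pos D C e f \<longleftrightarrow> (\<forall>u. C \<subseteq> max_face D u \<longrightarrow>
     u $ f \<le> u $ e \<and> (u $ e = u $ f \<longrightarrow> max_face D u = D))"

text \<open>On the cell of \<open>D\<close> the difference \<open>w_e - w_f\<close> is constant. By
  \<open>pos_tied\<close> this is necessary for \<open>D\<close> to be the face of a larger cell on
  which the difference is minimal.\<close>

definition tied :: "'n::finite set set \<Rightarrow> 'n \<Rightarrow> 'n \<Rightarrow> bool" where
  "tied D e f \<longleftrightarrow> (\<forall>v\<in>lineal D. v $ e = v $ f)"

text \<open>The flags \<open>a\<close> and \<open>b\<close> tell whether \<open>e\<close> may become a coloop and \<open>f\<close> a loop.\<close>

definition pos_faces :: "'n::finite set set \<Rightarrow> 'n \<Rightarrow> 'n \<Rightarrow> bool \<Rightarrow> bool \<Rightarrow> 'n set set set" where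
  "pos_faces D e f a b = {C. (\<exists>u. C = max_face D u) \<and> \<Union>D \<subseteq> \<Union>C \<union> (if b then {f} else {}) \<and>
     \<Inter>C \<subseteq> \<Inter>D \<union> (if a then {e} else {}) \<and> pos D C e f}"

text \<open>The exponent is the codimension of the cell of \<open>D\<close> in the closure of the
  cell of \<open>C\<close>, so the sum depends only on the local structure at
  \<open>D\<close>.\<close>

definition pos_poly :: "'a::comm_semiring_1 \<Rightarrow> 'n::finite set set \<Rightarrow> 'n \<Rightarrow> 'n \<Rightarrow> bool \<Rightarrow> bool \<Rightarrow> 'a" where
  "pos_poly t D e f a b = (\<Sum>C\<in>pos_faces D e f a b. t ^ (dim (lineal C) - dim (lineal D)))"

lemma pos_tied:
  assumes "pos D C e f" "C \<subseteq> D"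
  shows "tied D e f"
  unfolding tied_def
proof
  fix v assume v: "v \<in> lineal D"
  then have "- v \<in> lineal D" using subspace_lineal subspace_neg by blast
  then have "max_face D v = D" "max_face D (- v) = D" using v by (simp_all add: max_face_eq_iff)
  then have "v $ f \<le> v $ e" "(- v) $ f \<le> (- v) $ e" using assms unfolding pos_def by metis+
  then show "v $ e = v $ f" by simp
qed

text \<open>The region of \<open>C\<close> contains the axis of its coloop \<open>z\<close>, along
  which \<open>u_e - u_f\<close> stays \<open>0\<close>. The equality clause of \<open>pos\<close>
  puts this axis into the lineality space of \<open>D\<close>. For a loop the negative axis does the
  same.\<close>

lemma pos_coloop:
  assumes "pos D C e f" "C \<subseteq> D" "C \<noteq> {}" "z \<noteq> e" "z \<noteq> f" "z \<in> \<Inter>C"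
  shows "z \<in> \<Inter>D"
proof -
  let ?u = "axis z (1::real)"
  obtain I where I: "I \<in> C" using assms by auto
  have "C \<subseteq> max_face D ?u" using assms(2,6) by (auto simp: max_face_def wt_axis)
  moreover have "?u $ e = ?u $ f" using assms by (simp add: axis_def)
  ultimately have "max_face D ?u = D" using assms(1) unfolding pos_def by metis
  then have "?u \<in> lineal D" by (simp add: max_face_eq_iff)
  then have "wt ?u J = wt ?u I" if "J \<in> D" for J using that I assms(2) linealD[of ?u D J I] by auto
  moreover have "wt ?u I = 1" using I assms(6) by (simp add: wt_axis)
  ultimately have "z \<in> J" if "J \<in> D" for J using that by (metis wt_axis zero_neq_one)
  then show ?thesis by blast
qed

lemma pos_loop:
  assumes "pos D C e f" "C \<subseteq> D" "C \<noteq> {}" "z \<noteq> e" "z \<noteq> f" "z \<notin> \<Union>C"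
  shows "z \<notin> \<Union>D"
proof -
  let ?u = "axis z (-1::real)"
  obtain I where I: "I \<in> C" using assms by auto
  have "C \<subseteq> max_face D ?u" using assms(2,6) by (auto simp: max_face_def wt_axis)
  moreover have "?u $ e = ?u $ f" using assms by (simp add: axis_def)
  ultimately have "max_face D ?u = D" using assms(1) unfolding pos_def by metis
  then have "?u \<in> lineal D" by (simp add: max_face_eq_iff)
  then have "wt ?u J = wt ?u I" if "J \<in> D" for J using that I assms(2) linealD[of ?u D J I] by auto
  moreover have "wt ?u I = 0" using I assms(6) by (simp add: wt_axis)
  ultimately have "z \<notin> J" if "J \<in> D" for J using that by (metis wt_axis neg_equal_0_iff_equal zero_neq_one)
  then show ?thesis by blast
qed

text \<open>The axis of a coloop \<open>f\<close> would make \<open>u_e - u_f\<close> negative on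
  the region of \<open>C\<close>.\<close>

lemma pos_down_not_coloop:
  assumes "pos D C e f" "C \<subseteq> D" "e \<noteq> f"
  shows "f \<notin> \<Inter>C"
proof
  assume f: "f \<in> \<Inter>C"
  let ?u = "axis f (1::real)"
  have "C \<subseteq> max_face D ?u" using assms(2) f by (auto simp: max_face_def wt_axis)
  then have "?u $ f \<le> ?u $ e" using assms(1) unfolding pos_def by metis
  then show False using assms by (simp add: axis_def)
qed

lemma pos_faces_subset: "C \<in> pos_faces D e f a b \<Longrightarrow> C \<subseteq> D"
  unfolding pos_faces_def using max_face_subset by blast

lemma pos_faces_nonempty: "C \<in> pos_faces D e f a b \<Longrightarrow> D \<noteq> {} \<Longrightarrow> C \<noteq> {}"
  unfolding pos_faces_def mem_Collect_eq using max_face_nonempty by metis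

lemma dim_lineal_mono: "C \<subseteq> D \<Longrightarrow> dim (lineal D) \<le> dim (lineal C)"
  by (simp add: dim_subset lineal_antimono)

lemma uminus_image_subset_iff: "uminus ` C \<subseteq> uminus ` D \<longleftrightarrow> C \<subseteq> (D :: 'n set set)"
  by (rule inj_image_subset_iff) (simp add: inj_def)

lemma uminus_image_eq_iff: "uminus ` C = uminus ` D \<longleftrightarrow> C = (D :: 'n set set)"
  by (rule inj_image_eq_iff) (simp add: inj_def)

text \<open>Complementation replaces \<open>u\<close> by \<open>- u\<close>, which the exchange of
  \<open>e\<close> and \<open>f\<close> compensates. As loops and coloops change places too, the
  flags are exchanged in \<open>pos_faces_dual\<close>.\<close>

lemma pos_dual: "pos (uminus ` D) (uminus ` C) f e \<longleftrightarrow> pos D C e f"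
proof -
  have "pos (uminus ` D) (uminus ` C) f e \<longleftrightarrow> (\<forall>u. C \<subseteq> max_face D (- u) \<longrightarrow>
     u $ e \<le> u $ f \<and> (u $ f = u $ e \<longrightarrow> max_face D (- u) = D))"
    unfolding pos_def max_face_dual uminus_image_subset_iff uminus_image_eq_iff ..
  also have "\<dots> \<longleftrightarrow> pos D C e f"
  proof
    assume h: "\<forall>u. C \<subseteq> max_face D (- u) \<longrightarrow> u $ e \<le> u $ f \<and> (u $ f = u $ e \<longrightarrow> max_face D (- u) = D)"
    show "pos D C e f" unfolding pos_def
    proof (intro allI impI)
      fix u assume "C \<subseteq> max_face D u"
      then show "u $ f \<le> u $ e \<and> (u $ e = u $ f \<longrightarrow> max_face D u = D)"
        using h[rule_format, of "- u"] by auto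
    qed
  next
    assume h: "pos D C e f"
    show "\<forall>u. C \<subseteq> max_face D (- u) \<longrightarrow> u $ e \<le> u $ f \<and> (u $ f = u $ e \<longrightarrow> max_face D (- u) = D)"
    proof (intro allI impI)
      fix u assume "C \<subseteq> max_face D (- u)"
      then show "u $ e \<le> u $ f \<and> (u $ f = u $ e \<longrightarrow> max_face D (- u) = D)"
        using h[unfolded pos_def, rule_format, of "- u"] by auto
    qed
  qed
  finally show ?thesis .
qed

lemma Union_dual: "D \<noteq> {} \<Longrightarrow> \<Union>(uminus ` D) = - \<Inter>(D :: 'n set set)"
  by auto

lemma Inter_dual: "D \<noteq> {} \<Longrightarrow> \<Inter>(uminus ` D) = - \<Union>(D :: 'n set set)"
  by auto

lemma pos_faces_dual:
  assumes "D \<noteq> {}"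
  shows "pos_faces (uminus ` D) f e b a = (`) uminus ` pos_faces D e f a b"
proof -
  have k: "uminus ` C \<in> pos_faces (uminus ` D) f e b a" if hC: "C \<in> pos_faces D e f a b" and hD: "D \<noteq> {}" for C D e f a b
  proof -
    obtain u where u: "C = max_face D u" using hC by (auto simp: pos_faces_def)
    have ne: "C \<noteq> {}" using pos_faces_nonempty[OF hC hD] .
    have 1: "uminus ` C = max_face (uminus ` D) (- u)" by (simp add: max_face_dual u)
    have 2: "\<Union>D \<subseteq> \<Union>C \<union> (if b then {f} else {})" "\<Inter>C \<subseteq> \<Inter>D \<union> (if a then {e} else {})"
      and 3: "pos D C e f"
      using hC by (simp_all add: pos_faces_def)
    have 4: "- \<Inter>D \<subseteq> - \<Inter>C \<union> (if a then {e} else {})" using 2(2) by blast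
    have 5: "- \<Union>C \<subseteq> - \<Union>D \<union> (if b then {f} else {})" using 2(1) by blast
    show ?thesis
      unfolding pos_faces_def mem_Collect_eq Union_dual[OF ne] Inter_dual[OF ne] Union_dual[OF hD] Inter_dual[OF hD] pos_dual
      using 1 3 4 5 by blast
  qed
  show ?thesis
  proof (intro equalityI subsetI)
    fix C assume C: "C \<in> pos_faces (uminus ` D) f e b a"
    have "uminus ` C \<in> pos_faces (uminus ` uminus ` D) e f a b" using k[OF C] assms by simp
    then have "uminus ` C \<in> pos_faces D e f a b" by simp
    moreover have "C = uminus ` uminus ` C" by simp
    ultimately show "C \<in> (`) uminus ` pos_faces D e f a b" by (metis image_eqI)
  next
    fix C assume "C \<in> (`) uminus ` pos_faces D e f a b"
    then obtain C' where "C' \<in> pos_faces D e f a b" "C = uminus ` C'" by blast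
    then show "C \<in> pos_faces (uminus ` D) f e b a" using k assms by simp
  qed
qed

lemma pos_poly_dual:
  assumes "D \<noteq> {}"
  shows "pos_poly t (uminus ` D) f e b a = pos_poly t D e f a b"
proof -
  have "inj_on ((`) uminus) (pos_faces D e f a b)" by (rule inj_onI) (simp add: uminus_image_eq_iff)
  then show ?thesis unfolding pos_poly_def pos_faces_dual[OF assms] by (simp add: sum.reindex lineal_dual)
qed

lemma tied_dual: "tied (uminus ` D) e f \<longleftrightarrow> tied D e f"
  by (simp add: tied_def lineal_dual)

text \<open>The second and third identities are not needed for counting, but the induction over parallel and
  series extensions mixes all three.\<close>

definition balanced :: "'a::comm_semiring_1 \<Rightarrow> 'n::finite set set \<Rightarrow> bool" where
  "balanced t D \<longleftrightarrow> (\<forall>e f. e \<noteq> f \<longrightarrow> tied D e f \<longrightarrow>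
     pos_poly t D e f True True = (1 + t) * pos_poly t D f e False False \<and>
     pos_poly t D e f True False = pos_poly t D f e True False \<and>
     pos_poly t D e f False True = pos_poly t D f e False True)"

lemma tied_sym: "tied D e f \<longleftrightarrow> tied D f e"
  by (auto simp: tied_def)

lemma balanced_dual:
  assumes "D \<noteq> {}" "balanced t (uminus ` D)"
  shows "balanced t D"
  unfolding balanced_def
proof (intro allI impI)
  fix e f assume h: "e \<noteq> f" "tied D e f"
  have "tied (uminus ` D) f e" using h tied_dual tied_sym by metis
  then have "pos_poly t (uminus ` D) f e True True = (1 + t) * pos_poly t (uminus ` D) e f False False \<and>
     pos_poly t (uminus ` D) f e True False = pos_poly t (uminus ` D) e f True False \<and>
     pos_poly t (uminus ` D) f e False True = pos_poly t (uminus ` D) e f False True"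
    using assms(2) h(1) unfolding balanced_def by metis
  then show "pos_poly t D e f True True = (1 + t) * pos_poly t D f e False False \<and>
     pos_poly t D e f True False = pos_poly t D f e True False \<and>
     pos_poly t D e f False True = pos_poly t D f e False True"
    unfolding pos_poly_dual[OF assms(1)] by simp
qed

context par_ext
begin

definition rep :: "'n \<Rightarrow> 'n" where "rep z = (if z = x then y else z)"

text \<open>A direction whose maximal face contains an extension has \<open>u_x = u_y\<close>, so
  \<open>x\<close> can be read as \<open>y\<close>, which is the purpose of \<open>rep\<close>.
  Conversely every direction for \<open>D0\<close> becomes such a direction after a reset of
  coordinate \<open>x\<close>.\<close>

lemma pos_par:
  assumes "C0 \<subseteq> D0" "y \<in> \<Union>C0"
  shows "pos D (par C0 y x) e f \<longleftrightarrow> pos D0 C0 (rep e) (rep f)"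
proof
  assume h: "pos D (par C0 y x) e f"
  show "pos D0 C0 (rep e) (rep f)" unfolding pos_def
  proof (intro allI impI)
    fix u assume u: "C0 \<subseteq> max_face D0 u"
    let ?u = "reset x (u $ y) u"
    have m: "max_face D0 ?u = max_face D0 u" by (rule max_face_reset[OF x_loop])
    have e: "?u $ x = ?u $ y" by simp
    have "par C0 y x \<subseteq> max_face D ?u" using par_max_face_iff[OF assms, of ?u] u m e by simp
    then have k: "?u $ f \<le> ?u $ e" "?u $ e = ?u $ f \<longrightarrow> max_face D ?u = D" using h unfolding pos_def by metis+
    have r: "?u $ z = u $ rep z" for z by (simp add: rep_def)
    have "max_face D ?u = D \<Longrightarrow> max_face D0 u = D0"
      using max_face_eq[OF e] par_inj[of "max_face D0 ?u" D0] max_face_subset[of D0 ?u] m by simp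
    then show "u $ rep f \<le> u $ rep e \<and> (u $ rep e = u $ rep f \<longrightarrow> max_face D0 u = D0)"
      using k unfolding r by metis
  qed
next
  assume h: "pos D0 C0 (rep e) (rep f)"
  show "pos D (par C0 y x) e f" unfolding pos_def
  proof (intro allI impI)
    fix u assume "par C0 y x \<subseteq> max_face D u"
    then have u: "u $ x = u $ y" "C0 \<subseteq> max_face D0 u" using par_max_face_iff[OF assms] by simp_all
    have r: "u $ rep z = u $ z" for z using u by (simp add: rep_def)
    have "u $ rep f \<le> u $ rep e" "u $ rep e = u $ rep f \<longrightarrow> max_face D0 u = D0"
      using h u unfolding pos_def by metis+
    then show "u $ f \<le> u $ e \<and> (u $ e = u $ f \<longrightarrow> max_face D u = D)"
      unfolding r using max_face_eq[OF u(1)] by simp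
  qed
qed

lemma pos_faces_par:
  assumes "e \<noteq> f" "e \<noteq> y" "f \<noteq> y" "\<not> (b \<and> f = x)"
  shows "pos_faces D e f a b = (\<lambda>C. par C y x) ` pos_faces D0 (rep e) (rep f) (a \<or> e = x) b"
proof (intro equalityI subsetI)
  have D0: "D0 \<noteq> {}" using y_nonloop by auto
  have xD: "x \<in> \<Union>D" "y \<in> \<Union>D" using y_nonloop Union_par[of D0] by auto
  fix C assume C: "C \<in> pos_faces D e f a b"
  obtain u where u: "C = max_face D u" using C by (auto simp: pos_faces_def)
  have c: "\<Union>D \<subseteq> \<Union>C \<union> (if b then {f} else {})" "\<Inter>C \<subseteq> \<Inter>D \<union> (if a then {e} else {})" "pos D C e f"
    using C by (auto simp: pos_faces_def)
  have xC: "x \<in> \<Union>C" using c(1) xD assms(4) by (auto split: if_splits)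
  have yC: "y \<in> \<Union>C" using c(1) xD assms(3) by (auto split: if_splits)
  have "\<not> u $ x < u $ y"
  proof
    assume "u $ x < u $ y"
    then have "C \<subseteq> D0" using max_face_less u max_face_subset by metis
    then show False using xC x_loop by auto
  qed
  moreover have "\<not> u $ y < u $ x" using max_face_greater yC u by auto
  ultimately have ux: "u $ x = u $ y" by simp
  let ?C = "max_face D0 u"
  have CC: "C = par ?C y x" using max_face_eq[OF ux] u by simp
  have sub: "?C \<subseteq> D0" by (rule max_face_subset)
  have ne: "?C \<noteq> {}" by (rule max_face_nonempty[OF D0])
  obtain I0 where I0: "I0 \<in> C" "y \<in> I0" using yC by blast
  have "I0 \<in> ?C" using I0 y_not_in_swapped unfolding CC mem_par by metis
  then have y0: "y \<in> \<Union>?C" using I0(2) by blast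
  have p: "pos D0 ?C (rep e) (rep f)" using c(3) pos_par[OF sub y0] CC by simp
  have U: "\<Union>D0 \<subseteq> \<Union>?C \<union> (if b then {rep f} else {})"
  proof
    fix z assume z: "z \<in> \<Union>D0"
    then have zx: "z \<noteq> x" using x_loop by auto
    have "z \<in> \<Union>D" using z Union_par[OF y_nonloop] by auto
    then have "z \<in> \<Union>C \<union> (if b then {f} else {})" using c(1) by (rule subsetD[rotated])
    then have "z \<in> insert x (\<Union>?C) \<union> (if b then {f} else {})" using Union_par[OF y0] CC by simp
    then show "z \<in> \<Union>?C \<union> (if b then {rep f} else {})" using zx assms(4) by (auto simp: rep_def split: if_splits)
  qed
  have V: "\<Inter>?C \<subseteq> \<Inter>D0 \<union> (if a \<or> e = x then {rep e} else {})"
  proof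
    fix z assume z: "z \<in> \<Inter>?C"
    obtain I1 where I1: "I1 \<in> ?C" using ne by blast
    have zx: "z \<noteq> x" using z I1 sub x_notin by blast
    show "z \<in> \<Inter>D0 \<union> (if a \<or> e = x then {rep e} else {})"
    \<comment> \<open>Only \<open>y\<close> can be a coloop of the smaller face without being one of
      its extension.\<close>
    proof (cases "z = y")
      case False
      have "z \<in> I" if "I \<in> C" for I
        using that z zx False unfolding CC mem_par by blast
      then have "z \<in> \<Inter>C" by blast
      then have "z \<in> \<Inter>D \<union> (if a then {e} else {})" using c(2) by auto
      moreover have "\<Inter>D \<subseteq> \<Inter>D0" using subset_par by (metis Inter_anti_mono)
      ultimately show ?thesis using zx by (auto simp: rep_def split: if_splits)
    next
      case True
      show ?thesis
      proof (cases "e = x")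
        case True
        then show ?thesis using \<open>z = y\<close> by (simp add: rep_def)
      next
        case ex: False
        have "rep e \<noteq> rep f" using assms by (auto simp: rep_def)
        then have "z \<noteq> rep f" using pos_down_not_coloop[OF p sub] z by auto
        moreover have "z \<noteq> rep e" using True ex assms by (auto simp: rep_def)
        ultimately show ?thesis using pos_coloop[OF p sub ne _ _ z] by auto
      qed
    qed
  qed
  have "?C \<in> pos_faces D0 (rep e) (rep f) (a \<or> e = x) b" unfolding pos_faces_def using U V p by blast
  then show "C \<in> (\<lambda>C. par C y x) ` pos_faces D0 (rep e) (rep f) (a \<or> e = x) b" using CC by blast
next
  have D0: "D0 \<noteq> {}" using y_nonloop by auto
  fix C assume "C \<in> (\<lambda>C. par C y x) ` pos_faces D0 (rep e) (rep f) (a \<or> e = x) b"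
  then obtain C0 where C0: "C0 \<in> pos_faces D0 (rep e) (rep f) (a \<or> e = x) b" and CC: "C = par C0 y x" by blast
  obtain u where u: "C0 = max_face D0 u" using C0 by (auto simp: pos_faces_def)
  have c: "\<Union>D0 \<subseteq> \<Union>C0 \<union> (if b then {rep f} else {})" "\<Inter>C0 \<subseteq> \<Inter>D0 \<union> (if a \<or> e = x then {rep e} else {})"
    "pos D0 C0 (rep e) (rep f)"
    using C0 by (auto simp: pos_faces_def)
  have sub: "C0 \<subseteq> D0" using pos_faces_subset[OF C0] .
  have y0: "y \<in> \<Union>C0" using c(1) y_nonloop assms by (auto simp: rep_def split: if_splits)
  let ?u = "reset x (u $ y) u"
  have "max_face D ?u = par (max_face D0 ?u) y x" by (rule max_face_eq) simp
  then have 1: "C = max_face D ?u" using CC u max_face_reset[OF x_loop] by simp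
  have 2: "pos D C e f" using pos_par[OF sub y0] c(3) CC by simp
  have 3: "\<Union>D \<subseteq> \<Union>C \<union> (if b then {f} else {})"
    unfolding CC Union_par[OF y0] Union_par[OF y_nonloop] using c(1) assms(4)
    by (auto simp: rep_def split: if_splits)
  have 4: "\<Inter>C \<subseteq> \<Inter>D \<union> (if a then {e} else {})"
  proof
    fix z assume z: "z \<in> \<Inter>C"
    obtain I where I: "I \<in> C0" "y \<in> I" using y0 by auto
    then have "insert x (I - {y}) \<in> C" unfolding CC mem_par by blast
    then have zy: "z \<noteq> y" using z y_not_in_swapped by blast
    have "z \<in> \<Inter>C0" using z subset_par[of C0 y x] unfolding CC by auto
    then have "z \<in> \<Inter>D0 \<union> (if a \<or> e = x then {rep e} else {})" using c(2) by auto
    moreover have "z \<in> \<Inter>D" if "z \<in> \<Inter>D0" using that zy by (auto simp: mem_par)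
    ultimately show "z \<in> \<Inter>D \<union> (if a then {e} else {})" using zy by (auto simp: rep_def split: if_splits)
  qed
  show "C \<in> pos_faces D e f a b" unfolding pos_faces_def using 1 2 3 4 by blast
qed

lemma pos_poly_par:
  assumes "e \<noteq> f" "e \<noteq> y" "f \<noteq> y" "\<not> (b \<and> f = x)"
  shows "pos_poly t D e f a b = pos_poly t D0 (rep e) (rep f) (a \<or> e = x) b"
proof -
  let ?S = "pos_faces D0 (rep e) (rep f) (a \<or> e = x) b"
  have sub: "C \<subseteq> D0" if "C \<in> ?S" for C using pos_faces_subset[OF that] .
  have y0: "y \<in> \<Union>C" if "C \<in> ?S" for C
  proof -
    have "\<Union>D0 \<subseteq> \<Union>C \<union> (if b then {rep f} else {})" using that by (simp add: pos_faces_def)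
    moreover have "y \<notin> (if b then {rep f} else {})" using assms by (simp add: rep_def)
    ultimately show ?thesis using y_nonloop by blast
  qed
  have "inj_on (\<lambda>C. par C y x) ?S" by (rule inj_onI) (use sub par_inj in blast)
  then have "pos_poly t D e f a b = (\<Sum>C\<in>?S. t ^ (dim (lineal (par C y x)) - dim (lineal D)))"
    unfolding pos_poly_def pos_faces_par[OF assms] by (simp add: sum.reindex)
  also have "\<dots> = (\<Sum>C\<in>?S. t ^ (dim (lineal C) - dim (lineal D0)))"
  proof (rule sum.cong[OF refl])
    fix C assume C: "C \<in> ?S"
    show "t ^ (dim (lineal (par C y x)) - dim (lineal D)) = t ^ (dim (lineal C) - dim (lineal D0))"
      using dim_lineal_par[OF sub[OF C] y0[OF C]] dim_lineal_par[OF order_refl y_nonloop] by simp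
  qed
  finally show ?thesis by (simp add: pos_poly_def)
qed

end

context par_ext
begin

lemma Inter_D0: "z \<in> \<Inter>D0 \<Longrightarrow> z \<noteq> y \<Longrightarrow> z \<in> \<Inter>D"
  by (rule InterI) (auto simp: mem_par)

lemma Inter_D_subset: "\<Inter>D \<subseteq> \<Inter>D0"
  using subset_par by (metis Inter_anti_mono)

lemma Union_D: "\<Union>D = insert x (\<Union>D0)"
  by (rule Union_par[OF y_nonloop])

lemma max_face_x_loop:
  assumes "x \<notin> \<Union>(max_face D u)" "y \<in> \<Union>(max_face D u)"
  shows "u $ x < u $ y"
proof -
  obtain I where I: "I \<in> max_face D u" "y \<in> I" using assms(2) by blast
  have "\<not> u $ y < u $ x" using max_face_greater[OF _ I(1)] I(2) by blast
  moreover have "u $ x \<noteq> u $ y"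
  proof
    assume e: "u $ x = u $ y"
    have "I \<in> max_face D0 u" using I y_not_in_swapped unfolding max_face_eq[OF e] mem_par by metis
    then have "insert x (I - {y}) \<in> max_face D u" unfolding max_face_eq[OF e] mem_par using I by blast
    then show False using assms(1) by blast
  qed
  ultimately show ?thesis by simp
qed

lemma pos_x_loop:
  assumes "C \<subseteq> D0" "e \<noteq> x" "pos D C e x"
  shows "pos D0 C e y"
  unfolding pos_def
proof (intro allI impI)
  fix u assume u: "C \<subseteq> max_face D0 u"
  let ?u = "reset x (u $ y) u"
  have e: "?u $ x = ?u $ y" by simp
  have m: "max_face D0 ?u = max_face D0 u" by (rule max_face_reset[OF x_loop])
  have "C \<subseteq> max_face D ?u" unfolding max_face_eq[OF e] m using u subset_par by (meson order_trans)
  then have k: "?u $ x \<le> ?u $ e" "?u $ e = ?u $ x \<longrightarrow> max_face D ?u = D" using assms(3) unfolding pos_def by metis+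
  have "max_face D ?u = D \<Longrightarrow> max_face D0 u = D0"
    using max_face_eq[OF e] par_inj[of "max_face D0 ?u" D0] max_face_subset[of D0 ?u] m by simp
  then show "u $ y \<le> u $ e \<and> (u $ e = u $ y \<longrightarrow> max_face D0 u = D0)" using k assms(2) by simp
qed

lemma pos_x_loop':
  assumes "C \<subseteq> D0" "y \<in> \<Union>C" "pos D0 C e y"
  shows "pos D C e x"
  unfolding pos_def
proof (intro allI impI)
  fix u assume u: "C \<subseteq> max_face D u"
  obtain I where I: "I \<in> C" "y \<in> I" using assms(2) by blast
  have ID: "I \<in> D0" using I assms(1) by blast
  have "insert x (I - {y}) \<in> D" unfolding mem_par using ID I by blast
  moreover have "I \<in> max_face D u" using u I by blast
  ultimately have "wt u (insert x (I - {y})) \<le> wt u I" unfolding max_face_def by simp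
  then have xy: "u $ x \<le> u $ y" using wt_swap[OF ID I(2)] by simp
  have "C \<subseteq> max_face D0 u"
  proof
    fix J assume "J \<in> C"
    then have "J \<in> max_face D u" "J \<in> D0" using u assms(1) by blast+
    then show "J \<in> max_face D0 u" unfolding max_face_def using subset_par[of D0 y x] by blast
  qed
  then have k: "u $ y \<le> u $ e" "u $ e = u $ y \<longrightarrow> max_face D0 u = D0" using assms(3) unfolding pos_def by metis+
  have "max_face D u = D" if "u $ e = u $ x"
  proof -
    have e: "u $ x = u $ y" using that xy k by linarith
    then show ?thesis using max_face_eq[OF e] k that by simp
  qed
  then show "u $ x \<le> u $ e \<and> (u $ e = u $ x \<longrightarrow> max_face D u = D)" using xy k by simp
qed

text \<open>Permission for \<open>x\<close> to become a loop adds the faces with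
  \<open>u_x < u_y\<close>, which are faces of \<open>D0\<close>. On their regions in
  \<open>D\<close> one has \<open>u_x \<le> u_y \<le> u_e\<close>, so minimality with respect to
  \<open>x\<close> in \<open>D\<close> and with respect to \<open>y\<close> in \<open>D0\<close> are
  the same condition.\<close>

lemma pos_faces_down_x:
  assumes "e \<noteq> x" "e \<noteq> y"
  shows "pos_faces D e x a True = pos_faces D e x a False \<union> pos_faces D0 e y a False"
    and "pos_faces D e x a False \<inter> pos_faces D0 e y a False = {}"
proof -
  show "pos_faces D e x a True = pos_faces D e x a False \<union> pos_faces D0 e y a False"
  proof (intro equalityI subsetI)
    fix C assume C: "C \<in> pos_faces D e x a True"
    obtain u where u: "C = max_face D u" using C by (auto simp: pos_faces_def)
    have c: "\<Union>D \<subseteq> \<Union>C \<union> {x}" "\<Inter>C \<subseteq> \<Inter>D \<union> (if a then {e} else {})" "pos D C e x"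
      using C by (simp_all add: pos_faces_def)
    show "C \<in> pos_faces D e x a False \<union> pos_faces D0 e y a False"
    proof (cases "x \<in> \<Union>C")
      case True
      then have "\<Union>D \<subseteq> \<Union>C" using c(1) by blast
      then have "C \<in> pos_faces D e x a False" unfolding pos_faces_def using u c(2,3) by auto
      then show ?thesis by blast
    next
      case False
      have yC: "y \<in> \<Union>C" using c(1) Union_D y_nonloop xy by blast
      have lt: "u $ x < u $ y" using max_face_x_loop False yC u by metis
      have u0: "C = max_face D0 u" using max_face_less[OF lt] u by simp
      have sub: "C \<subseteq> D0" using u0 max_face_subset by simp
      have p: "pos D0 C e y" by (rule pos_x_loop[OF sub assms(1) c(3)])
      have 1: "\<Union>D0 \<subseteq> \<Union>C" using c(1) Union_D x_loop by blast
      have 2: "\<Inter>C \<subseteq> \<Inter>D0 \<union> (if a then {e} else {})" using c(2) Inter_D_subset by blast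
      have "C \<in> pos_faces D0 e y a False" unfolding pos_faces_def using u0 p 1 2 by auto
      then show ?thesis by blast
    qed
  next
    fix C assume "C \<in> pos_faces D e x a False \<union> pos_faces D0 e y a False"
    then show "C \<in> pos_faces D e x a True"
    proof
      assume "C \<in> pos_faces D e x a False"
      then show ?thesis unfolding pos_faces_def by auto
    next
      assume C: "C \<in> pos_faces D0 e y a False"
      obtain u where u: "C = max_face D0 u" using C by (auto simp: pos_faces_def)
      have c: "\<Union>D0 \<subseteq> \<Union>C" "\<Inter>C \<subseteq> \<Inter>D0 \<union> (if a then {e} else {})" "pos D0 C e y"
        using C by (simp_all add: pos_faces_def)
      have sub: "C \<subseteq> D0" using u max_face_subset by simp
      have yC: "y \<in> \<Union>C" using c(1) y_nonloop by blast
      let ?u = "reset x (u $ y - 1) u"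
      have "max_face D ?u = max_face D0 ?u" by (rule max_face_less) (use xy in simp)
      then have 1: "C = max_face D ?u" using u max_face_reset[OF x_loop] by simp
      have 2: "pos D C e x" by (rule pos_x_loop'[OF sub yC c(3)])
      have ynot: "y \<notin> \<Inter>C" using pos_down_not_coloop[OF c(3) sub assms(2)] .
      have 3: "\<Inter>C \<subseteq> \<Inter>D \<union> (if a then {e} else {})"
      proof
        fix z assume z: "z \<in> \<Inter>C"
        then have "z \<noteq> y" using ynot by blast
        moreover have "z \<in> \<Inter>D0 \<union> (if a then {e} else {})" using z c(2) by blast
        ultimately show "z \<in> \<Inter>D \<union> (if a then {e} else {})" using Inter_D0 by blast
      qed
      have 4: "\<Union>D \<subseteq> \<Union>C \<union> {x}" using c(1) Union_D by blast
      show ?thesis unfolding pos_faces_def mem_Collect_eq if_True using 1 2 3 4 by blast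
    qed
  qed
  show "pos_faces D e x a False \<inter> pos_faces D0 e y a False = {}"
  proof (rule ccontr)
    assume "pos_faces D e x a False \<inter> pos_faces D0 e y a False \<noteq> {}"
    then obtain C where C: "C \<in> pos_faces D e x a False" "C \<in> pos_faces D0 e y a False" by blast
    have "x \<in> \<Union>C" using C(1) Union_D by (auto simp: pos_faces_def)
    moreover have "C \<subseteq> D0" using pos_faces_subset[OF C(2)] .
    ultimately show False using x_loop by blast
  qed
qed

text \<open>Each face of \<open>D0\<close> on the right occurs twice on the left: as its extension,
  with unchanged codimension, and as itself, with codimension larger by one. This is the source of
  the factor \<open>1 + t\<close>.\<close>

lemma pos_poly_down_x:
  fixes t :: "'a::comm_semiring_1"
  assumes "e \<noteq> x" "e \<noteq> y"
  shows "pos_poly t D e x a True = (1 + t) * pos_poly t D0 e y a False"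
proof -
  have d: "dim (lineal D0) = Suc (dim (lineal D))" by (rule dim_lineal_par[OF order_refl y_nonloop])
  have "pos_poly t D e x a True = pos_poly t D e x a False + (\<Sum>C\<in>pos_faces D0 e y a False. t ^ (dim (lineal C) - dim (lineal D)))"
    unfolding pos_poly_def pos_faces_down_x(1)[OF assms] by (rule sum.union_disjoint) (simp_all add: pos_faces_down_x(2)[OF assms])
  also have "pos_poly t D e x a False = pos_poly t D0 e y a False"
    using pos_poly_par[of e x False t a] assms xy by (simp add: rep_def)
  also have "(\<Sum>C\<in>pos_faces D0 e y a False. t ^ (dim (lineal C) - dim (lineal D)))
    = (\<Sum>C\<in>pos_faces D0 e y a False. t * t ^ (dim (lineal C) - dim (lineal D0)))"
  proof (rule sum.cong[OF refl])
    fix C assume C: "C \<in> pos_faces D0 e y a False"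
    have "dim (lineal D0) \<le> dim (lineal C)" by (rule dim_lineal_mono[OF pos_faces_subset[OF C]])
    then have "dim (lineal C) - dim (lineal D) = Suc (dim (lineal C) - dim (lineal D0))" using d by simp
    then show "t ^ (dim (lineal C) - dim (lineal D)) = t * t ^ (dim (lineal C) - dim (lineal D0))" by simp
  qed
  also have "\<dots> = t * pos_poly t D0 e y a False" unfolding pos_poly_def by (simp add: sum_distrib_left)
  finally show ?thesis by (simp add: algebra_simps)
qed

lemma lineal_D_xy: "v \<in> lineal D \<Longrightarrow> v $ x = v $ y"
  using lineal_par[OF order_refl y_nonloop] by blast

text \<open>If neither \<open>x\<close> nor \<open>y\<close> becomes a loop, then
  \<open>u_x = u_y\<close>, and the equality clause of \<open>pos\<close> leaves only
  \<open>D\<close>.\<close>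

lemma pos_faces_pair_False:
  assumes "(e = x \<and> f = y) \<or> (e = y \<and> f = x)"
  shows "pos_faces D e f a False = {D}"
proof (intro equalityI subsetI)
  fix C assume C: "C \<in> pos_faces D e f a False"
  obtain u where u: "C = max_face D u" using C by (auto simp: pos_faces_def)
  have c: "\<Union>D \<subseteq> \<Union>C" "pos D C e f" using C by (simp_all add: pos_faces_def)
  have xC: "x \<in> \<Union>C" "y \<in> \<Union>C" using c(1) Union_D y_nonloop by blast+
  have "\<not> u $ x < u $ y"
  proof
    assume "u $ x < u $ y"
    then have "C \<subseteq> D0" using max_face_less u max_face_subset by metis
    then show False using xC x_loop by blast
  qed
  moreover have "\<not> u $ y < u $ x" using max_face_greater[of u] xC u by blast
  ultimately have "u $ e = u $ f" using assms by auto
  then have "max_face D u = D" using c(2) u unfolding pos_def by blast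
  then show "C \<in> {D}" using u by simp
next
  fix C assume "C \<in> {D}"
  then have C: "C = D" by simp
  have "pos D D e f" unfolding pos_def
  proof (intro allI impI)
    fix u assume "D \<subseteq> max_face D u"
    then have m: "max_face D u = D" using max_face_subset by blast
    then have "u \<in> lineal D" by (simp add: max_face_eq_iff)
    then have "u $ x = u $ y" by (rule lineal_D_xy)
    then show "u $ f \<le> u $ e \<and> (u $ e = u $ f \<longrightarrow> max_face D u = D)" using assms m by auto
  qed
  moreover have "D = max_face D 0" by (simp add: max_face_zero)
  ultimately show "C \<in> pos_faces D e f a False" unfolding pos_faces_def C by (simp, blast)
qed

lemma pos_poly_pair_False:
  assumes "(e = x \<and> f = y) \<or> (e = y \<and> f = x)"
  shows "pos_poly t D e f a False = 1"
  unfolding pos_poly_def pos_faces_pair_False[OF assms] by simp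

text \<open>A face in which \<open>x\<close> is a loop must be \<open>pos\<close> in
  \<open>D0\<close> for the pair \<open>y\<close>, \<open>y\<close>, where the difference is always
  \<open>0\<close>; hence it is \<open>D0\<close>. It is admissible unless \<open>y\<close> turns
  into a coloop there against the flag \<open>a\<close>.\<close>

lemma pos_faces_pair_True:
  "pos_faces D y x a True = insert D (if \<Inter>D0 \<subseteq> \<Inter>D \<union> (if a then {y} else {}) then {D0} else {})"
proof (intro equalityI subsetI)
  fix C assume C: "C \<in> pos_faces D y x a True"
  obtain u where u: "C = max_face D u" using C by (auto simp: pos_faces_def)
  have c: "\<Union>D \<subseteq> \<Union>C \<union> {x}" "\<Inter>C \<subseteq> \<Inter>D \<union> (if a then {y} else {})" "pos D C y x"
    using C by (simp_all add: pos_faces_def)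
  show "C \<in> insert D (if \<Inter>D0 \<subseteq> \<Inter>D \<union> (if a then {y} else {}) then {D0} else {})"
  proof (cases "x \<in> \<Union>C")
    case True
    then have "\<Union>D \<subseteq> \<Union>C" using c(1) by blast
    then have "C \<in> pos_faces D y x a False" unfolding pos_faces_def using u c(2,3) by auto
    then show ?thesis using pos_faces_pair_False by blast
  next
    case False
    have yC: "y \<in> \<Union>C" using c(1) Union_D y_nonloop xy by blast
    have lt: "u $ x < u $ y" using max_face_x_loop False yC u by metis
    have u0: "C = max_face D0 u" using max_face_less[OF lt] u by simp
    have sub: "C \<subseteq> D0" using u0 max_face_subset by simp
    have "pos D0 C y y" by (rule pos_x_loop[OF sub xy[symmetric] c(3)])
    then have "max_face D0 u = D0" using u0 unfolding pos_def by blast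
    then have "C = D0" using u0 by simp
    then show ?thesis using c(2) by simp
  qed
next
  fix C assume h: "C \<in> insert D (if \<Inter>D0 \<subseteq> \<Inter>D \<union> (if a then {y} else {}) then {D0} else {})"
  show "C \<in> pos_faces D y x a True"
  proof (cases "C = D")
    case True
    then have "C \<in> pos_faces D y x a False" using pos_faces_pair_False by blast
    then show ?thesis unfolding pos_faces_def by auto
  next
    case False
    then have C: "C = D0" "\<Inter>D0 \<subseteq> \<Inter>D \<union> (if a then {y} else {})" using h by (auto split: if_splits)
    let ?u = "reset x (-1) 0 :: real ^ 'n"
    have "max_face D ?u = max_face D0 ?u" by (rule max_face_less) (use xy in simp)
    then have 1: "D0 = max_face D ?u" using max_face_reset[OF x_loop] by (simp add: max_face_zero)
    have "pos D0 D0 y y" unfolding pos_def using max_face_subset by blast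
    then have 2: "pos D D0 y x" by (rule pos_x_loop'[OF order_refl y_nonloop])
    have 4: "\<Union>D \<subseteq> \<Union>D0 \<union> {x}" using Union_D by blast
    show ?thesis unfolding pos_faces_def C(1) mem_Collect_eq if_True using 1 2 4 C(2) by blast
  qed
qed

lemma pos_poly_pair_True:
  "pos_poly t D y x a True = 1 + (if a \<or> y \<notin> \<Inter>D0 then t else 0)"
proof -
  have d: "dim (lineal D0) = Suc (dim (lineal D))" by (rule dim_lineal_par[OF order_refl y_nonloop])
  have ne: "D \<noteq> D0" using Union_D x_loop by auto
  obtain I where "I \<in> D0" "y \<in> I" using y_nonloop by blast
  then have "insert x (I - {y}) \<in> D" unfolding mem_par by blast
  then have "y \<notin> \<Inter>D" using y_not_in_swapped by blast
  then have "\<Inter>D0 \<subseteq> \<Inter>D \<union> (if a then {y} else {}) \<longleftrightarrow> a \<or> y \<notin> \<Inter>D0"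
    using Inter_D0 by (auto simp del: Inter_iff split: if_splits)
  then show ?thesis unfolding pos_poly_def pos_faces_pair_True using ne d by auto
qed

lemma tied_par: "tied D e f \<Longrightarrow> tied D0 (rep e) (rep f)"
  unfolding tied_def
proof
  fix v assume h: "\<forall>v\<in>lineal D. v $ e = v $ f" and v: "v \<in> lineal D0"
  let ?v = "reset x (v $ y) v"
  have "max_face D0 ?v = D0" using v max_face_reset[OF x_loop] max_face_eq_iff by metis
  then have "?v \<in> lineal D0" by (simp add: max_face_eq_iff)
  then have "?v \<in> lineal D" using lineal_par[OF order_refl y_nonloop] by simp
  then have "?v $ e = ?v $ f" using h by blast
  moreover have "?v $ z = v $ rep z" for z by (simp add: rep_def)
  ultimately show "v $ rep e = v $ rep f" by metis
qed

text \<open>Passing to \<open>D0\<close> sets the flag at \<open>x\<close> when \<open>x\<close>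
  comes first, and produces a factor \<open>1 + t\<close> when \<open>x\<close> comes second and may
  be a loop. The four relations for \<open>x\<close> and \<open>f\<close> then reduce to the first
  two identities of \<open>D0\<close> for \<open>y\<close> and \<open>f\<close>.\<close>

lemma balanced_e:
  fixes t :: "'a::comm_semiring_1"
  assumes "balanced t D0" "f \<noteq> x" "f \<noteq> y" "tied D x f"
  shows "pos_poly t D x f True True = (1 + t) * pos_poly t D f x False False"
    "pos_poly t D f x True True = (1 + t) * pos_poly t D x f False False"
    "pos_poly t D x f True False = pos_poly t D f x True False"
    "pos_poly t D x f False True = pos_poly t D f x False True"
proof -
  have ti: "tied D0 y f" using tied_par[OF assms(4)] assms(2) by (simp add: rep_def)
  have b: "pos_poly t D0 y f True True = (1 + t) * pos_poly t D0 f y False False"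
    "pos_poly t D0 y f True False = pos_poly t D0 f y True False"
    using assms(1,3) ti unfolding balanced_def by metis+
  have e1: "pos_poly t D x f a b = pos_poly t D0 y f True b" for a b
    using pos_poly_par[of x f b t a] assms(2,3) xy by (simp add: rep_def)
  have e2: "pos_poly t D f x a False = pos_poly t D0 f y a False" for a
    using pos_poly_par[of f x False t a] assms(2,3) xy by (simp add: rep_def)
  have e3: "pos_poly t D f x a True = (1 + t) * pos_poly t D0 f y a False" for a
    using pos_poly_down_x[OF assms(2,3)] .
  show "pos_poly t D x f True True = (1 + t) * pos_poly t D f x False False"
    "pos_poly t D f x True True = (1 + t) * pos_poly t D x f False False"
    "pos_poly t D x f True False = pos_poly t D f x True False"
    "pos_poly t D x f False True = pos_poly t D f x False True"
    unfolding e1 e2 e3 b by simp_all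
qed

lemma balanced_other:
  assumes "balanced t D0" "e \<noteq> f" "e \<notin> {x, y}" "f \<notin> {x, y}" "tied D e f"
  shows "pos_poly t D e f True True = (1 + t) * pos_poly t D f e False False"
    "pos_poly t D e f True False = pos_poly t D f e True False"
    "pos_poly t D e f False True = pos_poly t D f e False True"
proof -
  have r: "rep e = e" "rep f = f" using assms by (auto simp: rep_def)
  have ti: "tied D0 e f" using tied_par[OF assms(5)] r by simp
  have e1: "pos_poly t D e f a b = pos_poly t D0 e f a b" "pos_poly t D f e a b = pos_poly t D0 f e a b" for a b
    using pos_poly_par[of e f b t a] pos_poly_par[of f e b t a] assms r by auto
  show "pos_poly t D e f True True = (1 + t) * pos_poly t D f e False False"
    "pos_poly t D e f True False = pos_poly t D f e True False"
    "pos_poly t D e f False True = pos_poly t D f e False True"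
    unfolding e1 using assms(1,2) ti unfolding balanced_def by metis+
qed

end

lemma par_ext_ppair: "ppair D x y \<Longrightarrow> par_ext (del x D) x y"
  using ppair_par(2,3) by (simp add: par_ext_def)

lemma ppair_coloop_sym:
  assumes "ppair D x y"
  shows "y \<in> \<Inter>(del x D) \<longleftrightarrow> x \<in> \<Inter>(del y D)"
  by auto

text \<open>The transfer to \<open>del x D\<close> does not reach pairs containing \<open>y\<close>;
  for these \<open>D\<close> is seen as an extension of \<open>del y D\<close>. For the pair
  \<open>x\<close>, \<open>y\<close> itself both sides are explicit: \<open>1 + t\<close> against
  \<open>1\<close>, and equal values in the mixed cases because \<open>y\<close> is a coloop of
  \<open>del x D\<close> iff \<open>x\<close> is one of \<open>del y D\<close>.\<close>

lemma balanced_ppair: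
  assumes pp: "ppair D x y" and b: "balanced t (del x D)" "balanced t (del y D)"
  shows "balanced t D"
  unfolding balanced_def
proof (intro allI impI)
  fix e f assume h: "e \<noteq> f" "tied D e f"
  have pp': "ppair D y x" by (rule ppair_sym[OF pp])
  interpret X: par_ext "del x D" x y by (rule par_ext_ppair[OF pp])
  interpret Y: par_ext "del y D" y x by (rule par_ext_ppair[OF pp'])
  have DX: "par (del x D) y x = D" using ppair_par(1)[OF pp] by simp
  have DY: "par (del y D) x y = D" using ppair_par(1)[OF pp'] by simp
  note Xe = X.balanced_e[unfolded DX, OF b(1)] and Ye = Y.balanced_e[unfolded DY, OF b(2)]
  have h': "tied D f e" using h(2) tied_sym by metis
  have cs: "y \<in> \<Inter>(del x D) \<longleftrightarrow> x \<in> \<Inter>(del y D)" by (rule ppair_coloop_sym[OF pp])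
  have tt: "pos_poly t D y x a True = 1 + (if a \<or> y \<notin> \<Inter>(del x D) then t else 0)"
    "pos_poly t D x y a True = 1 + (if a \<or> y \<notin> \<Inter>(del x D) then t else 0)" for a
    using X.pos_poly_pair_True[unfolded DX, of t a] Y.pos_poly_pair_True[unfolded DY, of t a] unfolding cs by simp_all
  have ff: "pos_poly t D x y a False = 1" "pos_poly t D y x a False = 1" for a
    using X.pos_poly_pair_False[unfolded DX] by blast+
  consider "e = x" "f = y" | "e = y" "f = x" | "e = x" "f \<noteq> x" "f \<noteq> y" | "e = y" "f \<noteq> x" "f \<noteq> y"
    | "f = x" "e \<noteq> x" "e \<noteq> y" | "f = y" "e \<noteq> x" "e \<noteq> y" | "e \<notin> {x, y}" "f \<notin> {x, y}"
    using h(1) by blast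
  then show "pos_poly t D e f True True = (1 + t) * pos_poly t D f e False False \<and>
     pos_poly t D e f True False = pos_poly t D f e True False \<and>
     pos_poly t D e f False True = pos_poly t D f e False True"
  proof cases
    case 1 then show ?thesis by (simp add: tt ff)
  next
    case 2 then show ?thesis by (simp add: tt ff)
  next
    case 3 then show ?thesis using Xe[of f] h by simp
  next
    case 4 then show ?thesis using Ye[of f] h by simp
  next
    case 5 then show ?thesis using Xe[of e] h' by simp
  next
    case 6 then show ?thesis using Ye[of e] h' by simp
  next
    case 7 then show ?thesis using X.balanced_other[unfolded DX, OF b(1) h(1)] h(2) by simp
  qed
qed

text \<open>The induction is on the number of sets and not on the derivation of \<open>sp\<close>,
  since \<open>balanced_ppair\<close> asks for both \<open>del x D\<close> and
  \<open>del y D\<close>, and only the first is a premise of the rule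
  \<open>parallel\<close>.\<close>

theorem sp_balanced:
  assumes "sp D"
  shows "balanced t (D :: 'n::finite set set)"
  using assms
proof (induction "card D" arbitrary: D rule: less_induct)
  case less
  have step: "balanced t D'" if pp: "ppair D' x y" and s: "sp D'" and c: "card D' = card D" for D' :: "'n set set" and x y
  proof -
    have pp': "ppair D' y x" by (rule ppair_sym[OF pp])
    obtain I where I: "I \<in> D'" "x \<in> I" using pp unfolding ppair_def by auto
    then have "y \<notin> I" using pp unfolding ppair_def by simp
    then have sy: "sp (del y D')" using sp_del[OF s I(1)] by simp
    obtain J where J: "J \<in> D'" "y \<in> J" using pp' unfolding ppair_def by auto
    then have "x \<notin> J" using pp unfolding ppair_def by auto
    then have sx: "sp (del x D')" using sp_del[OF s J(1)] by simp
    show ?thesis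
      using balanced_ppair[OF pp less.hyps[OF _ sx] less.hyps[OF _ sy]] ppair_par(4)[OF pp] ppair_par(4)[OF pp'] c
      by simp
  qed
  show ?case using less.prems
  proof (cases rule: sp.cases)
    case (single K)
    show ?thesis unfolding balanced_def
    proof (intro allI impI)
      fix e f :: 'n assume "e \<noteq> f" "tied D e f"
      moreover have "axis e (1::real) \<in> lineal D" unfolding single by (rule linealI) simp
      ultimately have False unfolding tied_def by (auto simp: axis_def)
      then show "pos_poly t D e f True True = (1 + t) * pos_poly t D f e False False \<and>
       pos_poly t D e f True False = pos_poly t D f e True False \<and> pos_poly t D e f False True = pos_poly t D f e False True" ..
    qed
  next
    case (parallel x y)
    then show ?thesis using step less.prems by simp
  next
    case (series x y)
    have "inj_on uminus D" by (simp add: inj_on_def)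
    then have "card (uminus ` D) = card D" by (rule card_image)
    then have "balanced t (uminus ` D)"
      using step[of "uminus ` D" x y] series(1) sp_dual[OF less.prems] by (simp add: ppair_dual)
    then show ?thesis using balanced_dual sp_nonempty[OF less.prems] by blast
  qed
qed

section \<open>Cells\<close>

lemma initial_bases_eq:
  "initial_bases d p w = {I. card I = d \<and> (\<forall>J. card J = d \<longrightarrow> p I - wt w I \<le> p J - wt w J)}"
  unfolding initial_bases_def is_arg_min_linorder wt_def by simp

lemma initial_bases_card: "I \<in> initial_bases d p w \<Longrightarrow> card I = d"
  by (simp add: initial_bases_eq)

lemma initial_bases_le: "I \<in> initial_bases d p w \<Longrightarrow> card J = d \<Longrightarrow> p I - wt w I \<le> p J - wt w J"
  by (simp add: initial_bases_eq)

lemma initial_basesI: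
  "I \<in> initial_bases d p w \<Longrightarrow> card J = d \<Longrightarrow> p J - wt w J \<le> p I - wt w I \<Longrightarrow> J \<in> initial_bases d p w"
  unfolding initial_bases_eq mem_Collect_eq by (meson order_trans)

lemma initial_bases_same: "I \<in> initial_bases d p w \<Longrightarrow> J \<in> initial_bases d p w \<Longrightarrow> p I - wt w I = p J - wt w J"
  by (rule order_antisym; rule initial_bases_le; (assumption | erule initial_bases_card))

lemma initial_bases_nonempty:
  fixes p :: "'n::finite set \<Rightarrow> real"
  assumes "d \<le> CARD('n)"
  shows "initial_bases d p w \<noteq> {}"
proof -
  obtain J :: "'n set" where "card J = d" using obtain_subset_with_card_n[OF assms] by blast
  then have ne: "{I :: 'n set. card I = d} \<noteq> {}" by blast
  obtain I where "I \<in> {I :: 'n set. card I = d}" "\<forall>J\<in>{I :: 'n set. card I = d}. p I - wt w I \<le> p J - wt w J"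
    using ex_min_if_finite[of "(\<lambda>I. p I - wt w I) ` {I :: 'n set. card I = d}"] ne
    by (metis (no_types, lifting) arg_min_if_finite(1) arg_min_least finite_code)
  then have "I \<in> initial_bases d p w" by (simp add: initial_bases_eq)
  then show ?thesis by blast
qed

text \<open>All bases at \<open>w0\<close> have the same value there, so their order at
  \<open>w1\<close> is decided by the weight of \<open>w1 - w0\<close>. A common basis shows that
  the best of them are optimal at \<open>w1\<close>.\<close>

lemma max_face_initial_bases:
  assumes "I0 \<in> initial_bases d p w0" "I0 \<in> initial_bases d p w1"
  shows "max_face (initial_bases d p w0) (w1 - w0) = initial_bases d p w0 \<inter> initial_bases d p w1"
proof (intro equalityI subsetI)
  fix I assume I: "I \<in> max_face (initial_bases d p w0) (w1 - w0)"
  then have I0: "I \<in> initial_bases d p w0" "wt (w1 - w0) I0 \<le> wt (w1 - w0) I"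
    using assms(1) by (simp_all add: max_face_def)
  have "p I - wt w1 I \<le> p I0 - wt w1 I0"
    using I0(2) initial_bases_same[OF I0(1) assms(1)] by (simp add: wt_diff)
  then show "I \<in> initial_bases d p w0 \<inter> initial_bases d p w1"
    using initial_basesI[OF assms(2)] initial_bases_card[OF I0(1)] I0(1) by blast
next
  fix I assume I: "I \<in> initial_bases d p w0 \<inter> initial_bases d p w1"
  have "wt (w1 - w0) J \<le> wt (w1 - w0) I" if J: "J \<in> initial_bases d p w0" for J
    using I initial_bases_same[of I d p w0 J] J initial_bases_le[of I d p w1 J] initial_bases_card[OF J]
    by (simp add: wt_diff)
  then show "I \<in> max_face (initial_bases d p w0) (w1 - w0)" using I by (simp add: max_face_def)
qed

lemma initial_bases_small_step:
  fixes p :: "'n::finite set \<Rightarrow> real"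
  assumes "d \<le> CARD('n)"
  obtains s where "s > 0" "initial_bases d p (w + s *\<^sub>R u) = max_face (initial_bases d p w) u"
proof -
  let ?B = "initial_bases d p w"
  obtain I0 where I0: "I0 \<in> ?B" using initial_bases_nonempty[OF assms] by blast
  let ?v = "\<lambda>I. p I - wt w I"
  let ?N = "{J. card J = d} - ?B"
  \<comment> \<open>The bound on the step below which a non-basis \<open>J\<close> cannot catch up;
    the summand \<open>1\<close> in the denominator keeps it positive, and the \<open>1\<close> in
    the definition of \<open>s\<close> covers the case of no non-basis.\<close>
  let ?g = "\<lambda>J. (?v J - ?v I0) / (1 + \<bar>wt u J - wt u I0\<bar>)"
  define s where "s = Min (insert 1 (?g ` ?N))"
  have gpos: "?g J > 0" if "J \<in> ?N" for J
  proof -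
    have "?v J > ?v I0" using that initial_basesI[OF I0, of J] by (auto simp: not_less[symmetric])
    then show ?thesis by (intro divide_pos_pos) simp_all
  qed
  have s: "s > 0" unfolding s_def using gpos by (subst Min_gr_iff) auto
  have lt: "s * (wt u J - wt u I0) < ?v J - ?v I0" if "J \<in> ?N" for J
  proof -
    have "s \<le> ?g J" unfolding s_def using that by (intro Min_le) auto
    then have "s * (1 + \<bar>wt u J - wt u I0\<bar>) \<le> ?v J - ?v I0" by (simp add: pos_le_divide_eq)
    moreover have "s * (wt u J - wt u I0) < s * (1 + \<bar>wt u J - wt u I0\<bar>)"
      using s by (intro mult_strict_left_mono) auto
    ultimately show ?thesis by linarith
  qed
  have "initial_bases d p (w + s *\<^sub>R u) = max_face ?B u"
  proof (intro equalityI subsetI)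
    fix I assume I: "I \<in> initial_bases d p (w + s *\<^sub>R u)"
    have c: "card I = d" using initial_bases_card[OF I] .
    have IB: "I \<in> ?B"
    proof (rule ccontr)
      assume "I \<notin> ?B"
      then have "I \<in> ?N" using c by simp
      then show False using lt[of I] initial_bases_le[OF I initial_bases_card[OF I0]]
        by (simp add: wt_add wt_scaleR algebra_simps)
    qed
    have "wt u J \<le> wt u I" if J: "J \<in> ?B" for J
    proof -
      have "s * wt u J \<le> s * wt u I"
        using initial_bases_le[OF I initial_bases_card[OF J]] initial_bases_same[OF IB J]
        by (simp add: wt_add wt_scaleR algebra_simps)
      then show ?thesis using s by simp
    qed
    then show "I \<in> max_face ?B u" using IB by (simp add: max_face_def)
  next
    fix I assume I: "I \<in> max_face ?B u"
    have IB: "I \<in> ?B" and m: "\<And>J. J \<in> ?B \<Longrightarrow> wt u J \<le> wt u I" using I by (simp_all add: max_face_def)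
    have "p I - wt (w + s *\<^sub>R u) I \<le> p J - wt (w + s *\<^sub>R u) J" if J: "card J = d" for J
    proof (cases "J \<in> ?B")
      case True
      have "s * wt u J \<le> s * wt u I" using m[OF True] s by simp
      then show ?thesis using initial_bases_same[OF IB True] by (simp add: wt_add wt_scaleR algebra_simps)
    next
      case False
      then have "s * (wt u J - wt u I0) < ?v J - ?v I0" using lt[of J] J by simp
      moreover have "s * wt u I0 \<le> s * wt u I" using m[OF I0] s by simp
      ultimately show ?thesis using initial_bases_same[OF IB I0] by (simp add: wt_add wt_scaleR algebra_simps)
    qed
    then show "I \<in> initial_bases d p (w + s *\<^sub>R u)" using initial_bases_card[OF IB] by (simp add: initial_bases_eq)
  qed
  then show ?thesis using that s by blast
qed

text \<open>A ratio test: along a lineality direction the bases stay tied, and they stay optimal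
  until the first outside set of greater weight in direction \<open>v\<close> draws level. If there
  is no such set, they are optimal forever.\<close>

lemma initial_bases_move:
  fixes p :: "'n::finite set \<Rightarrow> real"
  assumes "I0 \<in> initial_bases d p w" "v \<in> lineal (initial_bases d p w)"
  shows "(\<forall>s\<ge>0. initial_bases d p w \<subseteq> initial_bases d p (w + s *\<^sub>R v)) \<or>
    (\<exists>s\<ge>0. initial_bases d p w \<subset> initial_bases d p (w + s *\<^sub>R v))"
proof -
  let ?B = "initial_bases d p w"
  let ?v = "\<lambda>I. p I - wt w I"
  let ?P = "{J. card J = d \<and> wt v I0 < wt v J}"
  have vB: "wt v I = wt v I0" if "I \<in> ?B" for I using linealD[OF assms(2) that assms(1)] .
  have key: "?B \<subseteq> initial_bases d p (w + s *\<^sub>R v)"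
    if s: "\<And>J. card J = d \<Longrightarrow> s * (wt v J - wt v I0) \<le> ?v J - ?v I0" for s
  proof
    fix I assume I: "I \<in> ?B"
    have "p I - wt (w + s *\<^sub>R v) I \<le> p J - wt (w + s *\<^sub>R v) J" if J: "card J = d" for J
      using s[OF J] initial_bases_same[OF I assms(1)] vB[OF I]
      by (simp add: wt_add wt_scaleR algebra_simps)
    then show "I \<in> initial_bases d p (w + s *\<^sub>R v)" using initial_bases_card[OF I] by (simp add: initial_bases_eq)
  qed
  have ge: "?v J - ?v I0 \<ge> 0" if "card J = d" for J using initial_bases_le[OF assms(1) that] by simp
  show ?thesis
  proof (cases "?P = {}")
    case True
    have "?B \<subseteq> initial_bases d p (w + s *\<^sub>R v)" if "s \<ge> 0" for s
    proof (rule key)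
      fix J :: "'n set" assume J: "card J = d"
      then have "wt v J \<le> wt v I0" using True by force
      then have "s * (wt v J - wt v I0) \<le> 0" using that by (simp add: mult_nonneg_nonpos)
      then show "s * (wt v J - wt v I0) \<le> ?v J - ?v I0" using ge[OF J] by linarith
    qed
    then show ?thesis by blast
  next
    case False
    let ?g = "\<lambda>J. (?v J - ?v I0) / (wt v J - wt v I0)"
    define s where "s = Min (?g ` ?P)"
    have fin: "finite (?g ` ?P)" "?g ` ?P \<noteq> {}" using False by auto
    obtain J where J: "J \<in> ?P" "s = ?g J" using Min_in[OF fin] unfolding s_def by blast
    have s0: "s \<ge> 0" using J ge[of J] by simp
    have sub: "?B \<subseteq> initial_bases d p (w + s *\<^sub>R v)"
    proof (rule key)
      fix K :: "'n set" assume K: "card K = d"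
      show "s * (wt v K - wt v I0) \<le> ?v K - ?v I0"
      proof (cases "K \<in> ?P")
        case True
        then have "s \<le> ?g K" unfolding s_def by (intro Min_le[OF fin(1)]) blast
        then show ?thesis using True by (simp add: pos_le_divide_eq)
      next
        case False
        then have "s * (wt v K - wt v I0) \<le> 0" using K s0 by (simp add: mult_nonneg_nonpos)
        then show ?thesis using ge[OF K] by linarith
      qed
    qed
    have "s * (wt v J - wt v I0) = ?v J - ?v I0" using J by simp
    then have "p J - wt (w + s *\<^sub>R v) J \<le> p I0 - wt (w + s *\<^sub>R v) I0"
      by (simp add: wt_add wt_scaleR algebra_simps)
    then have "J \<in> initial_bases d p (w + s *\<^sub>R v)"
      using initial_basesI[of I0] sub assms(1) J(1) by blast
    moreover have "J \<notin> ?B" using vB[of J] J(1) by auto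
    ultimately show ?thesis using sub s0 by blast
  qed
qed

section \<open>Large differences of coordinates\<close>

definition spread :: "nat \<Rightarrow> ('n::finite set \<Rightarrow> real) \<Rightarrow> real" where
  "spread d p = 1 + 2 * (\<Sum>I | card I = d. \<bar>p I\<bar>)"

lemma spread_ge:
  fixes p :: "'n::finite set \<Rightarrow> real"
  assumes "card I = d" "card J = d"
  shows "p I - p J < spread d p"
proof -
  have "\<bar>p I\<bar> \<le> (\<Sum>I | card I = d. \<bar>p I\<bar>)" "\<bar>p J\<bar> \<le> (\<Sum>I | card I = d. \<bar>p I\<bar>)"
    by (intro member_le_sum; use assms in simp)+
  then show ?thesis unfolding spread_def by linarith
qed

lemma spread_pos: "spread d p > 0"
  unfolding spread_def by (intro add_pos_nonneg mult_nonneg_nonneg sum_nonneg) simp_all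

text \<open>Pigeonhole on the \<open>n\<close> consecutive half-open intervals of length
  \<open>G\<close> above \<open>w e\<close>: if each contained some \<open>w i\<close>, every index
  would be used, including \<open>e\<close>, whose value lies below them all.\<close>

lemma gap_threshold:
  fixes w :: "'n::finite \<Rightarrow> real"
  assumes "G > 0" "w f - w e > real CARD('n) * G"
  obtains c where "w e \<le> c" "c + G < w f" "\<And>i. w i \<le> c \<or> c + G < w i"
proof -
  let ?n = "CARD('n)"
  let ?J = "\<lambda>k. {i. w e + real k * G < w i \<and> w i \<le> w e + real (k + 1) * G}"
  have "\<exists>k<?n. ?J k = {}"
  proof (rule ccontr)
    assume "\<not> (\<exists>k<?n. ?J k = {})"
    then have "\<forall>k<?n. \<exists>i. i \<in> ?J k" by blast
    then obtain h where h: "\<And>k. k < ?n \<Longrightarrow> h k \<in> ?J k" by metis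
    have inj: "inj_on h {..<?n}"
    proof (rule inj_onI)
      fix k l assume kl: "k \<in> {..<?n}" "l \<in> {..<?n}" "h k = h l"
      have a: "real k * G < real (l + 1) * G" "real l * G < real (k + 1) * G"
        using h[of k] h[of l] kl by auto
      then have "real k < real (l + 1)" "real l < real (k + 1)" using assms(1) mult_less_cancel_right_pos by blast+
      then show "k = l" by linarith
    qed
    have "card (h ` {..<?n}) = ?n" by (simp add: card_image[OF inj])
    then have "h ` {..<?n} = UNIV" by (intro card_eq_UNIV_imp_eq_UNIV) simp_all
    then obtain k where k: "k < ?n" "h k = e" by (metis UNIV_I imageE lessThan_iff)
    have "w e + real k * G < w e" using h[OF k(1)] k(2) by simp
    moreover have "real k * G \<ge> 0" using assms(1) by simp
    ultimately show False by simp
  qed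
  then obtain k where k: "k < ?n" "?J k = {}" by blast
  have "real (k + 1) * G \<le> real ?n * G" using k assms(1) by (intro mult_right_mono) auto
  moreover have "real (k + 1) * G = real k * G + G" by (simp add: algebra_simps)
  ultimately have 1: "w e + real k * G + G < w f" using assms(2) by linarith
  have 2: "w i \<le> w e + real k * G \<or> w e + real k * G + G < w i" for i
  proof -
    have "i \<notin> ?J k" using k by blast
    then show ?thesis by (auto simp: algebra_simps)
  qed
  have 3: "w e \<le> w e + real k * G" using assms(1) by simp
  show ?thesis using that[OF 3 1 2] .
qed

text \<open>If two coordinates of \<open>w\<close> differ by much, then some value separates the coordinates into low and
  high ones with a gap in between, and all bases of minimal weight prefer the high coordinates.\<close>

lemma gap:
  fixes p :: "'n::finite set \<Rightarrow> real"
  assumes "w $ f - w $ e > real CARD('n) * spread d p"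
  shows "e \<notin> \<Union>(initial_bases d p w) \<or> f \<in> \<Inter>(initial_bases d p w)"
proof -
  obtain c where c: "w $ e \<le> c" "c + spread d p < w $ f" "\<And>i. w $ i \<le> c \<or> c + spread d p < w $ i"
    using gap_threshold[OF spread_pos assms] by blast
  let ?A = "{i. c + spread d p < w $ i}"
  have eA: "e \<notin> ?A" using c(1) spread_pos[of d p] by simp
  have fA: "f \<in> ?A" using c by simp
  have dich: "?A \<subseteq> I \<or> I \<subseteq> ?A" if I: "I \<in> initial_bases d p w" for I
  proof (rule ccontr)
    assume "\<not> (?A \<subseteq> I \<or> I \<subseteq> ?A)"
    then obtain a b where ab: "a \<in> ?A" "a \<notin> I" "b \<in> I" "b \<notin> ?A" by blast
    have b: "w $ b \<le> c" using c(3)[of b] ab by simp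
    let ?I = "insert a (I - {b})"
    have "a \<noteq> b" using ab by blast
    then have ci: "card ?I = d" using ab initial_bases_card[OF I] by (simp add: card_Diff_singleton card_gt_0_iff) (metis Suc_pred card_gt_0_iff empty_iff finite)
    have "p I - wt w I \<le> p ?I - wt w ?I" by (rule initial_bases_le[OF I ci])
    moreover have "wt w ?I = wt w I - w $ b + w $ a" by (rule wt_exchange[OF ab(3,2)])
    moreover have "p ?I - p I < spread d p" by (rule spread_ge[OF ci initial_bases_card[OF I]])
    ultimately show False using ab(1) b by simp
  qed
  show ?thesis
  proof (cases "card ?A \<le> d")
    case True
    have "?A \<subseteq> I" if I: "I \<in> initial_bases d p w" for I
    proof (rule ccontr)
      assume n: "\<not> ?A \<subseteq> I"
      then have "I \<subseteq> ?A" using dich[OF I] by blast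
      moreover have "card ?A \<le> card I" using True initial_bases_card[OF I] by simp
      ultimately have "I = ?A" by (intro card_seteq) simp_all
      then show False using n by blast
    qed
    then show ?thesis using fA by blast
  next
    case False
    have "I \<subseteq> ?A" if I: "I \<in> initial_bases d p w" for I
    proof (rule ccontr)
      assume n: "\<not> I \<subseteq> ?A"
      then have "?A \<subseteq> I" using dich[OF I] by blast
      then have "card ?A \<le> card I" by (intro card_mono) simp_all
      then show False using False initial_bases_card[OF I] by simp
    qed
    then show ?thesis using eA by blast
  qed
qed

section \<open>Minimal faces of cells and the counting recursion\<close>

definition cells :: "nat \<Rightarrow> ('n::finite set \<Rightarrow> real) \<Rightarrow> 'n set set set" where
  "cells d p = range (initial_bases d p)"

lemma tied_diff:
  assumes "initial_bases d p w = initial_bases d p w'" "tied (initial_bases d p w) e f"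
    "initial_bases d p w \<noteq> {}"
  shows "w $ e - w $ f = w' $ e - w' $ f"
proof -
  obtain I0 where "I0 \<in> initial_bases d p w" using assms(3) by blast
  then have "max_face (initial_bases d p w) (w' - w) = initial_bases d p w"
    using max_face_initial_bases[of I0 d p w w'] assms(1) by simp
  then have "w' - w \<in> lineal (initial_bases d p w)" by (simp add: max_face_eq_iff)
  then have "(w' - w) $ e = (w' - w) $ f" using assms(2) unfolding tied_def by blast
  then show ?thesis by simp
qed

context
  fixes d :: nat and p :: "'n::finite set \<Rightarrow> real"
  assumes dn: "d \<le> CARD('n)"
begin

text \<open>As long as \<open>e\<close> and \<open>f\<close> are not tied, some lineality direction
  lowers \<open>w_e - w_f\<close>. Following it forever would contradict \<open>gap\<close>, since
  \<open>C\<close> prevents \<open>e\<close> from being a loop and \<open>f\<close> from being a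
  coloop. So the family grows, which happens finitely often.\<close>

lemma descend_to_tied:
  assumes C: "C \<subseteq> initial_bases d p w" "e \<in> \<Union>C" "f \<notin> \<Inter>C"
  shows "\<exists>w'. C \<subseteq> initial_bases d p w' \<and> tied (initial_bases d p w') e f \<and> w' $ e - w' $ f \<le> w $ e - w $ f"
  using C(1)
proof (induction "card (UNIV - initial_bases d p w)" arbitrary: w rule: less_induct)
  case less
  let ?B = "initial_bases d p w"
  show ?case
  proof (cases "tied ?B e f")
    case True
    then show ?thesis using less.prems by blast
  next
    case False
    then obtain v0 where v0: "v0 \<in> lineal ?B" "v0 $ e \<noteq> v0 $ f" unfolding tied_def by blast
    have nv0: "- v0 \<in> lineal ?B" using v0(1) subspace_lineal subspace_neg by blast
    have "\<exists>v. v \<in> lineal ?B \<and> v $ e < v $ f"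
    proof (cases "v0 $ e < v0 $ f")
      case False
      then have "(- v0) $ e < (- v0) $ f" using v0(2) by simp
      then show ?thesis using nv0 by blast
    qed (use v0(1) in blast)
    then obtain v where v: "v \<in> lineal ?B" "v $ e < v $ f" by blast
    obtain I0 where I0: "I0 \<in> ?B" using initial_bases_nonempty[OF dn] by blast
    have notall: "\<not> (\<forall>s\<ge>0. ?B \<subseteq> initial_bases d p (w + s *\<^sub>R v))"
    proof
      assume h: "\<forall>s\<ge>0. ?B \<subseteq> initial_bases d p (w + s *\<^sub>R v)"
      let ?m = "real CARD('n) * spread d p"
      define s where "s = max 0 ((?m + 1 + (w $ e - w $ f)) / (v $ f - v $ e))"
      have s: "s \<ge> 0" by (simp add: s_def)
      have "(?m + 1 + (w $ e - w $ f)) / (v $ f - v $ e) \<le> s" by (simp add: s_def)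
      then have "?m + 1 + (w $ e - w $ f) \<le> s * (v $ f - v $ e)" using v(2) by (simp add: pos_divide_le_eq)
      then have "(w + s *\<^sub>R v) $ f - (w + s *\<^sub>R v) $ e > ?m" by (simp add: algebra_simps)
      then have "e \<notin> \<Union>(initial_bases d p (w + s *\<^sub>R v)) \<or> f \<in> \<Inter>(initial_bases d p (w + s *\<^sub>R v))"
        by (rule gap)
      moreover have "C \<subseteq> initial_bases d p (w + s *\<^sub>R v)" using h s less.prems by blast
      ultimately show False using C(2,3) by blast
    qed
    then obtain s where s: "s \<ge> 0" "?B \<subset> initial_bases d p (w + s *\<^sub>R v)"
      using initial_bases_move[OF I0 v(1)] by blast
    let ?w = "w + s *\<^sub>R v"
    have "card (UNIV - initial_bases d p ?w) < card (UNIV - ?B)"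
      by (rule psubset_card_mono) (use s(2) in auto)
    moreover have "C \<subseteq> initial_bases d p ?w" using less.prems s(2) by blast
    ultimately obtain w' where w': "C \<subseteq> initial_bases d p w'" "tied (initial_bases d p w') e f"
      "w' $ e - w' $ f \<le> ?w $ e - ?w $ f" using less.hyps by blast
    have "s * v $ e \<le> s * v $ f" using s(1) v(2) by (intro mult_left_mono) simp_all
    then have "?w $ e - ?w $ f \<le> w $ e - w $ f" by simp
    then show ?thesis using w' by (meson order_trans)
  qed
qed

text \<open>Finiteness takes the place of compactness: at tied points the difference depends only on
  the cell, so it takes finitely many values, and by the descent no point of the region lies below
  all of them.\<close>

lemma minimizing_cell:
  assumes C: "C \<subseteq> initial_bases d p w1" "e \<in> \<Union>C" "f \<notin> \<Inter>C"
  shows "\<exists>w0. C \<subseteq> initial_bases d p w0 \<and> (\<forall>w. C \<subseteq> initial_bases d p w \<longrightarrow> w0 $ e - w0 $ f \<le> w $ e - w $ f)"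
proof -
  let ?T = "{w. C \<subseteq> initial_bases d p w \<and> tied (initial_bases d p w) e f}"
  let ?k = "\<lambda>w. w $ e - w $ f"
  have "?k ` ?T \<subseteq> (\<lambda>D. ?k (SOME w. initial_bases d p w = D)) ` UNIV"
  proof
    fix a assume "a \<in> ?k ` ?T"
    then obtain w where w: "w \<in> ?T" "a = ?k w" by blast
    define w' where "w' = (SOME w'. initial_bases d p w' = initial_bases d p w)"
    have e: "initial_bases d p w' = initial_bases d p w"
      unfolding w'_def by (rule someI[of _ w]) (rule refl)
    have "w $ e - w $ f = w' $ e - w' $ f"
      by (rule tied_diff[OF e[symmetric]]) (use w(1) initial_bases_nonempty[OF dn] in blast)+
    then have "a = ?k (SOME w'. initial_bases d p w' = initial_bases d p w)" using w(2) unfolding w'_def by (rule trans[rotated])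
    then show "a \<in> (\<lambda>D. ?k (SOME w. initial_bases d p w = D)) ` UNIV" by (rule image_eqI) (rule UNIV_I)
  qed
  then have fin: "finite (?k ` ?T)" by (rule finite_subset) simp
  obtain w' where "w' \<in> ?T" using descend_to_tied[OF C] by blast
  then have ne: "?k ` ?T \<noteq> {}" by blast
  obtain w0 where w0: "w0 \<in> ?T" "?k w0 = Min (?k ` ?T)" using Min_in[OF fin ne] by (elim imageE) (rule that, assumption, simp only:)
  have "?k w0 \<le> ?k w" if w: "C \<subseteq> initial_bases d p w" for w
  proof -
    obtain w' where w': "w' \<in> ?T" "?k w' \<le> ?k w" using descend_to_tied[OF w C(2,3)] by blast
    have "?k w0 \<le> ?k w'" unfolding w0(2) by (rule Min_le[OF fin]) (use w'(1) in blast)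
    then show ?thesis using w'(2) by linarith
  qed
  then show ?thesis using w0(1) by blast
qed

lemma pos_cell_exists:
  assumes C: "C \<in> cells d p" "e \<in> \<Union>C" "f \<notin> \<Inter>C"
  obtains D u where "D \<in> cells d p" "C = max_face D u" "pos D C e f"
proof -
  obtain w1 where w1: "C = initial_bases d p w1" using C(1) by (auto simp: cells_def)
  obtain wm where wm: "C \<subseteq> initial_bases d p wm"
    "\<And>w. C \<subseteq> initial_bases d p w \<Longrightarrow> wm $ e - wm $ f \<le> w $ e - w $ f"
    using minimizing_cell[of C w1 e f] w1 C by blast
  let ?P = "\<lambda>w. C \<subseteq> initial_bases d p w \<and> w $ e - w $ f = wm $ e - wm $ f"
  \<comment> \<open>A minimizer with the fewest bases lies in the relative interior of the minimal
    face. This choice yields the equality clause of \<open>pos\<close>, as a small step within the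
    face cannot lose bases.\<close>
  obtain w0 where w0: "?P w0" "\<And>w. ?P w \<Longrightarrow> card (initial_bases d p w0) \<le> card (initial_bases d p w)"
    using ex_has_least_nat[of ?P wm "\<lambda>w. card (initial_bases d p w)"] wm(1) by blast
  let ?D = "initial_bases d p w0"
  obtain I0 where I0: "I0 \<in> C" using C(2) by blast
  have "max_face ?D (w1 - w0) = ?D \<inter> C"
    using max_face_initial_bases[of I0 d p w0 w1] w0(1) w1 I0 by blast
  then have 1: "C = max_face ?D (w1 - w0)" using w0(1) by blast
  have 2: "pos ?D C e f" unfolding pos_def
  proof (intro allI impI)
    fix u assume u: "C \<subseteq> max_face ?D u"
    obtain s where s: "s > 0" "initial_bases d p (w0 + s *\<^sub>R u) = max_face ?D u"
      using initial_bases_small_step[OF dn] by metis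
    have Cs: "C \<subseteq> initial_bases d p (w0 + s *\<^sub>R u)" using u s(2) by simp
    have "wm $ e - wm $ f \<le> (w0 + s *\<^sub>R u) $ e - (w0 + s *\<^sub>R u) $ f" by (rule wm(2)[OF Cs])
    then have "s * u $ f \<le> s * u $ e" using w0(1) by simp
    then have le: "u $ f \<le> u $ e" using s(1) by simp
    moreover have "max_face ?D u = ?D" if "u $ e = u $ f"
    proof -
      have "?P (w0 + s *\<^sub>R u)" using Cs w0(1) that by simp
      then have "card ?D \<le> card (max_face ?D u)" using w0(2)[of "w0 + s *\<^sub>R u"] s(2) by simp
      then show ?thesis by (intro card_seteq max_face_subset) simp_all
    qed
    ultimately show "u $ f \<le> u $ e \<and> (u $ e = u $ f \<longrightarrow> max_face ?D u = ?D)" by blast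
  qed
  show ?thesis using that[OF _ 1 2] by (auto simp: cells_def)
qed

text \<open>Moving from either point towards the other cannot lower \<open>w_e - w_f\<close>, so the
  differences agree, and the equality clause of \<open>pos\<close> identifies each family with the
  intersection of the two.\<close>

lemma pos_cell_unique:
  assumes "D \<in> cells d p" "D' \<in> cells d p" "C \<noteq> {}" "C \<subseteq> D" "C \<subseteq> D'" "pos D C e f" "pos D' C e f"
  shows "D = D'"
proof -
  obtain w w' where w: "D = initial_bases d p w" "D' = initial_bases d p w'" using assms(1,2) by (auto simp: cells_def)
  obtain I0 where I0: "I0 \<in> C" using assms(3) by blast
  have m: "max_face D (w' - w) = D \<inter> D'" "max_face D' (w - w') = D' \<inter> D"
    using max_face_initial_bases[of I0 d p w w'] max_face_initial_bases[of I0 d p w' w] w I0 assms(4,5) by blast+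
  have "C \<subseteq> max_face D (w' - w)" "C \<subseteq> max_face D' (w - w')" using m assms(4,5) by blast+
  then have "(w' - w) $ f \<le> (w' - w) $ e" "(w - w') $ f \<le> (w - w') $ e"
    and e: "(w' - w) $ e = (w' - w) $ f \<longrightarrow> max_face D (w' - w) = D"
      "(w - w') $ e = (w - w') $ f \<longrightarrow> max_face D' (w - w') = D'"
    using assms(6,7) unfolding pos_def by blast+
  then have "(w' - w) $ e = (w' - w) $ f" "(w - w') $ e = (w - w') $ f" by simp_all
  then show ?thesis using e m by blast
qed

lemma max_face_cell: "D \<in> cells d p \<Longrightarrow> max_face D u \<in> cells d p"
  unfolding cells_def using initial_bases_small_step[OF dn] by (metis (no_types, lifting) rangeE rangeI)

lemma cell_nonempty: "D \<in> cells d p \<Longrightarrow> D \<noteq> {}"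
  unfolding cells_def using initial_bases_nonempty[OF dn] by blast

text \<open>These play the role of the cells without loops and coloops for the minor of
  \<open>p\<close> that contracts \<open>K\<close> and deletes \<open>L\<close>, kept on the full
  ground set.\<close>

definition minor_cells :: "'n set \<Rightarrow> 'n set \<Rightarrow> 'n set set set" where
  "minor_cells K L = {C \<in> cells d p. \<Inter>C = K \<and> - \<Union>C = L}"

lemma tied_nontrivial:
  assumes "tied D e f" "e \<noteq> f" "D \<noteq> {}"
  shows "e \<in> \<Union>D" "f \<in> \<Union>D" "e \<notin> \<Inter>D" "f \<notin> \<Inter>D"
proof -
  have ax: "axis z (1::real) \<notin> lineal D" if "z = e \<or> z = f" for z
    using assms(1,2) that unfolding tied_def by (auto simp: axis_def)
  have l: "axis z (1::real) \<in> lineal D" if "z \<notin> \<Union>D" for z using that by (intro linealI) (auto simp: wt_axis)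
  have c: "axis z (1::real) \<in> lineal D" if "z \<in> \<Inter>D" for z using that by (intro linealI) (auto simp: wt_axis)
  show "e \<in> \<Union>D" "f \<in> \<Union>D" "e \<notin> \<Inter>D" "f \<notin> \<Inter>D" using ax l c by blast+
qed

text \<open>A coloop \<open>e\<close> or a loop \<open>f\<close> of \<open>C\<close> does not spoil
  the existence of the minimum. The minimal face has neither, because tied elements are neither
  loops nor coloops, and by \<open>pos_coloop\<close> and \<open>pos_loop\<close> nothing else
  changes; so its coloops and loops are exactly \<open>K\<close> and \<open>L\<close>.\<close>

lemma pos_cell_in_pos_faces:
  assumes C: "C \<in> cells d p" and ef: "e \<noteq> f" and CK: "K \<subseteq> \<Inter>C" "\<Inter>C \<subseteq> K \<union> (if a then {e} else {})"
    and CL: "L \<subseteq> - \<Union>C" "- \<Union>C \<subseteq> L \<union> (if b then {f} else {})" and nK: "e \<notin> K" "f \<notin> K" "e \<notin> L" "f \<notin> L"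
  shows "\<exists>D\<in>minor_cells K L. tied D e f \<and> C \<in> pos_faces D e f a b"
proof -
  have eC: "e \<in> \<Union>C" using CL(2) nK(3) ef by (cases b; simp only: if_True if_False; blast)
  have fC: "f \<notin> \<Inter>C" using CK(2) nK(2) ef by (cases a; simp only: if_True if_False; blast)
  obtain D u where D: "D \<in> cells d p" "C = max_face D u" "pos D C e f"
    using pos_cell_exists[OF C eC fC] by blast
  have sub: "C \<subseteq> D" using D(2) max_face_subset by simp
  have ne: "C \<noteq> {}" using eC by blast
  have ti: "tied D e f" by (rule pos_tied[OF D(3) sub])
  note tn = tied_nontrivial[OF ti ef cell_nonempty[OF D(1)]]
  have i1: "\<Inter>C \<subseteq> \<Inter>D \<union> (if a then {e} else {})"
  proof
    fix z assume z: "z \<in> \<Inter>C"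
    show "z \<in> \<Inter>D \<union> (if a then {e} else {})"
    proof (cases "z = e")
      case True
      have "e \<in> K \<union> (if a then {e} else {})" using z CK(2) unfolding True by (rule subsetD[rotated])
      then have "a" using nK(1) by (cases a) simp_all
      then show ?thesis using True by simp
    next
      case False
      moreover have "z \<noteq> f" using z fC by blast
      ultimately show ?thesis using pos_coloop[OF D(3) sub ne _ _ z] by blast
    qed
  qed
  have i2: "\<Union>D \<subseteq> \<Union>C \<union> (if b then {f} else {})"
  proof
    fix z assume z: "z \<in> \<Union>D"
    show "z \<in> \<Union>C \<union> (if b then {f} else {})"
    proof (cases "z \<in> \<Union>C")
      case False
      then have "z \<noteq> e" using eC by blast
      then have zf: "z = f" using pos_loop[OF D(3) sub ne _ _ False] z by blast
      have "f \<in> - \<Union>C" using False unfolding zf by simp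
      then have "f \<in> L \<union> (if b then {f} else {})" by (rule subsetD[OF CL(2)])
      then have "b" using nK(4) by (cases b) simp_all
      then show ?thesis using zf by simp
    qed blast
  qed
  have "\<Inter>D = K"
  proof (intro equalityI)
    have "\<Inter>D \<subseteq> \<Inter>C" using sub by blast
    then show "\<Inter>D \<subseteq> K" using CK(2) tn(3) by (cases a; simp only: if_True if_False; blast)
    show "K \<subseteq> \<Inter>D" using CK(1) i1 nK(1) by (cases a; simp only: if_True if_False; blast)
  qed
  moreover have "- \<Union>D = L"
  proof (intro equalityI)
    have "- \<Union>D \<subseteq> - \<Union>C" using sub by blast
    then show "- \<Union>D \<subseteq> L" using CL(2) tn(2) by (cases b; simp only: if_True if_False; blast)
    show "L \<subseteq> - \<Union>D" using CL(1) i2 nK(4) by (cases b; simp only: if_True if_False; blast)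
  qed
  ultimately have "D \<in> minor_cells K L" using D(1) by (simp add: minor_cells_def)
  moreover have "C \<in> pos_faces D e f a b" unfolding pos_faces_def using D(2,3) i1 i2 by blast
  ultimately show ?thesis using ti by blast
qed

lemma pos_faces_in_cells:
  assumes D: "D \<in> minor_cells K L" and C: "C \<in> pos_faces D e f a b"
  shows "C \<in> cells d p" "K \<subseteq> \<Inter>C" "\<Inter>C \<subseteq> K \<union> (if a then {e} else {})"
    "L \<subseteq> - \<Union>C" "- \<Union>C \<subseteq> L \<union> (if b then {f} else {})"
proof -
  have Dc: "D \<in> cells d p" and KL: "\<Inter>D = K" "- \<Union>D = L" using D by (simp_all add: minor_cells_def)
  obtain u where u: "C = max_face D u" using C by (auto simp: pos_faces_def)
  have c: "\<Union>D \<subseteq> \<Union>C \<union> (if b then {f} else {})" "\<Inter>C \<subseteq> \<Inter>D \<union> (if a then {e} else {})"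
    using C by (simp_all add: pos_faces_def)
  have sub: "C \<subseteq> D" by (rule pos_faces_subset[OF C])
  show "C \<in> cells d p" using max_face_cell[OF Dc] u by simp
  show "K \<subseteq> \<Inter>C" using sub KL(1) by blast
  show "\<Inter>C \<subseteq> K \<union> (if a then {e} else {})" using c(2) KL(1) by simp
  show "L \<subseteq> - \<Union>C" using sub KL(2) by blast
  show "- \<Union>C \<subseteq> L \<union> (if b then {f} else {})" using c(1) KL(2) by blast
qed

definition cell_poly :: "'a::comm_semiring_1 \<Rightarrow> 'n set \<Rightarrow> 'n set \<Rightarrow> 'a" where
  "cell_poly t K L = (\<Sum>C\<in>minor_cells K L. t ^ dim (lineal C))"

text \<open>Every cell is counted at its unique minimal face \<open>D\<close>, and its power of
  \<open>t\<close> splits into the dimension of \<open>D\<close> and the codimension recorded by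
  \<open>pos_poly\<close>.\<close>

lemma sum_over_pos_faces:
  assumes ef: "e \<noteq> f" and nK: "e \<notin> K" "f \<notin> K" "e \<notin> L" "f \<notin> L"
  shows "(\<Sum>C | C \<in> cells d p \<and> K \<subseteq> \<Inter>C \<and> \<Inter>C \<subseteq> K \<union> (if a then {e} else {}) \<and>
        L \<subseteq> - \<Union>C \<and> - \<Union>C \<subseteq> L \<union> (if b then {f} else {}). t ^ dim (lineal C))
    = (\<Sum>D | D \<in> minor_cells K L \<and> tied D e f. t ^ dim (lineal D) * pos_poly t D e f a b)"
    (is "sum ?g ?S = sum _ ?T")
proof -
  have S: "?S = (\<Union>D\<in>?T. pos_faces D e f a b)"
  proof (intro equalityI subsetI)
    fix C assume "C \<in> ?S"
    then have C: "C \<in> cells d p" "K \<subseteq> \<Inter>C" "\<Inter>C \<subseteq> K \<union> (if a then {e} else {})"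
        "L \<subseteq> - \<Union>C" "- \<Union>C \<subseteq> L \<union> (if b then {f} else {})"
      by simp_all
    show "C \<in> (\<Union>D\<in>?T. pos_faces D e f a b)" using pos_cell_in_pos_faces[OF C(1) ef C(2-5) nK] by blast
  next
    fix C assume "C \<in> (\<Union>D\<in>?T. pos_faces D e f a b)"
    then obtain D where "D \<in> minor_cells K L" "C \<in> pos_faces D e f a b" by blast
    then show "C \<in> ?S" using pos_faces_in_cells[of D K L C] by simp
  qed
  have disj: "pos_faces D e f a b \<inter> pos_faces D' e f a b = {}" if D: "D \<in> ?T" "D' \<in> ?T" "D \<noteq> D'" for D D'
  proof (rule ccontr)
    assume "pos_faces D e f a b \<inter> pos_faces D' e f a b \<noteq> {}"
    then obtain C where C: "C \<in> pos_faces D e f a b" "C \<in> pos_faces D' e f a b" by blast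
    have Dc: "D \<in> cells d p" "D' \<in> cells d p" using D by (simp_all add: minor_cells_def)
    have "pos D C e f" "pos D' C e f" using C by (simp_all add: pos_faces_def)
    then show False
      using pos_cell_unique[OF Dc pos_faces_nonempty[OF C(1) cell_nonempty[OF Dc(1)]] pos_faces_subset[OF C(1)] pos_faces_subset[OF C(2)]] D(3)
      by blast
  qed
  have "sum ?g ?S = (\<Sum>D\<in>?T. sum ?g (pos_faces D e f a b))"
    unfolding S by (rule sum.UNION_disjoint) (use disj in auto)
  also have "\<dots> = (\<Sum>D\<in>?T. t ^ dim (lineal D) * pos_poly t D e f a b)"
  proof (rule sum.cong[OF refl])
    fix D assume "D \<in> ?T"
    have "?g C = t ^ dim (lineal D) * t ^ (dim (lineal C) - dim (lineal D))" if "C \<in> pos_faces D e f a b" for C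
      using dim_lineal_mono[OF pos_faces_subset[OF that]] by (simp add: power_add[symmetric])
    then show "sum ?g (pos_faces D e f a b) = t ^ dim (lineal D) * pos_poly t D e f a b"
      unfolding pos_poly_def sum_distrib_left by (rule sum.cong[OF refl])
  qed
  finally show ?thesis .
qed

text \<open>Sorting by the minimum expresses the sum of four \<open>cell_poly\<close> terms over
  \<open>?T\<close>; sorting by the maximum, with \<open>e\<close> and \<open>f\<close> exchanged
  and both flags off, expresses \<open>cell_poly t K L\<close> over the same \<open>?T\<close>,
  since being tied is symmetric. Balance at each \<open>D\<close> makes the first
  \<open>1 + t\<close> times the second, and one copy of \<open>cell_poly t K L\<close>
  cancels.\<close>

lemma cell_poly_recursion:
  fixes t :: "'a::comm_ring_1"
  assumes sp: "\<And>w. sp (initial_bases d p w)"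
    and ef: "e \<noteq> f" and nK: "e \<notin> K" "f \<notin> K" "e \<notin> L" "f \<notin> L"
  shows "t * cell_poly t K L = cell_poly t K (insert f L) + cell_poly t (insert e K) L + cell_poly t (insert e K) (insert f L)"
proof -
  let ?g = "\<lambda>C. t ^ dim (lineal C)"
  let ?S = "{C. C \<in> cells d p \<and> K \<subseteq> \<Inter>C \<and> \<Inter>C \<subseteq> K \<union> {e} \<and> L \<subseteq> - \<Union>C \<and> - \<Union>C \<subseteq> L \<union> {f}}"
  let ?T = "{D. D \<in> minor_cells K L \<and> tied D e f}"
  have b: "balanced t D" if "D \<in> minor_cells K L" for D
  proof -
    have "D \<in> range (initial_bases d p)" using that by (simp add: minor_cells_def cells_def)
    then show ?thesis using sp_balanced sp by blast
  qed
  have 1: "sum ?g ?S = (\<Sum>D\<in>?T. t ^ dim (lineal D) * pos_poly t D e f True True)"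
    using sum_over_pos_faces[OF ef nK, where a = True and b = True and t = t] by simp
  have e2: "minor_cells K L = {C. C \<in> cells d p \<and> K \<subseteq> \<Inter>C \<and> \<Inter>C \<subseteq> K \<and> L \<subseteq> - \<Union>C \<and> - \<Union>C \<subseteq> L}"
    unfolding minor_cells_def by (rule Collect_cong) (simp only: set_eq_subset conj_assoc conj_commute conj_left_commute)
  have e3: "{D. D \<in> minor_cells K L \<and> tied D f e} = ?T" using tied_sym by blast
  have 2: "cell_poly t K L = (\<Sum>D\<in>?T. t ^ dim (lineal D) * pos_poly t D f e False False)"
    unfolding cell_poly_def using sum_over_pos_faces[OF ef[symmetric] nK(2,1,4,3), where a = False and b = False and t = t]
    by (simp add: e3 e2[symmetric])
  have "sum ?g ?S = (\<Sum>D\<in>?T. (1 + t) * (t ^ dim (lineal D) * pos_poly t D f e False False))"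
    unfolding 1
  proof (rule sum.cong[OF refl])
    fix D assume D: "D \<in> ?T"
    then have "pos_poly t D e f True True = (1 + t) * pos_poly t D f e False False"
      using b[of D] ef unfolding balanced_def by blast
    then show "t ^ dim (lineal D) * pos_poly t D e f True True = (1 + t) * (t ^ dim (lineal D) * pos_poly t D f e False False)"
      by (simp add: mult.left_commute)
  qed
  also have "\<dots> = (1 + t) * cell_poly t K L" unfolding 2 sum_distrib_left ..
  finally have 3: "sum ?g ?S = (1 + t) * cell_poly t K L" .
  have dec: "?S = (minor_cells K L \<union> minor_cells K (insert f L)) \<union> (minor_cells (insert e K) L \<union> minor_cells (insert e K) (insert f L))"
  proof (intro equalityI subsetI)
    fix C assume "C \<in> ?S"
    then have C: "C \<in> cells d p" "K \<subseteq> \<Inter>C" "\<Inter>C \<subseteq> insert e K" "L \<subseteq> - \<Union>C" "- \<Union>C \<subseteq> insert f L" by simp_all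
    have "\<Inter>C = K \<or> \<Inter>C = insert e K" using C(2,3) by blast
    moreover have "- \<Union>C = L \<or> - \<Union>C = insert f L" using C(4,5) by blast
    ultimately show "C \<in> (minor_cells K L \<union> minor_cells K (insert f L)) \<union> (minor_cells (insert e K) L \<union> minor_cells (insert e K) (insert f L))"
      using C(1) unfolding minor_cells_def by blast
  next
    fix C assume "C \<in> (minor_cells K L \<union> minor_cells K (insert f L)) \<union> (minor_cells (insert e K) L \<union> minor_cells (insert e K) (insert f L))"
    then have "C \<in> cells d p" "\<Inter>C = K \<or> \<Inter>C = insert e K" "- \<Union>C = L \<or> - \<Union>C = insert f L"
      unfolding minor_cells_def by blast+
    then show "C \<in> ?S" by (simp only: mem_Collect_eq) blast
  qed
  have dj: "minor_cells K L \<inter> minor_cells K (insert f L) = {}" "minor_cells (insert e K) L \<inter> minor_cells (insert e K) (insert f L) = {}"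
    "(minor_cells K L \<union> minor_cells K (insert f L)) \<inter> (minor_cells (insert e K) L \<union> minor_cells (insert e K) (insert f L)) = {}"
  proof -
    have u: "K1 = K2 \<and> L1 = L2" if "C \<in> minor_cells K1 L1" "C \<in> minor_cells K2 L2" for C K1 L1 K2 L2
      using that by (simp add: minor_cells_def)
    have "L \<noteq> insert f L" "K \<noteq> insert e K" using nK by blast+
    then show "minor_cells K L \<inter> minor_cells K (insert f L) = {}" "minor_cells (insert e K) L \<inter> minor_cells (insert e K) (insert f L) = {}"
    "(minor_cells K L \<union> minor_cells K (insert f L)) \<inter> (minor_cells (insert e K) L \<union> minor_cells (insert e K) (insert f L)) = {}"
      using u by blast+
  qed
  have "sum ?g ?S = cell_poly t K L + cell_poly t K (insert f L) + (cell_poly t (insert e K) L + cell_poly t (insert e K) (insert f L))"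
    unfolding dec cell_poly_def sum.union_disjoint[OF finite finite dj(1)] sum.union_disjoint[OF finite finite dj(2)]
      sum.union_disjoint[OF finite finite dj(3)] ..
  then show ?thesis using 3 by (simp add: algebra_simps)
qed

end

section \<open>The Delannoy recursion and its coefficients\<close>

lemma card_Compl: "card (- A) = CARD('n) - card (A :: 'n::finite set)"
  by (simp add: Compl_eq_Diff_UNIV card_Diff_subset)

text \<open>The recursion of \<open>cell_poly\<close> after division by \<open>t\<close> to the
  power \<open>|K| + |L| + 1\<close>; the arguments are the remaining rank and corank. The boundary
  values vanish because remaining elements of rank zero are further loops, and those of corank zero
  further coloops.\<close>

fun delannoy_poly :: "'a::comm_semiring_1 \<Rightarrow> nat \<Rightarrow> nat \<Rightarrow> 'a" where
  "delannoy_poly t 0 0 = 1"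
| "delannoy_poly t 0 (Suc s) = 0"
| "delannoy_poly t (Suc r) 0 = 0"
| "delannoy_poly t (Suc r) (Suc s) = delannoy_poly t (Suc r) s + delannoy_poly t r (Suc s) + t * delannoy_poly t r s"

text \<open>With weight \<open>spread\<close> on each element of \<open>K\<close>, any other set of
  size \<open>d\<close> loses more weight than its value under \<open>p\<close> can make up
  for.\<close>

lemma singleton_cell:
  fixes p :: "'n::finite set \<Rightarrow> real"
  assumes "card K = d"
  shows "{K} \<in> cells d p"
proof -
  let ?w = "(\<chi> i. if i \<in> K then spread d p else 0) :: real ^ 'n"
  have wt: "wt ?w J = spread d p * real (card (J \<inter> K))" for J
    unfolding wt_def by (simp add: sum.If_cases)
  have lt: "p K - wt ?w K < p J - wt ?w J" if "card J = d" "J \<noteq> K" for J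
  proof -
    have "J \<inter> K \<subset> K" using that assms by (metis Int_lower1 Int_lower2 card_subset_eq finite psubsetI)
    then have "card (J \<inter> K) < d" using assms psubset_card_mono[of K "J \<inter> K"] by simp
    then have "spread d p * (real (card (J \<inter> K)) + 1) \<le> spread d p * real d"
      using spread_pos[of d p] by (intro mult_left_mono) auto
    then show ?thesis unfolding wt using spread_ge[OF assms that(1), of p] assms by (simp add: algebra_simps)
  qed
  have "initial_bases d p ?w = {K}"
  proof (intro equalityI subsetI)
    fix I assume I: "I \<in> initial_bases d p ?w"
    show "I \<in> {K}"
    proof (rule ccontr)
      assume "I \<notin> {K}"
      then show False using lt[of I] initial_bases_card[OF I] initial_bases_le[OF I assms] by simp
    qed
  next
    fix I assume "I \<in> {K}"
    moreover have "K \<in> initial_bases d p ?w" unfolding initial_bases_eq mem_Collect_eq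
      using assms lt by (metis less_imp_le order_refl)
    ultimately show "I \<in> initial_bases d p ?w" by simp
  qed
  then show ?thesis unfolding cells_def by (metis rangeI)
qed

lemma cell_card: "C \<in> cells d p \<Longrightarrow> I \<in> C \<Longrightarrow> card I = d"
  unfolding cells_def using initial_bases_card by blast

lemma dim_lineal_singleton: "dim (lineal {K :: 'n::finite set}) = CARD('n)"
proof -
  have "lineal {K} = UNIV" by (intro equalityI subsetI linealI) simp_all
  then show ?thesis by simp
qed

lemma minor_cells_rank_zero:
  fixes p :: "'n::finite set \<Rightarrow> real"
  assumes dn: "d \<le> CARD('n)" and K: "card K = d" and L: "L \<inter> K = {}"
  shows "minor_cells d p K L = (if L = - K then {{K}} else {})"
proof -
  have one: "C = {K}" if C: "C \<in> cells d p" "\<Inter>C = K" for C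
  proof -
    have "I = K" if I: "I \<in> C" for I
    proof -
      have "K \<subseteq> I" using C(2) I by blast
      then show ?thesis using cell_card[OF C(1) I] K by (metis card_subset_eq finite)
    qed
    then show ?thesis using cell_nonempty[OF dn C(1)] by blast
  qed
  show ?thesis
  proof (intro equalityI subsetI)
    fix C assume C: "C \<in> minor_cells d p K L"
    then have "C = {K}" "- \<Union>C = L" using one unfolding minor_cells_def[OF dn] by blast+
    then show "C \<in> (if L = - K then {{K}} else {})" by simp
  next
    fix C assume "C \<in> (if L = - K then {{K}} else {})"
    then have "L = - K" "C = {K}" by (auto split: if_splits)
    then show "C \<in> minor_cells d p K L" unfolding minor_cells_def[OF dn] using singleton_cell[OF K] by simp
  qed
qed

lemma minor_cells_corank_zero:
  fixes p :: "'n::finite set \<Rightarrow> real"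
  assumes dn: "d \<le> CARD('n)" and L: "card (- L) = d" and K: "card K < d"
  shows "minor_cells d p K L = {}"
proof (rule ccontr)
  assume "minor_cells d p K L \<noteq> {}"
  then obtain C where "C \<in> minor_cells d p K L" by blast
  then have C: "C \<in> cells d p" "\<Inter>C = K" "- \<Union>C = L" unfolding minor_cells_def[OF dn] by blast+
  have "I = - L" if I: "I \<in> C" for I
  proof -
    have "I \<subseteq> - L" using C(3) I by blast
    then show ?thesis using cell_card[OF C(1) I] L by (metis card_subset_eq finite)
  qed
  then have "C = {- L}" using cell_nonempty[OF dn C(1)] by blast
  then have "K = - L" using C(2) by simp
  then show False using K L by simp
qed

text \<open>The recursion does not mention \<open>p\<close>, and neither do the values where the
  remaining rank or corank is zero. If both are positive, at least two elements are left to serve as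
  \<open>e\<close> and \<open>f\<close>. The factor \<open>t\<close> is cancelled at the end, whence
  a nonzero \<open>t\<close> in an integral domain.\<close>

theorem cell_poly_eq_delannoy_poly:
  fixes p :: "'n::finite set \<Rightarrow> real" and t :: "'a::idom"
  assumes dn: "d \<le> CARD('n)" and sp: "\<And>w. sp (initial_bases d p w)" and t: "t \<noteq> 0"
  assumes "K \<inter> L = {}" "card K \<le> d" "card L \<le> CARD('n) - d"
  shows "cell_poly d p t K L = t ^ (card K + card L) * delannoy_poly t (d - card K) (CARD('n) - d - card L)"
  using assms(4-6)
proof (induction "(d - card K) + (CARD('n) - d - card L)" arbitrary: K L rule: less_induct)
  case less
  let ?n = "CARD('n)"
  have cL: "card (- L) = ?n - card L" by (simp add: card_Compl)
  have cKL: "card (- (K \<union> L)) = ?n - (card K + card L)"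
    unfolding card_Compl using less.prems(1) by (simp add: card_Un_disjoint)
  show ?case
  proof (cases "d - card K = 0")
    case True
    then have K: "card K = d" using less.prems(2) by simp
    have iff: "L = - K \<longleftrightarrow> ?n - d - card L = 0"
    proof
      assume "L = - K"
      then show "?n - d - card L = 0" using K by (simp add: card_Compl)
    next
      assume "?n - d - card L = 0"
      then have "card (- (K \<union> L)) = 0" using cKL K by simp
      then have "K \<union> L = UNIV" by auto
      then show "L = - K" using less.prems(1) by blast
    qed
    have c: "minor_cells d p K L = (if L = - K then {{K}} else {})"
      by (rule minor_cells_rank_zero[OF dn K]) (use less.prems(1) in blast)
    show ?thesis
    proof (cases "L = - K")
      case True
      have "card K + card L = ?n" using True K dn by (simp add: card_Compl)
      then show ?thesis unfolding cell_poly_def[OF dn] c using True K iff by (simp add: dim_lineal_singleton)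
    next
      case False
      then obtain s where "?n - d - card L = Suc s" using iff by (metis not0_implies_Suc)
      then show ?thesis unfolding cell_poly_def[OF dn] c using False K by simp
    qed
  next
    case rF: False
    then obtain r where r: "d - card K = Suc r" by (metis not0_implies_Suc)
    show ?thesis
    proof (cases "?n - d - card L = 0")
      case True
      have "card (- L) = d" using True less.prems(3) cL dn by linarith
      then have "minor_cells d p K L = {}" using r by (intro minor_cells_corank_zero[OF dn]) simp_all
      then show ?thesis unfolding cell_poly_def[OF dn] using True r by simp
    next
      case False
      then obtain s where s: "?n - d - card L = Suc s" by (metis not0_implies_Suc)
      have "card (- (K \<union> L)) \<ge> 2" using cKL r s dn less.prems by linarith
      then obtain e f where ef: "e \<in> - (K \<union> L)" "f \<in> - (K \<union> L)" "e \<noteq> f"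
        by (metis card_2_iff' card_le_Suc0_iff_eq finite not_less_eq_eq numeral_2_eq_2)
      have nK: "e \<notin> K" "f \<notin> K" "e \<notin> L" "f \<notin> L" using ef by blast+
      let ?K = "insert e K" and ?L = "insert f L"
      have cK: "card ?K = Suc (card K)" "card ?L = Suc (card L)" using nK by simp_all
      have r': "d - card ?K = r" "card ?K \<le> d" using r cK by simp_all
      have s': "?n - d - card ?L = s" "card ?L \<le> ?n - d" using s cK by simp_all
      have dj: "K \<inter> ?L = {}" "?K \<inter> L = {}" "?K \<inter> ?L = {}" using less.prems(1) nK ef(3) by blast+
      have a: "cell_poly d p t K ?L = t ^ (card K + card ?L) * delannoy_poly t (d - card K) (?n - d - card ?L)"
        by (rule less.hyps) (use r s s' dj less.prems in simp_all)
      have b: "cell_poly d p t ?K L = t ^ (card ?K + card L) * delannoy_poly t (d - card ?K) (?n - d - card L)"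
        by (rule less.hyps) (use r s r' dj less.prems in simp_all)
      have c: "cell_poly d p t ?K ?L = t ^ (card ?K + card ?L) * delannoy_poly t (d - card ?K) (?n - d - card ?L)"
        by (rule less.hyps) (use r s r' s' dj less.prems in simp_all)
      have "t * cell_poly d p t K L = cell_poly d p t K ?L + cell_poly d p t ?K L + cell_poly d p t ?K ?L"
        by (rule cell_poly_recursion[OF dn sp ef(3) nK])
      also have "\<dots> = t * (t ^ (card K + card L) * delannoy_poly t (Suc r) (Suc s))"
        unfolding a b c r s r' s' unfolding cK by (simp add: algebra_simps)
      finally show ?thesis unfolding r s using t by simp
    qed
  qed
qed

text \<open>The trinomial coefficient \<open>(a + b + j)! / (a! b! j!)\<close>, which counts lattice
  paths with \<open>a\<close> and \<open>b\<close> steps along the axes and \<open>j\<close>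
  diagonal steps; \<open>tri_rec\<close> removes the last step.\<close>

definition tri :: "nat \<Rightarrow> nat \<Rightarrow> nat \<Rightarrow> nat" where
  "tri a b j = ((a + b + j) choose j) * ((a + b) choose a)"

lemma tri_rec:
  assumes "a + b + j > 0"
  shows "tri a b j = (if b = 0 then 0 else tri a (b - 1) j) + (if a = 0 then 0 else tri (a - 1) b j)
     + (if j = 0 then 0 else tri a b (j - 1))"
proof -
  have pascal: "(a + b) choose a = (if b = 0 then 0 else (a + (b - 1)) choose a) + (if a = 0 then 0 else ((a - 1) + b) choose (a - 1))"
    if "a + b > 0"
    using that by (cases a; cases b) simp_all
  have A: "(if b = 0 then 0 else tri a (b - 1) j) + (if a = 0 then 0 else tri (a - 1) b j)
    = ((a + b - 1 + j) choose j) * ((a + b) choose a)" if h: "a + b > 0"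
  proof -
    have "tri a (b - 1) j = ((a + b - 1 + j) choose j) * ((a + (b - 1)) choose a)" if "b > 0"
      using that by (simp add: tri_def)
    moreover have "tri (a - 1) b j = ((a + b - 1 + j) choose j) * (((a - 1) + b) choose (a - 1))" if "a > 0"
    proof -
      have "a - 1 + b = a + b - 1" using that by simp
      then show ?thesis by (simp add: tri_def)
    qed
    ultimately show ?thesis unfolding pascal[OF h] by (auto simp: algebra_simps)
  qed
  show ?thesis
  proof (cases "a + b > 0")
    case True
    show ?thesis
    proof (cases j)
      case 0
      then show ?thesis unfolding A[OF True] by (simp add: tri_def)
    next
      case (Suc k)
      obtain N where N: "a + b = Suc N" using True by (metis gr0_implies_Suc)
      have "(a + b + j) choose j = ((a + b - 1 + j) choose j) + ((a + b + k) choose k)"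
        unfolding N Suc by simp
      then show ?thesis unfolding A[OF True] using Suc by (simp add: tri_def algebra_simps)
    qed
  next
    case False
    then show ?thesis using assms by (cases j) (simp_all add: tri_def)
  qed
qed

text \<open>As \<open>delannoy_poly\<close> vanishes on the axes away from the origin, every
  contributing path starts with a diagonal step to \<open>(1, 1)\<close>. Of its \<open>i\<close>
  diagonal steps, each of weight \<open>t\<close>, the other \<open>j = i - 1\<close> are mixed with
  \<open>r - i\<close> and \<open>s - i\<close> steps along the axes.\<close>

definition delannoy_coeff :: "nat \<Rightarrow> nat \<Rightarrow> nat \<Rightarrow> nat" where
  "delannoy_coeff r s i = (case i of 0 \<Rightarrow> (if r = 0 \<and> s = 0 then 1 else 0)
     | Suc j \<Rightarrow> (if Suc j \<le> r \<and> Suc j \<le> s then tri (r - Suc j) (s - Suc j) j else 0))"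

lemma delannoy_coeff_rec: "delannoy_coeff (Suc r) (Suc s) i = delannoy_coeff (Suc r) s i + delannoy_coeff r (Suc s) i + (case i of 0 \<Rightarrow> 0 | Suc j \<Rightarrow> delannoy_coeff r s j)"
proof (cases i)
  case 0
  then show ?thesis by (simp add: delannoy_coeff_def)
next
  case (Suc j)
  show ?thesis
  proof (cases "j \<le> r \<and> j \<le> s")
    case True
    then obtain a b where ab: "r = a + j" "s = b + j" by (metis add.commute le_Suc_ex)
    have 1: "delannoy_coeff (Suc r) (Suc s) i = tri a b j" unfolding Suc ab by (simp add: delannoy_coeff_def)
    have 2: "delannoy_coeff (Suc r) s i = (if b = 0 then 0 else tri a (b - 1) j)" unfolding Suc ab by (cases b) (simp_all add: delannoy_coeff_def)
    have 3: "delannoy_coeff r (Suc s) i = (if a = 0 then 0 else tri (a - 1) b j)" unfolding Suc ab by (cases a) (simp_all add: delannoy_coeff_def)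
    have 4: "delannoy_coeff r s j = (if j = 0 then (if a = 0 \<and> b = 0 then 1 else 0) else tri a b (j - 1))"
      unfolding ab by (cases j) (simp_all add: delannoy_coeff_def)
    show ?thesis
    proof (cases "a + b + j = 0")
      case True
      then show ?thesis unfolding 1 2 3 using 4 Suc by (simp add: tri_def)
    next
      case False
      then have "tri a b j = (if b = 0 then 0 else tri a (b - 1) j) + (if a = 0 then 0 else tri (a - 1) b j)
        + (if j = 0 then 0 else tri a b (j - 1))" by (intro tri_rec) simp
      then show ?thesis unfolding 1 2 3 using 4 Suc False by (cases "j = 0") simp_all
    qed
  next
    case False
    then show ?thesis unfolding Suc by (cases j) (auto simp: delannoy_coeff_def)
  qed
qed

lemma coeff_delannoy_poly: "coeff (delannoy_poly [:0, 1:] r s) i = int (delannoy_coeff r s i)"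
proof (induction "[:0, 1:] :: int poly" r s arbitrary: i rule: delannoy_poly.induct)
  case 1
  then show ?case by (cases i) (simp_all add: delannoy_coeff_def one_pCons)
next
  case (2 s)
  then show ?case by (cases i) (simp_all add: delannoy_coeff_def)
next
  case (3 r)
  then show ?case by (cases i) (simp_all add: delannoy_coeff_def)
next
  case (4 r s)
  have "coeff ([:0, 1:] * delannoy_poly [:0, 1:] r s) i = (case i of 0 \<Rightarrow> 0 | Suc j \<Rightarrow> coeff (delannoy_poly [:0, 1:] r s) j)"
    by (simp add: coeff_pCons split: nat.split)
  then show ?case unfolding delannoy_poly.simps coeff_add delannoy_coeff_rec using 4 by (cases i) simp_all
qed

theorem card_interior_cells:
  fixes p :: "'n::finite set \<Rightarrow> real"
  assumes dn: "d \<le> CARD('n)" and sp: "\<And>w. sp (initial_bases d p w)"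
  shows "card {C \<in> cells d p. \<Inter>C = {} \<and> \<Union>C = UNIV \<and> dim (lineal C) = i} = delannoy_coeff d (CARD('n) - d) i"
proof -
  \<comment> \<open>With the polynomial variable for \<open>t\<close>, coefficient \<open>i\<close>
    counts the cells of dimension \<open>i\<close>.\<close>
  let ?t = "[:0, 1:] :: int poly"
  have "cell_poly d p ?t {} {} = delannoy_poly ?t d (CARD('n) - d)"
    using cell_poly_eq_delannoy_poly[OF dn sp, of ?t "{}" "{}"] by simp
  then have "coeff (cell_poly d p ?t {} {}) i = int (delannoy_coeff d (CARD('n) - d) i)" by (simp add: coeff_delannoy_poly)
  moreover have "coeff (cell_poly d p ?t {} {}) i = (\<Sum>C\<in>minor_cells d p {} {}. if dim (lineal C) = i then 1 else 0)"
  proof -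
    have "?t ^ k = monom 1 k" for k by (simp add: monom_altdef)
    then show ?thesis unfolding cell_poly_def[OF dn] by (simp add: coeff_sum)
  qed
  moreover have "(\<Sum>C\<in>minor_cells d p {} {}. if dim (lineal C) = i then 1 else (0::int)) = int (card {C \<in> minor_cells d p {} {}. dim (lineal C) = i})"
    by (simp add: sum.If_cases Int_def)
  moreover have "{C \<in> minor_cells d p {} {}. dim (lineal C) = i} = {C \<in> cells d p. \<Inter>C = {} \<and> \<Union>C = UNIV \<and> dim (lineal C) = i}"
    unfolding minor_cells_def[OF dn] by (rule Collect_cong) (simp only: mem_Collect_eq Compl_empty_eq[symmetric] boolean_algebra.compl_eq_compl_iff conj_assoc, metis double_complement Compl_UNIV_eq)
  ultimately show ?thesis by simp
qed

section \<open>Valuated exchange\<close>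

lemma card_exchange:
  fixes B :: "'n::finite set"
  assumes "u \<in> B" "v \<notin> B"
  shows "card (insert v (B - {u})) = card B"
proof -
  have "card (B - {u}) = card B - 1" "card B > 0" using assms by (auto simp: card_gt_0_iff)
  then show ?thesis using assms by simp
qed

lemma ex_least_value:
  fixes h :: "'b \<Rightarrow> real"
  assumes "finite A" "A \<noteq> {}"
  shows "\<exists>a\<in>A. \<forall>b\<in>A. h a \<le> h b"
proof -
  have fin: "finite (h ` A)" "h ` A \<noteq> {}" using assms by auto
  from Min_in[OF fin] obtain a where a: "a \<in> A" "Min (h ` A) = h a" by (rule imageE) (rule that)
  have "h a \<le> h b" if "b \<in> A" for b using Min_le[OF fin(1), of "h b"] that unfolding a(2) by simp
  then show ?thesis using a(1) by blast
qed

text \<open>A minimum of three numbers that is attained twice is attained by one of the last two,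
  which is then at most the first. All three sums carry the same total weight, so \<open>p\<close>
  may be replaced by \<open>q\<close>.\<close>

lemma three_term:
  fixes p :: "'n::finite set \<Rightarrow> real" and w :: "real ^ 'n"
  assumes p: "tropical_pluecker d p" and A: "card A = d" and v: "v1 \<in> A" "v2 \<in> A" "v1 \<noteq> v2"
    and u: "u1 \<notin> A" "u2 \<notin> A" "u1 \<noteq> u2"
  defines "q \<equiv> \<lambda>I. p I - wt w I"
  shows "q (insert u1 (A - {v1})) + q (insert u2 (A - {v2})) \<le> q A + q (insert u1 (insert u2 (A - {v1, v2})))
    \<or> q (insert u2 (A - {v1})) + q (insert u1 (A - {v2})) \<le> q A + q (insert u1 (insert u2 (A - {v1, v2})))"
proof -
  let ?S = "A - {v1, v2}"
  let ?f = "\<lambda>m. [p (?S \<union> {v1, v2}) + p (?S \<union> {u1, u2}), p (?S \<union> {v1, u1}) + p (?S \<union> {v2, u2}),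
    p (?S \<union> {v1, u2}) + p (?S \<union> {v2, u1})] ! m"
  have e: "?S \<union> {v1, v2} = A" "?S \<union> {u1, u2} = insert u1 (insert u2 ?S)"
    "?S \<union> {v1, u1} = insert u1 (A - {v2})" "?S \<union> {v2, u2} = insert u2 (A - {v1})"
    "?S \<union> {v1, u2} = insert u2 (A - {v2})" "?S \<union> {v2, u1} = insert u1 (A - {v1})"
    using v by auto
  have "card ?S = card A - card {v1, v2}" by (rule card_Diff_subset) (use v in auto)
  moreover have "card {v1, v2} \<le> card A" by (rule card_mono) (use v in auto)
  moreover have "card {v1, v2} = 2" using v(3) by simp
  ultimately have c: "card ?S + 2 = d" using A by linarith
  have d: "distinct [v1, v2, u1, u2]" using v u by auto
  have i: "{v1, v2, u1, u2} \<inter> ?S = {}" using u by auto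
  have "min_attained_twice ?f {..<3}" using p c d i unfolding tropical_pluecker_def by blast
  then obtain a b where ab: "a < 3" "b < 3" "a \<noteq> b" "?f a = ?f b" "\<forall>c\<in>{..<3}. ?f a \<le> ?f c"
    unfolding min_attained_twice_def by blast
  have a0: "?f a \<le> ?f 0" by (rule bspec[OF ab(5)]) simp
  have b0: "?f b \<le> ?f 0" using a0 ab(4) by simp
  have "?f 1 \<le> ?f 0 \<or> ?f 2 \<le> ?f 0"
  proof (cases "a = 0")
    case True
    then have "b = 1 \<or> b = 2" using ab(2,3) by linarith
    then show ?thesis using b0 by auto
  next
    case False
    then have "a = 1 \<or> a = 2" using ab(1) by linarith
    then show ?thesis using a0 by auto
  qed
  then have k: "p (insert u1 (A - {v2})) + p (insert u2 (A - {v1})) \<le> p A + p (insert u1 (insert u2 ?S))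
    \<or> p (insert u2 (A - {v2})) + p (insert u1 (A - {v1})) \<le> p A + p (insert u1 (insert u2 ?S))"
    unfolding e by (simp add: numeral_2_eq_2)
  have w1: "wt w (insert u1 (A - {v1})) = wt w A - w $ v1 + w $ u1" "wt w (insert u2 (A - {v2})) = wt w A - w $ v2 + w $ u2"
    "wt w (insert u2 (A - {v1})) = wt w A - w $ v1 + w $ u2" "wt w (insert u1 (A - {v2})) = wt w A - w $ v2 + w $ u1"
    using v u by (simp_all add: wt_exchange)
  have "insert u1 (insert u2 ?S) = insert u1 (insert u2 (A - {v2}) - {v1})" using v u by auto
  then have w2: "wt w (insert u1 (insert u2 ?S)) = wt w A - w $ v2 + w $ u2 - w $ v1 + w $ u1"
    using v u by (simp add: wt_exchange)
  show ?thesis unfolding q_def w1 w2 using k by (elim disjE) (simp_all add: algebra_simps)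
qed

text \<open>Three-term exchange implies the full symmetric exchange property of valuated matroids; the
  argument is Murota's, with the weight vector chosen so that all exchanges of \<open>u\<close> in \<open>B\<close> are free.\<close>

theorem valuated_exchange:
  fixes p :: "'n::finite set \<Rightarrow> real"
  assumes p: "tropical_pluecker d p" and B: "card B = d"
  shows "card B' = d \<Longrightarrow> u \<in> B - B' \<Longrightarrow>
    \<exists>v\<in>B' - B. p (insert v (B - {u})) + p (insert u (B' - {v})) \<le> p B + p B'"
proof (induction "card (B - B')" arbitrary: B' rule: less_induct)
  case less
  note B' = less.prems(1) and u = less.prems(2)
  show ?case
  proof (rule ccontr)
    assume neg: "\<not> ?thesis"
    have cc: "card (B - B') = card (B' - B)" by (simp add: card_Diff_subset_Int B B' Int_commute)
    have "card (B - B') > 0" using u by (auto simp: card_gt_0_iff)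
    then obtain v0 where v0: "v0 \<in> B' - B" using cc by (metis card_gt_0_iff ex_in_conv)
    have "\<exists>u1. u1 \<in> B - B' \<and> u1 \<noteq> u"
    proof (rule ccontr)
      assume "\<not> ?thesis"
      then have "B - B' = {u}" using u by blast
      then have "card (B' - B) = 1" using cc by simp
      then have "B' - B = {v0}" using v0 by (metis card_1_singletonE singletonD)
      then have "insert v0 (B - {u}) = B'" "insert u (B' - {v0}) = B" using \<open>B - B' = {u}\<close> by blast+
      then show False using neg v0 by (metis add.commute order_refl)
    qed
    then obtain u1 where u1: "u1 \<in> B - B'" "u1 \<noteq> u" by blast
    define w where "w = (\<chi> i. if i \<in> B' - B then p (insert i (B - {u})) - p B else 0)"
    define q where "q = (\<lambda>I. p I - wt w I)"
    have wB: "wt w B = 0" unfolding wt_def w_def by (rule sum.neutral) simp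
    have qv: "q (insert v (B - {u})) = q B" if v: "v \<in> B' - B" for v
    proof -
      have "wt w (insert v (B - {u})) = wt w B - w $ u + w $ v" by (rule wt_exchange) (use u v in auto)
      then show ?thesis unfolding q_def wB using u v by (simp add: w_def)
    qed
    have fail: "q B' < q (insert u (B' - {v}))" if v: "v \<in> B' - B" for v
    proof -
      have "p B + p B' < p (insert v (B - {u})) + p (insert u (B' - {v}))" using neg v by (metis not_le)
      moreover have "wt w (insert v (B - {u})) = wt w B - w $ u + w $ v" by (rule wt_exchange) (use u v in auto)
      moreover have "wt w (insert u (B' - {v})) = wt w B' - w $ v + w $ u" by (rule wt_exchange) (use u v in auto)
      ultimately show ?thesis using qv[OF v] unfolding q_def by simp
    qed
    \<comment> \<open>The induction hypothesis will be applied to \<open>?B2\<close>, which is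
      closer to \<open>B\<close> by the exchange of \<open>v1\<close> for \<open>u1\<close>.
      Minimality of \<open>v1\<close> bounds \<open>q ?B2\<close> by the value of the exchange of
      \<open>v\<close> for \<open>u1\<close>, which refutes the second alternative of the three-term
      relation.\<close>
    have "\<exists>v1\<in>B' - B. \<forall>v\<in>B' - B. q (insert u1 (B' - {v1})) \<le> q (insert u1 (B' - {v}))"
      by (rule ex_least_value) (use v0 in auto)
    then obtain v1 where v1: "v1 \<in> B' - B" "\<forall>v\<in>B' - B. q (insert u1 (B' - {v1})) \<le> q (insert u1 (B' - {v}))"
      by (elim bexE) (rule that)
    let ?B2 = "insert u1 (B' - {v1})"
    have cB2: "card ?B2 = d" using card_exchange[of v1 B' u1] v1(1) u1(1) B' by simp
    have "B - ?B2 \<subset> B - B'" using u1 v1(1) by blast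
    then have "card (B - ?B2) < card (B - B')" by (intro psubset_card_mono) simp_all
    moreover have "u \<in> B - ?B2" using u u1(2) by blast
    ultimately obtain v where v: "v \<in> ?B2 - B"
      "p (insert v (B - {u})) + p (insert u (?B2 - {v})) \<le> p B + p ?B2" using less.hyps[OF _ cB2] by blast
    have vB: "v \<in> B' - B" "v \<noteq> v1" using v(1) u1(1) by blast+
    let ?X = "insert u1 (insert u (B' - {v1, v}))"
    have X: "insert u (?B2 - {v}) = ?X" using v(1) u1(1) by blast
    have "wt w (insert v (B - {u})) = wt w B - w $ u + w $ v" by (rule wt_exchange) (use u vB in auto)
    moreover have "wt w (insert u (?B2 - {v})) = wt w ?B2 - w $ v + w $ u" by (rule wt_exchange) (use u v u1 in auto)
    ultimately have qX: "q ?X \<le> q ?B2" using v(2) qv[OF vB(1)] unfolding X q_def by simp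
    have "q (insert u1 (B' - {v1})) + q (insert u (B' - {v})) \<le> q B' + q ?X
      \<or> q (insert u (B' - {v1})) + q (insert u1 (B' - {v})) \<le> q B' + q ?X"
      unfolding q_def by (rule three_term[OF p B']) (use v1(1) vB u u1 in auto)
    then show False using qX fail[OF vB(1)] fail[OF v1(1)] bspec[OF v1(2) vB(1)] by linarith
  qed
qed

lemma wt_remove: "j \<in> J \<Longrightarrow> wt w (J - {j}) = wt w J - w $ j"
  unfolding wt_def by (simp add: sum.remove)

text \<open>For a loop \<open>i\<close> and a basis \<open>B\<close>, removing either of the two
  minimizers from \<open>J = B + i\<close> leaves a set at least as good as \<open>B\<close>, hence
  a basis, and one of the two sets contains \<open>i\<close>. Here \<open>p\<close> is an arbitrary
  function, so that dual vectors are covered.\<close>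

lemma loopfree_of_tropical_linear_space:
  fixes p :: "'n::finite set \<Rightarrow> real"
  assumes dn: "d \<le> CARD('n)" and w: "w \<in> tropical_linear_space d p"
  shows "\<Union>(initial_bases d p w) = UNIV"
proof (rule ccontr)
  assume "\<Union>(initial_bases d p w) \<noteq> UNIV"
  then obtain i where i: "i \<notin> \<Union>(initial_bases d p w)" by blast
  obtain B where B: "B \<in> initial_bases d p w" using initial_bases_nonempty[OF dn] by blast
  have iB: "i \<notin> B" using i B by blast
  let ?J = "insert i B"
  have cJ: "card ?J = d + 1" using iB initial_bases_card[OF B] by simp
  obtain a b where ab: "a \<in> ?J" "b \<in> ?J" "a \<noteq> b" "p (?J - {a}) + w $ a = p (?J - {b}) + w $ b"
    "\<forall>c\<in>?J. p (?J - {a}) + w $ a \<le> p (?J - {c}) + w $ c"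
    using w cJ unfolding tropical_linear_space_def min_attained_twice_def by blast
  have Ji: "?J - {i} = B" using iB by simp
  have in_ib: "?J - {z} \<in> initial_bases d p w" if z: "z \<in> ?J" "p (?J - {z}) + w $ z \<le> p (?J - {i}) + w $ i" for z
  proof (rule initial_basesI[OF B])
    show "card (?J - {z}) = d" using z(1) cJ by simp
    show "p (?J - {z}) - wt w (?J - {z}) \<le> p B - wt w B"
      using z(2) wt_remove[OF z(1), of w] wt_remove[of i ?J w] unfolding Ji by simp
  qed
  have le: "p (?J - {a}) + w $ a \<le> p (?J - {i}) + w $ i" using ab(5) by simp
  have "?J - {a} \<in> initial_bases d p w" "?J - {b} \<in> initial_bases d p w"
    using in_ib[OF ab(1) le] in_ib[OF ab(2)] le ab(4) by simp_all
  moreover have "i \<in> ?J - {a} \<or> i \<in> ?J - {b}" using ab(3) by blast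
  ultimately show False using i by blast
qed

text \<open>For the converse, take a minimizer \<open>j0\<close> in \<open>J\<close> and a basis
  through \<open>j0\<close>, and exchange \<open>j0\<close> with the set \<open>J - {j0}\<close>.
  Since the basis cannot improve, the element \<open>v\<close> obtained is a second
  minimizer.\<close>

theorem tropical_linear_space_eq:
  fixes p :: "'n::finite set \<Rightarrow> real"
  assumes p: "tropical_pluecker d p"
  shows "tropical_linear_space d p = {w. \<Union>(initial_bases d p w) = UNIV}"
proof (intro equalityI subsetI)
  have dn: "d \<le> CARD('n)" using p by (simp add: tropical_pluecker_def)
  fix w assume "w \<in> tropical_linear_space d p"
  then show "w \<in> {w. \<Union>(initial_bases d p w) = UNIV}" using loopfree_of_tropical_linear_space[OF dn] by blast
next
  fix w assume "w \<in> {w. \<Union>(initial_bases d p w) = UNIV}"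
  then have w: "\<And>i. \<exists>B\<in>initial_bases d p w. i \<in> B" by blast
  show "w \<in> tropical_linear_space d p" unfolding tropical_linear_space_def mem_Collect_eq
  proof (intro allI impI)
    fix J :: "'n set" assume cJ: "card J = d + 1"
    let ?f = "\<lambda>j. p (J - {j}) + w $ j"
    have "J \<noteq> {}" using cJ by auto
    have "\<exists>j0\<in>J. \<forall>j\<in>J. ?f j0 \<le> ?f j" by (rule ex_least_value) (use \<open>J \<noteq> {}\<close> in simp_all)
    then obtain j0 where j0: "j0 \<in> J" and min: "\<forall>j\<in>J. ?f j0 \<le> ?f j" by (elim bexE) (rule that)
    obtain B where B: "B \<in> initial_bases d p w" "j0 \<in> B" using w by blast
    let ?I = "J - {j0}"
    have cI: "card ?I = d" using cJ j0 by simp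
    obtain v where v: "v \<in> ?I - B" "p (insert v (B - {j0})) + p (insert j0 (?I - {v})) \<le> p B + p ?I"
      using valuated_exchange[OF p initial_bases_card[OF B(1)] cI, of j0] B(2) by blast
    have e: "insert j0 (?I - {v}) = J - {v}" using j0 v(1) by auto
    have ce: "card (insert v (B - {j0})) = d" using card_exchange[of j0 B v] B v initial_bases_card[OF B(1)] by simp
    have "p B - wt w B \<le> p (insert v (B - {j0})) - wt w (insert v (B - {j0}))" by (rule initial_bases_le[OF B(1) ce])
    moreover have "wt w (insert v (B - {j0})) = wt w B - w $ j0 + w $ v" by (rule wt_exchange) (use B v in auto)
    ultimately have "?f v \<le> ?f j0" using v(2) unfolding e by simp
    moreover have "?f j0 \<le> ?f v" by (rule bspec[OF min]) (use v(1) in blast)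
    ultimately have "?f j0 = ?f v" by linarith
    moreover have "v \<in> J" "j0 \<noteq> v" using v(1) by blast+
    ultimately show "min_attained_twice ?f J" unfolding min_attained_twice_def using j0 min by blast
  qed
qed

section \<open>Transverse intersection of series-parallel families\<close>

abbreviation nt :: "'n set set \<Rightarrow> 'n set" where
  "nt M \<equiv> \<Union>M - \<Inter>M"

lemma ppairD:
  assumes "ppair M x y"
  shows "x \<noteq> y" "\<And>I. I \<in> M \<Longrightarrow> x \<in> I \<Longrightarrow> y \<notin> I" "\<And>I. I \<in> M \<Longrightarrow> y \<in> I \<Longrightarrow> x \<notin> I"
    "\<And>I. I \<in> M \<Longrightarrow> x \<in> I \<Longrightarrow> insert y (I - {x}) \<in> M"
    "\<And>I. I \<in> M \<Longrightarrow> y \<in> I \<Longrightarrow> insert x (I - {y}) \<in> M"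
    "x \<in> \<Union>M" "y \<in> \<Union>M" "x \<notin> \<Inter>M" "y \<notin> \<Inter>M"
proof -
  have h: "x \<noteq> y" "\<forall>I\<in>M. \<not> (x \<in> I \<and> y \<in> I)" "\<forall>I\<in>M. x \<in> I \<longrightarrow> insert y (I - {x}) \<in> M"
    "\<forall>I\<in>M. y \<in> I \<longrightarrow> insert x (I - {y}) \<in> M" "x \<in> \<Union>M"
    using assms unfolding ppair_def by simp_all
  have s: "y \<in> \<Union>M" using ppair_sym[OF assms] unfolding ppair_def by simp
  show "x \<noteq> y" by (rule h(1))
  show a: "y \<notin> I" if "I \<in> M" "x \<in> I" for I using bspec[OF h(2) that(1)] that(2) by simp
  show b: "x \<notin> I" if "I \<in> M" "y \<in> I" for I using bspec[OF h(2) that(1)] that(2) by simp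
  show "insert y (I - {x}) \<in> M" if "I \<in> M" "x \<in> I" for I using bspec[OF h(3) that(1)] that(2) by simp
  show "insert x (I - {y}) \<in> M" if "I \<in> M" "y \<in> I" for I using bspec[OF h(4) that(1)] that(2) by simp
  show "x \<in> \<Union>M" "y \<in> \<Union>M" by (rule h(5)) (rule s)
  obtain I J where IJ: "I \<in> M" "x \<in> I" "J \<in> M" "y \<in> J" using h(5) s by (elim UnionE) (rule that)
  show "x \<notin> \<Inter>M" using b[OF IJ(3,4)] IJ(3) by (meson InterD)
  show "y \<notin> \<Inter>M" using a[OF IJ(1,2)] IJ(1) by (meson InterD)
qed

lemma ppairI:
  assumes "x \<noteq> y" "x \<in> \<Union>M" "\<And>I. I \<in> M \<Longrightarrow> x \<in> I \<Longrightarrow> y \<notin> I"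
    "\<And>I. I \<in> M \<Longrightarrow> x \<in> I \<Longrightarrow> insert y (I - {x}) \<in> M"
    "\<And>I. I \<in> M \<Longrightarrow> y \<in> I \<Longrightarrow> insert x (I - {y}) \<in> M"
  shows "ppair M x y"
  unfolding ppair_def using assms by simp

lemma spairD:
  assumes "spair M x y"
  shows "x \<noteq> y" "\<And>I. I \<in> M \<Longrightarrow> x \<notin> I \<Longrightarrow> y \<in> I" "\<And>I. I \<in> M \<Longrightarrow> y \<notin> I \<Longrightarrow> x \<in> I"
    "\<And>I. I \<in> M \<Longrightarrow> x \<notin> I \<Longrightarrow> insert x (I - {y}) \<in> M"
    "\<And>I. I \<in> M \<Longrightarrow> y \<notin> I \<Longrightarrow> insert y (I - {x}) \<in> M"
    "\<exists>I\<in>M. x \<notin> I" "\<exists>I\<in>M. y \<notin> I" "x \<in> \<Union>M" "y \<in> \<Union>M" "x \<notin> \<Inter>M" "y \<notin> \<Inter>M"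
proof -
  have h: "x \<noteq> y" "\<forall>I\<in>M. x \<in> I \<or> y \<in> I" "\<forall>I\<in>M. x \<notin> I \<longrightarrow> insert x (I - {y}) \<in> M"
    "\<forall>I\<in>M. y \<notin> I \<longrightarrow> insert y (I - {x}) \<in> M" "\<exists>I\<in>M. x \<notin> I"
    using assms unfolding spair_def by simp_all
  have s: "\<exists>I\<in>M. y \<notin> I" using spair_sym[OF assms] unfolding spair_def by simp
  show "x \<noteq> y" by (rule h(1))
  show a: "y \<in> I" if "I \<in> M" "x \<notin> I" for I using bspec[OF h(2) that(1)] that(2) by simp
  show b: "x \<in> I" if "I \<in> M" "y \<notin> I" for I using bspec[OF h(2) that(1)] that(2) by simp
  show "insert x (I - {y}) \<in> M" if "I \<in> M" "x \<notin> I" for I using bspec[OF h(3) that(1)] that(2) by simp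
  show "insert y (I - {x}) \<in> M" if "I \<in> M" "y \<notin> I" for I using bspec[OF h(4) that(1)] that(2) by simp
  show "\<exists>I\<in>M. x \<notin> I" "\<exists>I\<in>M. y \<notin> I" by (rule h(5)) (rule s)
  obtain I J where IJ: "I \<in> M" "x \<notin> I" "J \<in> M" "y \<notin> J" using h(5) s by (elim bexE) (rule that)
  show "x \<in> \<Union>M" by (rule UnionI[OF IJ(3) b[OF IJ(3,4)]])
  show "y \<in> \<Union>M" by (rule UnionI[OF IJ(1) a[OF IJ(1,2)]])
  show "x \<notin> \<Inter>M" using IJ(1,2) by (meson InterD)
  show "y \<notin> \<Inter>M" using IJ(3,4) by (meson InterD)
qed

lemma spairI:
  assumes "x \<noteq> y" "J \<in> M" "x \<notin> J" "\<And>I. I \<in> M \<Longrightarrow> x \<notin> I \<Longrightarrow> y \<in> I"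
    "\<And>I. I \<in> M \<Longrightarrow> x \<notin> I \<Longrightarrow> insert x (I - {y}) \<in> M"
    "\<And>I. I \<in> M \<Longrightarrow> y \<notin> I \<Longrightarrow> insert y (I - {x}) \<in> M"
  shows "spair M x y"
proof -
  have "\<exists>I\<in>M. x \<notin> I" using assms(2,3) by (rule bexI[rotated])
  moreover have "\<forall>I\<in>M. x \<in> I \<or> y \<in> I" using assms(4) by metis
  ultimately show ?thesis unfolding spair_def using assms(1,5,6) by simp
qed

text \<open>Every set through \<open>x\<close> arises from a set through \<open>y\<close> by a swap,
  so an exchange valid in \<open>del x M\<close> can be performed before the swap.\<close>

lemma ppair_lift_ppair:
  assumes xy: "ppair M x y" and ab: "ppair (del x M) a b"
  shows "ppair M a b"
proof -
  note X = ppairD[OF xy] and A = ppairD[OF ab]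
  have ax: "a \<noteq> x" "b \<noteq> x" using A(6,7) by blast+
  have red: "\<exists>I0. I0 \<in> del x M \<and> y \<in> I0 \<and> I = insert x (I0 - {y})" if I: "I \<in> M" "x \<in> I" for I
  proof (rule exI[of _ "insert y (I - {x})"], intro conjI)
    show "insert y (I - {x}) \<in> del x M" using X(4)[OF I] X(1) by simp
    show "I = insert x (insert y (I - {x}) - {y})" using X(2)[OF I] I(2) by auto
  qed simp_all
  have sw: "insert b' (I - {a'}) \<in> M" if I: "I \<in> M" "a' \<in> I" and ab': "a' = a \<and> b' = b \<or> a' = b \<and> b' = a" for I a' b'
  proof (cases "x \<in> I")
    case False
    then have i: "I \<in> del x M" using I by simp
    have "insert b' (I - {a'}) \<in> del x M" using ab'
    proof (elim disjE conjE)
      assume e: "a' = a" "b' = b"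
      show ?thesis unfolding e by (rule A(4)[OF i]) (use I(2) e in simp)
    next
      assume e: "a' = b" "b' = a"
      show ?thesis unfolding e by (rule A(5)[OF i]) (use I(2) e in simp)
    qed
    then show ?thesis by simp
  next
    case True
    obtain I0 where I0: "I0 \<in> del x M" "y \<in> I0" "I = insert x (I0 - {y})" using red[OF I(1) True] by blast
    have a0: "a' \<in> I0" "a' \<noteq> y" "a' \<noteq> x" using I(2) I0(3) ax ab' by auto
    have i0: "insert b' (I0 - {a'}) \<in> del x M" using ab'
    proof (elim disjE conjE)
      assume e: "a' = a" "b' = b"
      show ?thesis unfolding e by (rule A(4)[OF I0(1)]) (use a0(1) e in simp)
    next
      assume e: "a' = b" "b' = a"
      show ?thesis unfolding e by (rule A(5)[OF I0(1)]) (use a0(1) e in simp)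
    qed
    have yb: "b' \<noteq> y" using ab' A(2)[OF I0(1)] A(3)[OF I0(1)] I0(2) a0(1) by (elim disjE conjE) (metis, metis)
    have "insert x (insert b' (I0 - {a'}) - {y}) \<in> M" using X(5)[of "insert b' (I0 - {a'})"] i0 I0(2) a0(2) by simp
    moreover have "insert x (insert b' (I0 - {a'}) - {y}) = insert b' (I - {a'})" using I0(3) a0 yb ax ab' by auto
    ultimately show ?thesis by simp
  qed
  show ?thesis
  proof (rule ppairI)
    show "a \<noteq> b" by (rule A(1))
    show "a \<in> \<Union>M" using A(6) by blast
    show "insert b (I - {a}) \<in> M" if "I \<in> M" "a \<in> I" for I using sw[OF that] by simp
    show "insert a (I - {b}) \<in> M" if "I \<in> M" "b \<in> I" for I using sw[OF that] by simp
    show "b \<notin> I" if I: "I \<in> M" "a \<in> I" for I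
    proof (cases "x \<in> I")
      case False then show ?thesis using A(2) I by simp
    next
      case True
      obtain I0 where I0: "I0 \<in> del x M" "y \<in> I0" "I = insert x (I0 - {y})" using red[OF I(1) True] by blast
      have "a \<in> I0" using I(2) I0(3) ax by blast
      then show ?thesis using A(2)[OF I0(1)] I0(3) ax by blast
    qed
  qed
qed

text \<open>Pairs containing \<open>y\<close> are excluded, because a set of \<open>M\<close> may
  use \<open>x\<close> in place of \<open>y\<close> and so avoid both \<open>y\<close> and its
  series partner.\<close>

lemma ppair_lift_spair:
  assumes xy: "ppair M x y" and ab: "spair (del x M) a b" "a \<noteq> y" "b \<noteq> y"
  shows "spair M a b" "a \<noteq> x" "b \<noteq> x"
proof -
  note X = ppairD[OF xy] and A = spairD[OF ab(1)]
  show ax: "a \<noteq> x" "b \<noteq> x" using A(8,9) by blast+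
  have red: "\<exists>I0. I0 \<in> del x M \<and> y \<in> I0 \<and> I = insert x (I0 - {y})" if I: "I \<in> M" "x \<in> I" for I
  proof (rule exI[of _ "insert y (I - {x})"], intro conjI)
    show "insert y (I - {x}) \<in> del x M" using X(4)[OF I] X(1) by simp
    show "I = insert x (insert y (I - {x}) - {y})" using X(2)[OF I] I(2) by auto
  qed simp_all
  have sw: "insert a' (I - {b'}) \<in> M" if I: "I \<in> M" "a' \<notin> I" and ab': "a' = a \<and> b' = b \<or> a' = b \<and> b' = a" for I a' b'
  proof (cases "x \<in> I")
    case False
    then have i: "I \<in> del x M" using I by simp
    have "insert a' (I - {b'}) \<in> del x M" using ab'
    proof (elim disjE conjE)
      assume e: "a' = a" "b' = b"
      show ?thesis unfolding e by (rule A(4)[OF i]) (use I(2) e in simp)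
    next
      assume e: "a' = b" "b' = a"
      show ?thesis unfolding e by (rule A(5)[OF i]) (use I(2) e in simp)
    qed
    then show ?thesis by simp
  next
    case True
    obtain I0 where I0: "I0 \<in> del x M" "y \<in> I0" "I = insert x (I0 - {y})" using red[OF I(1) True] by blast
    have a0: "a' \<notin> I0" "a' \<noteq> y" "b' \<noteq> y" "a' \<noteq> x" "b' \<noteq> x" using I(2) I0(3) ax ab' ab(2,3) by auto
    have i0: "insert a' (I0 - {b'}) \<in> del x M" using ab'
    proof (elim disjE conjE)
      assume e: "a' = a" "b' = b"
      show ?thesis unfolding e by (rule A(4)[OF I0(1)]) (use a0(1) e in simp)
    next
      assume e: "a' = b" "b' = a"
      show ?thesis unfolding e by (rule A(5)[OF I0(1)]) (use a0(1) e in simp)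
    qed
    have "insert x (insert a' (I0 - {b'}) - {y}) \<in> M" using X(5)[of "insert a' (I0 - {b'})"] i0 I0(2) a0 by simp
    moreover have "insert x (insert a' (I0 - {b'}) - {y}) = insert a' (I - {b'})" using I0(3) a0 by auto
    ultimately show ?thesis by simp
  qed
  obtain J where J: "J \<in> del x M" "a \<notin> J" using A(6) by blast
  show "spair M a b"
  proof (rule spairI[of _ _ J])
    show "a \<noteq> b" by (rule A(1))
    show "J \<in> M" "a \<notin> J" using J by simp_all
    show "insert a (I - {b}) \<in> M" if "I \<in> M" "a \<notin> I" for I using sw[OF that] by simp
    show "insert b (I - {a}) \<in> M" if "I \<in> M" "b \<notin> I" for I using sw[OF that] by simp
    show "b \<in> I" if I: "I \<in> M" "a \<notin> I" for I
    proof (cases "x \<in> I")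
      case False then show ?thesis using A(2) I by simp
    next
      case True
      obtain I0 where I0: "I0 \<in> del x M" "y \<in> I0" "I = insert x (I0 - {y})" using red[OF I(1) True] by blast
      have "a \<notin> I0" using I(2) I0(3) ab(2) by blast
      then show ?thesis using A(2)[OF I0(1)] I0(3) ab(3) by blast
    qed
  qed
qed

lemma spair_lift_spair:
  assumes "spair M x y" "spair (con x M) a b"
  shows "spair M a b"
  using ppair_lift_ppair[of "uminus ` M" x y a b] assms unfolding del_dual ppair_dual by blast

lemma spair_lift_ppair:
  assumes "spair M x y" "ppair (con x M) a b" "a \<noteq> y" "b \<noteq> y"
  shows "ppair M a b" "a \<noteq> x" "b \<noteq> x"
  using ppair_lift_spair[of "uminus ` M" x y a b] assms unfolding del_dual ppair_dual spair_dual by blast+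

lemma ppair_trans:
  assumes "ppair M y z" "ppair M y b" "b \<noteq> z"
  shows "ppair M z b"
proof -
  note Z = ppairD[OF assms(1)] and B = ppairD[OF assms(2)]
  have via: "insert b' (I - {a'}) \<in> M" if I: "I \<in> M" "a' \<in> I" and ab: "a' = z \<and> b' = b \<or> a' = b \<and> b' = z" for I a' b'
  proof -
    have yI: "y \<notin> I" using ab Z(3)[OF I(1)] B(3)[OF I(1)] I(2) by (elim disjE conjE; simp)
    have i: "insert y (I - {a'}) \<in> M" using ab Z(5)[OF I(1)] B(5)[OF I(1)] I(2) by (elim disjE conjE; simp)
    have "insert b' (insert y (I - {a'}) - {y}) \<in> M" using ab Z(4)[OF i insertI1] B(4)[OF i insertI1] by (elim disjE conjE; simp)
    moreover have "insert b' (insert y (I - {a'}) - {y}) = insert b' (I - {a'})" using yI by auto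
    ultimately show ?thesis by simp
  qed
  show ?thesis
  proof (rule ppairI)
    show "z \<noteq> b" using assms(3) by simp
    show "z \<in> \<Union>M" by (rule Z(7))
    show "insert b (I - {z}) \<in> M" if "I \<in> M" "z \<in> I" for I using via[OF that] by simp
    show "insert z (I - {b}) \<in> M" if "I \<in> M" "b \<in> I" for I using via[OF that] by simp
    show "b \<notin> I" if I: "I \<in> M" "z \<in> I" for I
    proof
      assume "b \<in> I"
      then have "b \<in> insert y (I - {z})" using assms(3) by blast
      then show False using B(2)[OF Z(5)[OF I]] by blast
    qed
  qed
qed

lemma ppair_del_facts:
  fixes M :: "'n::finite set set"
  assumes "ppair M x y"
  shows "dim (lineal (del x M)) = Suc (dim (lineal M))" "\<Union>M = insert x (\<Union>(del x M))" "x \<notin> \<Union>(del x M)"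
    "\<Inter>M = \<Inter>(del x M) - {y}" "y \<in> \<Union>(del x M)"
proof -
  interpret par_ext "del x M" x y by (rule par_ext_ppair[OF assms])
  have D: "par (del x M) y x = M" using ppair_par(1)[OF assms] by simp
  show "dim (lineal (del x M)) = Suc (dim (lineal M))" using dim_lineal_par[OF order_refl y_nonloop] D by simp
  show "\<Union>M = insert x (\<Union>(del x M))" using Union_D D by simp
  show "x \<notin> \<Union>(del x M)" by (rule x_loop)
  show "y \<in> \<Union>(del x M)" by (rule y_nonloop)
  show "\<Inter>M = \<Inter>(del x M) - {y}"
    using Inter_D0 Inter_D_subset ppairD(9)[OF assms] unfolding D by blast
qed

lemma compl_eq_diff_singleton: "- U = - A - {y} \<Longrightarrow> U = insert y A"
  by blast

lemma eq_diff_notin: "y \<notin> A \<Longrightarrow> A = A - {y}"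
  by blast

lemma spair_con_facts:
  fixes M :: "'n::finite set set"
  assumes "spair M x y"
  shows "dim (lineal (con x M)) = Suc (dim (lineal M))" "\<Inter>(con x M) = insert x (\<Inter>M)" "x \<notin> \<Inter>M"
    "\<Union>M = insert y (\<Union>(con x M))" "y \<notin> \<Inter>(con x M)"
proof -
  have p: "ppair (uminus ` M) x y" using assms by (simp add: ppair_dual)
  note f = ppair_del_facts[OF p, unfolded del_dual lineal_dual]
  obtain I where I: "I \<in> M" "x \<notin> I" using spairD(6)[OF assms] by blast
  have ne: "M \<noteq> {}" "con x M \<noteq> {}" using I spairD(4)[OF assms I] by auto
  show "dim (lineal (con x M)) = Suc (dim (lineal M))" by (rule f(1))
  have "- \<Inter>M = insert x (- \<Inter>(con x M))" using f(2) unfolding Union_dual[OF ne(1)] Union_dual[OF ne(2)] .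
  moreover have "x \<in> \<Inter>(con x M)" by simp
  ultimately show "\<Inter>(con x M) = insert x (\<Inter>M)" by (simp only: set_eq_iff) blast
  show "x \<notin> \<Inter>M" by (rule spairD(10)[OF assms])
  have "- \<Union>M = - \<Union>(con x M) - {y}" using f(4) unfolding Inter_dual[OF ne(1)] Inter_dual[OF ne(2)] .
  then show "\<Union>M = insert y (\<Union>(con x M))" by (rule compl_eq_diff_singleton)
  show "y \<notin> \<Inter>(con x M)" using f(5) unfolding Union_dual[OF ne(2)] by simp
qed

section \<open>A dimension count for series-parallel families\<close>

definition hit :: "'n set set \<Rightarrow> 'n set \<Rightarrow> bool" where
  "hit M X \<longleftrightarrow> (\<forall>x y. ppair M x y \<longrightarrow> x \<in> X \<and> y \<in> X) \<and> (\<forall>x y. spair M x y \<longrightarrow> x \<in> X \<or> y \<in> X)"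

lemma spair_common_basis:
  assumes "spair M x y" "\<not> ppair M x y"
  shows "\<exists>I\<in>M. x \<in> I \<and> y \<in> I"
proof (rule ccontr)
  assume n: "\<not> ?thesis"
  note S = spairD[OF assms(1)]
  have "ppair M x y"
  proof (rule ppairI)
    show "insert y (I - {x}) \<in> M" if "I \<in> M" "x \<in> I" for I using that n S(5) by blast
    show "insert x (I - {y}) \<in> M" if "I \<in> M" "y \<in> I" for I using that n S(4) by blast
  qed (use n S in blast)+
  then show False using assms(2) by simp
qed

lemma hit_ppair:
  assumes h: "hit M X" and xy: "ppair M x y"
  shows "hit (del x M) X"
proof -
  have yX: "y \<in> X" using h xy unfolding hit_def by blast
  have "a \<in> X \<and> b \<in> X" if "ppair (del x M) a b" for a b
    using ppair_lift_ppair[OF xy that] h unfolding hit_def by blast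
  moreover have "a \<in> X \<or> b \<in> X" if "spair (del x M) a b" for a b
  proof (cases "a = y \<or> b = y")
    case False
    then show ?thesis using ppair_lift_spair(1)[OF xy that] h unfolding hit_def by blast
  qed (use yX in blast)
  ultimately show ?thesis unfolding hit_def by blast
qed

lemma card_Compl_insert: "x \<in> U \<Longrightarrow> U = insert x V \<Longrightarrow> x \<notin> V \<Longrightarrow> card (- V) = Suc (card (- U))" for U V :: "'n::finite set"
  by (subgoal_tac "- V = insert x (- U)") auto

text \<open>For a matroid, \<open>dim (lineal M)\<close> is the number of connected components, each
  loop and coloop being one. The bound says that every other component contains at least two
  elements of \<open>X\<close>. It will be applied with \<open>X\<close> the set of elements that
  are coloops of neither of two families.\<close>

theorem hit_card:
  fixes M :: "'n::finite set set"
  assumes "sp M" "hit M X"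
  shows "2 * dim (lineal M) \<le> card (X \<inter> nt M) + 2 * (card (\<Inter>M) + card (- \<Union>M))"
  using assms
proof (induction "card M" arbitrary: M rule: less_induct)
  case less
  have par: ?case if xy: "ppair M x y" for x y
  proof -
    let ?D = "del x M"
    note f = ppair_del_facts[OF xy] and P = ppairD[OF xy]
    have xyX: "x \<in> X" "y \<in> X" using less.prems(2) xy unfolding hit_def by blast+
    obtain J where J: "J \<in> M" "y \<in> J" using P(7) by blast
    have s: "sp ?D" by (rule sp_del[OF less.prems(1) J(1) P(3)[OF J]])
    have ih: "2 * dim (lineal ?D) \<le> card (X \<inter> nt ?D) + 2 * (card (\<Inter>?D) + card (- \<Union>?D))"
      by (rule less.hyps[OF ppair_par(4)[OF xy] s hit_ppair[OF less.prems(2) xy]])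
    have cU: "card (- \<Union>?D) = Suc (card (- \<Union>M))" by (rule card_Compl_insert[OF P(6) f(2,3)])
    show ?thesis
    \<comment> \<open>If \<open>y\<close> is a coloop after the deletion of \<open>x\<close>, then
      \<open>x\<close> and \<open>y\<close> form a whole component, and both lie in
      \<open>X\<close>. Otherwise no component is lost.\<close>
    proof (cases "y \<in> \<Inter>?D")
      case True
      have cI: "card (\<Inter>?D) = Suc (card (\<Inter>M))" unfolding f(4) by (rule card_Suc_Diff1[OF finite True, symmetric])
      have "X \<inter> nt M = insert x (insert y (X \<inter> nt ?D))"
        using f(2,3,4,5) True xyX P(1,6,7,8,9) by blast
      moreover have "x \<notin> insert y (X \<inter> nt ?D)" "y \<notin> X \<inter> nt ?D" using f(3) P(1) True by blast+
      ultimately have "card (X \<inter> nt M) = card (X \<inter> nt ?D) + 2" by simp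
      then show ?thesis using ih unfolding cI cU f(1) by simp
    next
      case False
      have "\<Inter>?D = \<Inter>M" using f(4) False by blast
      moreover have "card (X \<inter> nt ?D) \<le> card (X \<inter> nt M)" by (rule card_mono) (use f(2) \<open>\<Inter>?D = \<Inter>M\<close> in auto)
      ultimately show ?thesis using ih unfolding cU f(1) by simp
    qed
  qed
  have ser: ?case if xy: "spair M x y" and yX: "y \<in> X" and np: "\<not> ppair M x y" for x y
  proof -
    let ?M0 = "con x M"
    note f = spair_con_facts[OF xy] and S = spairD[OF xy]
    obtain I0 where I0: "I0 \<in> M" "x \<in> I0" "y \<in> I0" using spair_common_basis[OF xy np] by blast
    have s0: "sp ?M0" by (rule sp_con[OF less.prems(1) I0(1,2)])
    obtain I1 where I1: "I1 \<in> M" "x \<notin> I1" using S(6) by (elim bexE) (rule that)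
    have "?M0 \<subset> M"
    proof
      show "?M0 \<subseteq> M" by (rule subsetI) simp
      show "?M0 \<noteq> M" using I1 by (metis (mono_tags, lifting) mem_Collect_eq)
    qed
    then have "card ?M0 < card M" by (intro psubset_card_mono) simp_all
    have "y \<in> \<Union>?M0" using I0 by (intro UnionI[of I0]) simp_all
    then have U0: "\<Union>?M0 = \<Union>M" unfolding f(4) by (simp add: insert_absorb)
    have cI0: "card (\<Inter>?M0) = Suc (card (\<Inter>M))" unfolding f(2) using f(3) by simp
    have liftS: "a \<in> X \<or> b \<in> X" if "spair ?M0 a b" for a b
      using spair_lift_spair[OF xy that] less.prems(2) unfolding hit_def by blast
    have liftP: "a \<in> X \<and> b \<in> X" if "ppair ?M0 a b" "a \<noteq> y" "b \<noteq> y" for a b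
      using spair_lift_ppair(1)[OF xy that] less.prems(2) unfolding hit_def by blast
    show ?thesis
    \<comment> \<open>Series pairs of \<open>?M0\<close>, and parallel pairs avoiding
      \<open>y\<close>, lift to \<open>M\<close>. So contraction of \<open>x\<close> can destroy
      \<open>hit\<close> only by making \<open>y\<close> parallel to some \<open>z\<close> outside
      \<open>X\<close>.\<close>
    proof (cases "\<exists>z. ppair ?M0 y z \<and> z \<notin> X")
      case False
      have "a \<in> X \<and> b \<in> X" if ab: "ppair ?M0 a b" for a b
      proof (cases "a = y \<or> b = y")
        case True
        then show ?thesis using ab ppair_sym[OF ab] False yX by blast
      next
        case F: False
        then show ?thesis using liftP[OF ab] by blast
      qed
      then have "hit ?M0 X" unfolding hit_def using liftS by blast
      then have "2 * dim (lineal ?M0) \<le> card (X \<inter> nt ?M0) + 2 * (card (\<Inter>?M0) + card (- \<Union>?M0))"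
        by (rule less.hyps[OF \<open>card ?M0 < card M\<close> s0])
      moreover have "card (X \<inter> nt ?M0) \<le> card (X \<inter> nt M)" by (rule card_mono) (use f(2) U0 in auto)
      ultimately show ?thesis unfolding cI0 U0 f(1) by simp
    next
      case True
      then obtain z where z: "ppair ?M0 y z" "z \<notin> X" by blast
      have zy: "ppair ?M0 z y" by (rule ppair_sym[OF z(1)])
      note Z = ppairD[OF zy]
      \<comment> \<open>Deleting such a \<open>z\<close> restores \<open>hit\<close>: any further
        element parallel to \<open>y\<close> would be parallel to \<open>z\<close>, already in
        \<open>M\<close>, and this would put \<open>z\<close> into \<open>X\<close>.\<close>
      let ?M1 = "del z ?M0"
      note g = ppair_del_facts[OF zy]
      have zx: "z \<noteq> x" using Z(8) by auto
      obtain J where J: "J \<in> ?M0" "y \<in> J" using Z(7) by blast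
      have s1: "sp ?M1" by (rule sp_del[OF s0 J(1) Z(3)[OF J]])
      have c1: "card ?M1 < card M" using ppair_par(4)[OF zy] \<open>card ?M0 < card M\<close> by linarith
      have cU: "card (- \<Union>?M1) = Suc (card (- \<Union>M))" using card_Compl_insert[OF Z(6) g(2,3)] U0 by simp
      have spX: "a \<in> X \<or> b \<in> X" if ab: "spair ?M1 a b" for a b
      proof (cases "a = y \<or> b = y")
        case False
        then show ?thesis using ppair_lift_spair(1)[OF zy ab] liftS by blast
      qed (use yX in blast)
      have ppX: "a \<in> X \<and> b \<in> X" if ab: "ppair ?M1 a b" for a b
      proof (cases "a = y \<or> b = y")
        case False
        then show ?thesis using liftP[OF ppair_lift_ppair[OF zy ab]] by blast
      next
        case True
        define b' where "b' = (if a = y then b else a)"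
        have pb: "ppair ?M1 y b'" using ab ppair_sym[OF ab] True unfolding b'_def by (cases "a = y") simp_all
        have yb: "ppair ?M0 y b'" by (rule ppair_lift_ppair[OF zy pb])
        have bz: "b' \<noteq> z" using ppairD(7)[OF pb] g(3) by metis
        have "ppair ?M0 z b'" by (rule ppair_trans[OF z(1) yb bz])
        then have "z \<in> X" using liftP[of z b'] Z(1) ppairD(1)[OF yb] by simp
        then show ?thesis using z(2) by simp
      qed
      have h1: "hit ?M1 X" unfolding hit_def
        by (intro conjI allI impI) (erule conjunct1[OF ppX] conjunct2[OF ppX] spX)+
      have ih: "2 * dim (lineal ?M1) \<le> card (X \<inter> nt ?M1) + 2 * (card (\<Inter>?M1) + card (- \<Union>?M1))"
        by (rule less.hyps[OF c1 s1 h1])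
      have ntsub: "nt ?M1 \<subseteq> nt M"
      proof (rule Diff_mono)
        show "\<Union>?M1 \<subseteq> \<Union>M" unfolding trans[OF U0[symmetric] g(2)] by (rule subset_insertI)
        have "\<Inter>M \<subseteq> \<Inter>?M0" unfolding f(2) by (rule subset_insertI)
        also have "\<dots> \<subseteq> \<Inter>?M1" unfolding g(4) by (rule Diff_subset)
        finally show "\<Inter>M \<subseteq> \<Inter>?M1" .
      qed
      show ?thesis
      \<comment> \<open>If \<open>y\<close> is a coloop of \<open>?M1\<close>, the elements
        \<open>x\<close>, \<open>y\<close>, \<open>z\<close> behave like a triangle:
        \<open>x\<close> and \<open>z\<close> are in series in \<open>M\<close>, so \<open>x\<close>
        lies in \<open>X\<close> because \<open>z\<close> does not. Then \<open>x\<close> and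
        \<open>y\<close> supply the two elements that the bound requires.\<close>
      proof (cases "y \<in> \<Inter>?M1")
        case False
        then have "\<Inter>?M1 = \<Inter>?M0" unfolding g(4) by (rule eq_diff_notin)
        then have cI: "card (\<Inter>?M1) = Suc (card (\<Inter>M))" using cI0 by simp
        have "card (X \<inter> nt ?M1) \<le> card (X \<inter> nt M)"
          by (rule card_mono[OF finite Int_mono[OF order_refl ntsub]])
        then show ?thesis using ih unfolding cU cI g(1) f(1) by simp
      next
        case True
        have yz: "I \<in> ?M0 \<Longrightarrow> z \<notin> I \<Longrightarrow> y \<in> I" for I using InterD[OF True, of I] by simp
        have "spair M x z"
        proof (rule spairI[of _ _ "SOME I. I \<in> M \<and> x \<notin> I"])
          have "\<exists>I. I \<in> M \<and> x \<notin> I" using S(6) by blast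
          then have "(SOME I. I \<in> M \<and> x \<notin> I) \<in> M \<and> x \<notin> (SOME I. I \<in> M \<and> x \<notin> I)" by (rule someI_ex)
          then show "(SOME I. I \<in> M \<and> x \<notin> I) \<in> M" "x \<notin> (SOME I. I \<in> M \<and> x \<notin> I)" by blast+
          show "x \<noteq> z" using zx by simp
          fix I assume I: "I \<in> M"
          {
            assume xI: "x \<notin> I"
            have yI: "y \<in> I" by (rule S(2)[OF I xI])
            let ?I' = "insert x (I - {y})"
            have I': "?I' \<in> ?M0" using S(4)[OF I xI] by simp
            have "y \<notin> ?I'" using S(1) by simp
            then have zI': "z \<in> ?I'" using yz[OF I'] by blast
            then show "z \<in> I" using zx by blast
            have "insert y (?I' - {z}) \<in> ?M0" by (rule Z(4)[OF I' zI'])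
            moreover have "insert y (?I' - {z}) = insert x (I - {z})" using yI zx Z(1) by auto
            ultimately show "insert x (I - {z}) \<in> M" by simp
          }
          assume zI: "z \<notin> I"
          show "insert z (I - {x}) \<in> M"
          proof (cases "x \<in> I")
            case True
            then have I0: "I \<in> ?M0" using I by simp
            have yI: "y \<in> I" by (rule yz[OF I0 zI])
            let ?I' = "insert z (I - {y})"
            have "?I' \<in> ?M0" by (rule Z(5)[OF I0 yI])
            moreover have "y \<notin> ?I'" using Z(1) by simp
            ultimately have "insert y (?I' - {x}) \<in> M" using S(5)[of ?I'] by simp
            moreover have "insert y (?I' - {x}) = insert z (I - {x})" using yI zx S(1) by auto
            ultimately show ?thesis by simp
          next
            case False
            have yI: "y \<in> I" by (rule S(2)[OF I False])
            let ?I' = "insert x (I - {y})"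
            have I': "?I' \<in> ?M0" using S(4)[OF I False] by simp
            have "y \<notin> ?I'" using S(1) by simp
            then have "z \<in> ?I'" using yz[OF I'] by blast
            then show ?thesis using zI zx by blast
          qed
        qed
        then have xX: "x \<in> X" using less.prems(2) z(2) unfolding hit_def by blast
        have cI: "card (\<Inter>?M1) = Suc (card (\<Inter>?M0))" unfolding g(4) by (rule card_Suc_Diff1[OF finite True, symmetric])
        have x1: "x \<in> \<Inter>?M1" by (rule InterI) simp
        have "x \<in> X \<inter> nt M" "y \<in> X \<inter> nt M"
          by (intro IntI DiffI xX S(8) S(10)) (intro IntI DiffI yX S(9) S(11))
        then have "insert x (insert y (X \<inter> nt ?M1)) \<subseteq> X \<inter> nt M"
          using Int_mono[OF order_refl ntsub, of X] by (simp only: insert_subset)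
        then have "card (insert x (insert y (X \<inter> nt ?M1))) \<le> card (X \<inter> nt M)" by (intro card_mono) simp_all
        moreover have "x \<notin> insert y (X \<inter> nt ?M1)" "y \<notin> X \<inter> nt ?M1"
          using x1 S(1) by (simp only: insert_iff Int_iff Diff_iff simp_thms) (use True in \<open>simp only: Int_iff Diff_iff simp_thms\<close>)
        ultimately have "card (X \<inter> nt ?M1) + 2 \<le> card (X \<inter> nt M)" by simp
        then show ?thesis using ih unfolding cU cI cI0 g(1) f(1) by simp
      qed
    qed
  qed
  show ?case using less.prems(1)
  proof (cases rule: sp.cases)
    case (single K)
    then show ?thesis using dim_lineal_singleton[of K] card_Compl[of K] card_mono[of UNIV K] by simp
  next
    case (parallel x y)
    then show ?thesis using par by blast
  next
    case (series x y)
    show ?thesis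
    proof (cases "ppair M x y")
      case True then show ?thesis by (rule par)
    next
      case False
      have or: "x \<in> X \<or> y \<in> X"
        using less.prems(2)[unfolded hit_def, THEN conjunct2, rule_format, OF series(1)] .
      have nyx: "\<not> ppair M y x" using False ppair_sym[of M y x] by (elim contrapos_nn)
      show ?thesis
      proof (cases "y \<in> X")
        case True
        show ?thesis by (rule ser[OF series(1) True False])
      next
        case F: False
        then have "x \<in> X" using or by simp
        then show ?thesis by (rule ser[OF spair_sym[OF series(1)] _ nyx])
      qed
    qed
  qed
qed

section \<open>Stable intersection of set families\<close>

definition meet :: "'n set set \<Rightarrow> 'n set set \<Rightarrow> 'n set set" where
  "meet M M' = {J. \<exists>I\<in>M. \<exists>I'\<in>M'. J = I \<inter> I' \<and> I \<union> I' = UNIV}"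

lemma meet_commute: "meet M M' = meet M' M"
  unfolding meet_def by (rule Collect_cong) (metis Int_commute Un_commute)

lemma meetI: "I \<in> M \<Longrightarrow> I' \<in> M' \<Longrightarrow> I \<union> I' = UNIV \<Longrightarrow> I \<inter> I' \<in> meet M M'"
  unfolding meet_def by blast

lemma meetE:
  assumes "J \<in> meet M M'"
  obtains I I' where "I \<in> M" "I' \<in> M'" "J = I \<inter> I'" "I \<union> I' = UNIV"
  using assms unfolding meet_def by blast

lemma meet_UNIV: "meet {UNIV} M' = M'"
  unfolding meet_def by auto

lemma lineal_insert: "x \<notin> \<Union>B \<Longrightarrow> lineal B \<subseteq> lineal (insert x ` B)"
proof (intro subsetI linealI)
  fix v I J assume h: "x \<notin> \<Union>B" "v \<in> lineal B" "I \<in> insert x ` B" "J \<in> insert x ` B"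
  then obtain I0 J0 where IJ: "I0 \<in> B" "I = insert x I0" "J0 \<in> B" "J = insert x J0" by (elim imageE) (rule that)
  have n: "x \<notin> I0" "x \<notin> J0" using h(1) IJ by (metis UnionI)+
  have "wt v I0 = wt v J0" by (rule linealD[OF h(2) IJ(1,3)])
  then show "wt v I = wt v J" unfolding IJ wt_def using n by simp
qed

text \<open>Plain deletion of \<open>x\<close> would leave a loop, and the induction works with
  families without loops; so \<open>x\<close> is turned into a coloop. As \<open>x\<close> is a
  coloop of \<open>M'\<close>, the parallel pair persists in the meet, and deleting \<open>x\<close>
  from the meet amounts to removing the coloop \<open>x\<close> from the smaller one.\<close>

lemma meet_parallel:
  assumes xy: "ppair M x y" and x: "x \<in> \<Inter>M'"
    and ih: "sp (meet (insert x ` del x M) M')" "\<Union>(meet (insert x ` del x M) M') = UNIV"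
  shows "sp (meet M M')" "\<Union>(meet M M') = UNIV"
proof -
  note P = ppairD[OF xy]
  let ?N = "meet M M'" and ?P = "meet (insert x ` del x M) M'"
  have xM': "x \<in> I'" if "I' \<in> M'" for I' by (rule InterD[OF x that])
  have N0E: "\<exists>I I'. I \<in> M \<and> x \<notin> I \<and> I' \<in> M' \<and> J = insert x I \<inter> I' \<and> I \<union> I' = UNIV" if J: "J \<in> ?P" for J
  proof -
    obtain K I' where K: "K \<in> insert x ` del x M" "I' \<in> M'" "J = K \<inter> I'" "K \<union> I' = UNIV" by (rule meetE[OF J])
    obtain I where I: "I \<in> M" "x \<notin> I" "K = insert x I" using K(1) by auto
    have "I \<union> I' = UNIV" using K(4) xM'[OF K(2)] I(3) by auto
    then show ?thesis using I K by blast
  qed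
  have N0I: "insert x I \<inter> I' \<in> ?P" if "I \<in> M" "x \<notin> I" "I' \<in> M'" "I \<union> I' = UNIV" for I I'
    by (rule meetI) (use that in auto)
  have U: "\<Union>?N = UNIV"
  proof -
    have "z \<in> \<Union>?N" for z
    proof (cases "z = x")
      case False
      have "z \<in> \<Union>?P" using ih(2) by simp
      then obtain J where J: "J \<in> ?P" "z \<in> J" by (elim UnionE) (rule that)
      obtain I I' where I: "I \<in> M" "x \<notin> I" "I' \<in> M'" "J = insert x I \<inter> I'" "I \<union> I' = UNIV" using N0E[OF J(1)] by blast
      have "z \<in> I \<inter> I'" using J(2) I(4) False by simp
      then show "z \<in> \<Union>(meet M M')" by (rule UnionI[OF meetI[OF I(1,3,5)]])
    next
      case True
      have "y \<in> \<Union>?P" using ih(2) by simp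
      then obtain J where J: "J \<in> ?P" "y \<in> J" by (elim UnionE) (rule that)
      obtain I I' where I: "I \<in> M" "x \<notin> I" "I' \<in> M'" "J = insert x I \<inter> I'" "I \<union> I' = UNIV" using N0E[OF J(1)] by blast
      have yI: "y \<in> I" "y \<in> I'" using J(2) I(4) P(1) by auto
      have "insert x (I - {y}) \<union> I' = UNIV" using I(5) yI(2) by auto
      then have "insert x (I - {y}) \<inter> I' \<in> ?N" by (rule meetI[OF P(5)[OF I(1) yI(1)] I(3)])
      moreover have "x \<in> insert x (I - {y}) \<inter> I'" using xM'[OF I(3)] by simp
      ultimately show ?thesis unfolding True by (rule UnionI)
    qed
    then show ?thesis by auto
  qed
  show "\<Union>?N = UNIV" by (rule U)
  have pp: "ppair ?N x y"
  proof (rule ppairI)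
    show "x \<noteq> y" by (rule P(1))
    show "x \<in> \<Union>?N" using U by simp
    fix J assume J: "J \<in> ?N"
    obtain I I' where I: "I \<in> M" "I' \<in> M'" "J = I \<inter> I'" "I \<union> I' = UNIV" by (rule meetE[OF J])
    {
      assume xJ: "x \<in> J"
      then have xI: "x \<in> I" using I(3) by simp
      have yI: "y \<notin> I" by (rule P(2)[OF I(1) xI])
      then show "y \<notin> J" using I(3) by simp
      have yI': "y \<in> I'" using yI I(4) by auto
      have "insert y (I - {x}) \<union> I' = UNIV" using I(4) xM'[OF I(2)] by auto
      then have "insert y (I - {x}) \<inter> I' \<in> ?N" by (rule meetI[OF P(4)[OF I(1) xI] I(2)])
      moreover have "insert y (I - {x}) \<inter> I' = insert y (J - {x})" using I(3) yI' by auto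
      ultimately show "insert y (J - {x}) \<in> ?N" by simp
    }
    assume "y \<in> J"
    then have yI: "y \<in> I" "y \<in> I'" using I(3) by simp_all
    have "insert x (I - {y}) \<union> I' = UNIV" using I(4) yI(2) by auto
    then have "insert x (I - {y}) \<inter> I' \<in> ?N" by (rule meetI[OF P(5)[OF I(1) yI(1)] I(2)])
    moreover have "insert x (I - {y}) \<inter> I' = insert x (J - {y})" using I(3) xM'[OF I(2)] by auto
    ultimately show "insert x (J - {y}) \<in> ?N" by simp
  qed
  have e: "del x ?N = (\<lambda>J. J - {x}) ` ?P"
  proof (intro equalityI subsetI)
    fix J assume "J \<in> del x ?N"
    then have J: "J \<in> ?N" "x \<notin> J" by simp_all
    obtain I I' where I: "I \<in> M" "I' \<in> M'" "J = I \<inter> I'" "I \<union> I' = UNIV" by (rule meetE[OF J(1)])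
    have xI: "x \<notin> I" using J(2) I(3) xM'[OF I(2)] by simp
    have "J = insert x I \<inter> I' - {x}" using I(3) xI by auto
    then show "J \<in> (\<lambda>J. J - {x}) ` ?P" using N0I[OF I(1) xI I(2,4)] by (rule image_eqI)
  next
    fix J assume "J \<in> (\<lambda>J. J - {x}) ` ?P"
    then obtain J0 where J0: "J0 \<in> ?P" "J = J0 - {x}" by (elim imageE) (rule that)
    obtain I I' where I: "I \<in> M" "x \<notin> I" "I' \<in> M'" "J0 = insert x I \<inter> I'" "I \<union> I' = UNIV" using N0E[OF J0(1)] by blast
    have "J = I \<inter> I'" using J0(2) I(2,4) by auto
    then show "J \<in> del x ?N" using meetI[OF I(1,3,5)] I(2) by simp
  qed
  have "x \<in> \<Inter>?P"
  proof (rule InterI)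
    fix J assume "J \<in> ?P"
    then obtain I I' where "I' \<in> M'" "J = insert x I \<inter> I'" using N0E by blast
    then show "x \<in> J" using xM' by simp
  qed
  then have "sp (del x ?N)" unfolding e by (rule sp_remove_coloop[OF ih(1)])
  then show "sp ?N" by (rule sp.parallel[OF pp])
qed

text \<open>With \<open>x\<close> and \<open>y\<close> in every set of \<open>M'\<close>, their
  membership in \<open>I \<inter> I'\<close> is decided by \<open>I\<close>. So contraction of
  \<open>x\<close> commutes with the meet, and the pair stays in series unless \<open>x\<close> is a
  coloop of the meet, where the contraction changes nothing.\<close>

lemma meet_series:
  assumes xy: "spair M x y" and x: "x \<in> \<Inter>M'" "y \<in> \<Inter>M'"
    and ih: "sp (meet (con x M) M')" "\<Union>(meet (con x M) M') = UNIV"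
  shows "sp (meet M M')" "\<Union>(meet M M') = UNIV"
proof -
  note P = spairD[OF xy]
  let ?N = "meet M M'"
  have xM': "x \<in> I'" "y \<in> I'" if "I' \<in> M'" for I' using InterD[OF x(1) that] InterD[OF x(2) that] .
  have e: "con x ?N = meet (con x M) M'"
  proof (intro equalityI subsetI)
    fix J assume "J \<in> con x ?N"
    then have J: "J \<in> ?N" "x \<in> J" by simp_all
    obtain I I' where I: "I \<in> M" "I' \<in> M'" "J = I \<inter> I'" "I \<union> I' = UNIV" by (rule meetE[OF J(1)])
    have "I \<in> con x M" using I J(2) by simp
    then show "J \<in> meet (con x M) M'" unfolding I(3) by (rule meetI[OF _ I(2,4)])
  next
    fix J assume J: "J \<in> meet (con x M) M'"
    obtain I I' where I: "I \<in> con x M" "I' \<in> M'" "J = I \<inter> I'" "I \<union> I' = UNIV" by (rule meetE[OF J])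
    then have "I \<in> M" "x \<in> I" by simp_all
    then show "J \<in> con x ?N" using meetI[OF _ I(2,4)] I(3) xM'[OF I(2)] by simp
  qed
  have "meet (con x M) M' \<subseteq> ?N" unfolding e[symmetric] by (rule subsetI) simp
  then show "\<Union>?N = UNIV" using ih(2) by (metis Union_mono top.extremum_uniqueI)
  show "sp ?N"
  proof (cases "\<exists>J\<in>?N. x \<notin> J")
    case False
    then have "?N = con x ?N" by (intro equalityI subsetI) simp_all
    then show ?thesis using ih(1) e by metis
  next
    case True
    then obtain J0 where J0: "J0 \<in> ?N" "x \<notin> J0" by (elim bexE) (rule that)
    have "spair ?N x y"
    proof (rule spairI[OF P(1) J0])
      fix J assume J: "J \<in> ?N"
      obtain I I' where I: "I \<in> M" "I' \<in> M'" "J = I \<inter> I'" "I \<union> I' = UNIV" by (rule meetE[OF J])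
      {
        assume "x \<notin> J"
        then have xI: "x \<notin> I" using I(3) xM'[OF I(2)] by simp
        have "y \<in> I" by (rule P(2)[OF I(1) xI])
        then show "y \<in> J" using I(3) xM'[OF I(2)] by simp
        have "insert x (I - {y}) \<union> I' = UNIV" using I(4) xM'[OF I(2)] by auto
        then have "insert x (I - {y}) \<inter> I' \<in> ?N" by (rule meetI[OF P(4)[OF I(1) xI] I(2)])
        moreover have "insert x (I - {y}) \<inter> I' = insert x (J - {y})" using I(3) xM'[OF I(2)] by auto
        ultimately show "insert x (J - {y}) \<in> ?N" by simp
      }
      assume "y \<notin> J"
      then have yI: "y \<notin> I" using I(3) xM'[OF I(2)] by simp
      have "insert y (I - {x}) \<union> I' = UNIV" using I(4) xM'[OF I(2)] by auto
      then have "insert y (I - {x}) \<inter> I' \<in> ?N" by (rule meetI[OF P(5)[OF I(1) yI] I(2)])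
      moreover have "insert y (I - {x}) \<inter> I' = insert y (J - {x})" using I(3) xM'[OF I(2)] by auto
      ultimately show "insert y (J - {x}) \<in> ?N" by simp
    qed
    then show ?thesis by (rule sp.series) (unfold e, rule ih(1))
  qed
qed

text \<open>Both lineality spaces contain the axes of the common coloops and, since the sets of each
  family have equal size, the all-ones vector. Coordinate \<open>z0\<close> vanishes on those axes,
  so the all-ones vector is independent of them.\<close>

lemma dim_common_lineal:
  fixes M M' :: "'n::finite set set"
  assumes "z0 \<notin> \<Inter>M \<inter> \<Inter>M'" and card: "\<And>I J. I \<in> M \<Longrightarrow> J \<in> M \<Longrightarrow> card I = card J" "\<And>I J. I \<in> M' \<Longrightarrow> J \<in> M' \<Longrightarrow> card I = card J"
  shows "Suc (card (\<Inter>M \<inter> \<Inter>M')) \<le> dim (lineal M \<inter> lineal M')"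
proof -
  let ?K = "\<Inter>M \<inter> \<Inter>M'"
  let ?A = "(\<lambda>z. axis z (1::real)) ` ?K"
  let ?one = "vec 1 :: real ^ 'n"
  have "?A \<subseteq> Basis" by (auto simp: axis_in_Basis_iff)
  then have indA: "independent ?A" using independent_Basis independent_mono by blast
  have "span ?A \<subseteq> {v. v $ z0 = 0}"
  proof (rule span_minimal)
    show "?A \<subseteq> {v. v $ z0 = 0}"
    proof
      fix a assume "a \<in> ?A"
      then obtain z where z: "z \<in> ?K" "a = axis z 1" by (elim imageE) (rule that)
      then have "z \<noteq> z0" using assms(1) by metis
      then show "a \<in> {v. v $ z0 = 0}" using z(2) by (simp add: axis_def)
    qed
    show "subspace {v :: real ^ 'n. v $ z0 = 0}" by (simp add: subspace_def)
  qed
  then have n1: "?one \<notin> span ?A" by auto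
  then have ind: "independent (insert ?one ?A)" using indA by (simp add: independent_insert)
  have "inj_on (\<lambda>z. axis z (1::real)) ?K" by (rule inj_onI) (metis axis_eq_axis zero_neq_one)
  then have cA: "card ?A = card ?K" by (rule card_image)
  have "?one \<notin> ?A" using n1 by (rule contrapos_nn) (rule span_base)
  then have c: "card (insert ?one ?A) = Suc (card ?K)" using cA by simp
  have o1: "?one \<in> lineal M" by (rule linealI) (simp add: wt_def, rule card(1))
  have o2: "?one \<in> lineal M'" by (rule linealI) (simp add: wt_def, rule card(2))
  have a: "axis z 1 \<in> lineal M \<inter> lineal M'" if "z \<in> ?K" for z
    using that by (intro IntI linealI) (simp_all add: wt_axis)
  have "insert ?one ?A \<subseteq> lineal M \<inter> lineal M'" using IntI[OF o1 o2] a by (intro insert_subsetI image_subsetI)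
  then have "card (insert ?one ?A) \<le> dim (lineal M \<inter> lineal M')" using ind by (rule independent_card_le_dim)
  then show ?thesis using c by simp
qed

text \<open>If no pair is reducible, the set \<open>?S\<close> of elements that are coloops of
  neither family is hit by both. Adding the two bounds of \<open>hit_card\<close> gives
  \<open>dim + dim' \<le> n + c\<close> with \<open>c\<close> common coloops, while transversality
  makes the same sum \<open>n\<close> plus the dimension of the common lineality space, which is at
  least \<open>c + 1\<close>.\<close>

lemma reducible_pair_exists:
  fixes M M' :: "'n::finite set set"
  assumes s: "sp M" "sp M'" and U: "\<Union>M = UNIV" "\<Union>M' = UNIV"
    and card: "\<And>I J. I \<in> M \<Longrightarrow> J \<in> M \<Longrightarrow> card I = card J" "\<And>I J. I \<in> M' \<Longrightarrow> J \<in> M' \<Longrightarrow> card I = card J"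
    and V: "{v + v' | v v'. v \<in> lineal M \<and> v' \<in> lineal M'} = UNIV" and z0: "z0 \<notin> \<Inter>M \<inter> \<Inter>M'"
  shows "(\<exists>x y. ppair M x y \<and> x \<in> \<Inter>M') \<or> (\<exists>x y. spair M x y \<and> x \<in> \<Inter>M' \<and> y \<in> \<Inter>M') \<or>
    (\<exists>x y. ppair M' x y \<and> x \<in> \<Inter>M) \<or> (\<exists>x y. spair M' x y \<and> x \<in> \<Inter>M \<and> y \<in> \<Inter>M)"
proof (rule ccontr)
  assume n: "\<not> ?thesis"
  let ?S = "- \<Inter>M \<inter> - \<Inter>M'"
  have hitM: "hit M ?S" unfolding hit_def
  proof (intro conjI allI impI)
    fix x y assume p: "ppair M x y"
    show "x \<in> ?S" using n p ppairD(8)[OF p] by (metis ComplI IntI)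
    show "y \<in> ?S" using n ppair_sym[OF p] ppairD(9)[OF p] by (metis ComplI IntI)
  next
    fix x y assume p: "spair M x y"
    have "x \<notin> \<Inter>M' \<or> y \<notin> \<Inter>M'" using n p by metis
    then show "x \<in> ?S \<or> y \<in> ?S" using spairD(10,11)[OF p] by (metis ComplI IntI)
  qed
  have hitM': "hit M' ?S" unfolding hit_def
  proof (intro conjI allI impI)
    fix x y assume p: "ppair M' x y"
    show "x \<in> ?S" using n p ppairD(8)[OF p] by (metis ComplI IntI)
    show "y \<in> ?S" using n ppair_sym[OF p] ppairD(9)[OF p] by (metis ComplI IntI)
  next
    fix x y assume p: "spair M' x y"
    have "x \<notin> \<Inter>M \<or> y \<notin> \<Inter>M" using n p by metis
    then show "x \<in> ?S \<or> y \<in> ?S" using spairD(10,11)[OF p] by (metis ComplI IntI)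
  qed
  have le: "card (?S \<inter> A) \<le> card ?S" for A by (rule card_mono) auto
  have 1: "2 * dim (lineal M) \<le> card ?S + 2 * card (\<Inter>M)"
    using hit_card[OF s(1) hitM] le[of "nt M"] unfolding U by simp
  have 2: "2 * dim (lineal M') \<le> card ?S + 2 * card (\<Inter>M')"
    using hit_card[OF s(2) hitM'] le[of "nt M'"] unfolding U by simp
  have "dim {v + v' | v v'. v \<in> lineal M \<and> v' \<in> lineal M'} + dim (lineal M \<inter> lineal M') = dim (lineal M) + dim (lineal M')"
    by (rule dim_sums_Int[OF subspace_lineal subspace_lineal])
  then have 3: "CARD('n) + dim (lineal M \<inter> lineal M') = dim (lineal M) + dim (lineal M')" unfolding V by simp
  have 4: "Suc (card (\<Inter>M \<inter> \<Inter>M')) \<le> dim (lineal M \<inter> lineal M')" by (rule dim_common_lineal[OF z0 card])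
  have 5: "card (\<Inter>M) + card (\<Inter>M') = card (\<Inter>M \<union> \<Inter>M') + card (\<Inter>M \<inter> \<Inter>M')"
    by (rule card_Un_Int) simp_all
  have "?S = - (\<Inter>M \<union> \<Inter>M')" by simp
  then have "card ?S = CARD('n) - card (\<Inter>M \<union> \<Inter>M')" by (simp only: card_Compl)
  moreover have "card (\<Inter>M \<union> \<Inter>M') \<le> CARD('n)" by (rule card_mono) simp_all
  ultimately have 6: "card ?S + card (\<Inter>M \<union> \<Inter>M') = CARD('n)" by simp
  show False using 1 2 3 4 5 6 by linarith
qed

text \<open>Each reduction decreases the number of sets, keeps both families free of loops, and
  enlarges a lineality space, so transversality persists. It stops when every element is a common
  coloop.\<close>

theorem meet_sp:
  fixes M M' :: "'n::finite set set"
  assumes "sp M" "sp M'" "\<Union>M = UNIV" "\<Union>M' = UNIV"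
    and "\<And>I J. I \<in> M \<Longrightarrow> J \<in> M \<Longrightarrow> card I = card J" "\<And>I J. I \<in> M' \<Longrightarrow> J \<in> M' \<Longrightarrow> card I = card J"
    and "{v + v' | v v'. v \<in> lineal M \<and> v' \<in> lineal M'} = UNIV"
  shows "sp (meet M M') \<and> \<Union>(meet M M') = UNIV"
  using assms
proof (induction "card M + card M'" arbitrary: M M' rule: less_induct)
  case less
  have V': "{v + v' | v v'. v \<in> lineal N' \<and> v' \<in> lineal N} = UNIV"
    if "{v + v' | v v'. v \<in> lineal N \<and> v' \<in> lineal N'} = UNIV" for N N' :: "'n set set"
  proof -
    have "{v + v' | v v'. v \<in> lineal N' \<and> v' \<in> lineal N} = {v + v' | v v'. v \<in> lineal N \<and> v' \<in> lineal N'}"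
      by (rule Collect_cong) (metis add.commute)
    then show ?thesis using that by simp
  qed
  have Vmono: "{v + v' | v v'. v \<in> lineal N0 \<and> v' \<in> lineal N'} = UNIV"
    if "{v + v' | v v'. v \<in> lineal N \<and> v' \<in> lineal N'} = UNIV" "lineal N \<subseteq> lineal N0" for N N0 N' :: "'n set set"
  proof -
    have "{v + v' | v v'. v \<in> lineal N \<and> v' \<in> lineal N'} \<subseteq> {v + v' | v v'. v \<in> lineal N0 \<and> v' \<in> lineal N'}"
      using that(2) by (intro Collect_mono) blast
    then show ?thesis unfolding that(1) by (rule top.extremum_uniqueI)
  qed
  have P: "sp (meet N N') \<and> \<Union>(meet N N') = UNIV" if c: "card N + card N' = card M + card M'" and xy: "ppair N x y" "x \<in> \<Inter>N'"
    and h: "sp N" "sp N'" "\<Union>N = UNIV" "\<Union>N' = UNIV" "{v + v' | v v'. v \<in> lineal N \<and> v' \<in> lineal N'} = UNIV"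
      "\<And>I J. I \<in> N \<Longrightarrow> J \<in> N \<Longrightarrow> card I = card J" "\<And>I J. I \<in> N' \<Longrightarrow> J \<in> N' \<Longrightarrow> card I = card J"
    for N N' :: "'n set set" and x y
  proof -
    note f = ppair_del_facts[OF xy(1)] and Q = ppairD[OF xy(1)]
    let ?N0 = "insert x ` del x N"
    obtain J where J: "J \<in> N" "y \<in> J" using Q(7) by (elim UnionE) (rule that)
    have s: "sp (del x N)" by (rule sp_del[OF h(1) J(1) Q(3)[OF J]])
    have "card ?N0 \<le> card (del x N)" by (rule card_image_le) simp
    then have c0: "card ?N0 + card N' < card M + card M'" using ppair_par(4)[OF xy(1)] c by linarith
    have "del x N \<noteq> {}" by (rule sp_nonempty[OF s])
    then have "\<Union>?N0 = insert x (\<Union>(del x N))" by auto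
    then have U0: "\<Union>?N0 = UNIV" using f(2) h(3) by simp
    have "lineal N \<subseteq> lineal (del x N)" by (rule lineal_antimono) auto
    then have l: "lineal N \<subseteq> lineal ?N0" using lineal_insert[OF f(3)] by (rule order_trans)
    have cN0: "card I = card K" if IK: "I \<in> ?N0" "K \<in> ?N0" for I K
    proof -
      obtain I0 K0 where IK0: "I0 \<in> del x N" "I = insert x I0" "K0 \<in> del x N" "K = insert x K0" using IK by (elim imageE) (rule that)
      then show ?thesis using h(6)[of I0 K0] by simp
    qed
    have "sp (meet ?N0 N') \<and> \<Union>(meet ?N0 N') = UNIV"
      by (rule less.hyps[OF c0 sp_insert_coloop[OF s f(3)] h(2) U0 h(4) cN0 h(7) Vmono[OF h(5) l]])
    then show ?thesis using meet_parallel[OF xy] by blast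
  qed
  have S: "sp (meet N N') \<and> \<Union>(meet N N') = UNIV" if c: "card N + card N' = card M + card M'" and xy: "spair N x y" "x \<in> \<Inter>N'" "y \<in> \<Inter>N'"
    and h: "sp N" "sp N'" "\<Union>N = UNIV" "\<Union>N' = UNIV" "{v + v' | v v'. v \<in> lineal N \<and> v' \<in> lineal N'} = UNIV"
      "\<And>I J. I \<in> N \<Longrightarrow> J \<in> N \<Longrightarrow> card I = card J" "\<And>I J. I \<in> N' \<Longrightarrow> J \<in> N' \<Longrightarrow> card I = card J"
    for N N' :: "'n set set" and x y
  \<comment> \<open>If the pair is parallel as well, no set contains both elements and contraction
    of \<open>x\<close> would make \<open>y\<close> a loop; the parallel reduction is then
    used.\<close>
  proof (cases "ppair N x y")
    case True
    show ?thesis by (rule P[OF c True xy(2) h])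
  next
    case False
    note f = spair_con_facts[OF xy(1)] and Q = spairD[OF xy(1)]
    let ?N0 = "con x N"
    obtain I0 where I0: "I0 \<in> N" "x \<in> I0" "y \<in> I0" using spair_common_basis[OF xy(1) False] by blast
    have s: "sp ?N0" by (rule sp_con[OF h(1) I0(1,2)])
    obtain I1 where I1: "I1 \<in> N" "x \<notin> I1" using Q(6) by (elim bexE) (rule that)
    have "?N0 \<subset> N"
    proof
      show "?N0 \<subseteq> N" by (rule subsetI) simp
      show "?N0 \<noteq> N" using I1 by (metis (mono_tags, lifting) mem_Collect_eq)
    qed
    then have "card ?N0 < card N" by (intro psubset_card_mono) simp_all
    then have c0: "card ?N0 + card N' < card M + card M'" using c by linarith
    have "y \<in> \<Union>?N0" using I0 by (intro UnionI[of I0]) simp_all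
    then have U0: "\<Union>?N0 = UNIV" using f(4) h(3) by (simp add: insert_absorb)
    have l: "lineal N \<subseteq> lineal ?N0" by (rule lineal_antimono) auto
    have cN0: "card I = card K" if "I \<in> ?N0" "K \<in> ?N0" for I K using h(6)[of I K] that by simp
    have "sp (meet ?N0 N') \<and> \<Union>(meet ?N0 N') = UNIV"
      by (rule less.hyps[OF c0 s h(2) U0 h(4) cN0 h(7) Vmono[OF h(5) l]])
    then show ?thesis using meet_series[OF xy] by blast
  qed
  note prems = less.prems
  show ?case
  proof (cases "\<exists>z0. z0 \<notin> \<Inter>M \<inter> \<Inter>M'")
    case False
    then have "\<Inter>M = UNIV" by (metis IntD1 UNIV_eq_I)
    then have "I = UNIV" if "I \<in> M" for I using that by (metis InterD UNIV_I UNIV_eq_I)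
    then have "M = {UNIV}" using sp_nonempty[OF prems(1)] by (metis is_singletonI' is_singleton_the_elem singletonD singletonI)
    then show ?thesis using prems(2,4) by (simp add: meet_UNIV)
  next
    case True
    then obtain z0 where z0: "z0 \<notin> \<Inter>M \<inter> \<Inter>M'" by (elim exE) (rule that)
    have R: "(\<exists>x y. ppair M x y \<and> x \<in> \<Inter>M') \<or> (\<exists>x y. spair M x y \<and> x \<in> \<Inter>M' \<and> y \<in> \<Inter>M') \<or>
      (\<exists>x y. ppair M' x y \<and> x \<in> \<Inter>M) \<or> (\<exists>x y. spair M' x y \<and> x \<in> \<Inter>M \<and> y \<in> \<Inter>M)"
      by (rule reducible_pair_exists[OF prems(1-4) _ _ prems(7) z0]) (erule (1) prems(5), erule (1) prems(6))
    consider x y where "ppair M x y" "x \<in> \<Inter>M'" | x y where "spair M x y" "x \<in> \<Inter>M'" "y \<in> \<Inter>M'"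
      | x y where "ppair M' x y" "x \<in> \<Inter>M" | x y where "spair M' x y" "x \<in> \<Inter>M" "y \<in> \<Inter>M"
      using R by (elim disjE exE conjE) (assumption | rule that)+
    then show ?thesis
    proof cases
      case 1
      show ?thesis by (rule P[OF refl 1 prems(1-4,7,5,6)])
    next
      case 2
      show ?thesis by (rule S[OF refl 2 prems(1-4,7,5,6)])
    next
      case 3
      show ?thesis unfolding meet_commute[of M] by (rule P[OF add.commute 3 prems(2,1,4,3) V'[OF prems(7)] prems(6,5)])
    next
      case 4
      show ?thesis unfolding meet_commute[of M] by (rule S[OF add.commute 4 prems(2,1,4,3) V'[OF prems(7)] prems(6,5)])
    qed
  qed
qed

section \<open>Geometry of the faces\<close>

lemma value_combination:
  assumes "a + b = (1::real)"
  shows "p I - wt (a *\<^sub>R x + b *\<^sub>R y) I = a * (p I - wt x I) + b * (p I - wt y I)"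
proof -
  have "p I = (a + b) * p I" using assms by simp
  then show ?thesis by (simp add: wt_add wt_scaleR algebra_simps)
qed

definition region :: "nat \<Rightarrow> ('n::finite set \<Rightarrow> real) \<Rightarrow> 'n set set \<Rightarrow> (real ^ 'n) set" where
  "region d p C = {w. C \<subseteq> initial_bases d p w}"

lemma regionI: "C \<subseteq> initial_bases d p w \<Longrightarrow> w \<in> region d p C"
  by (simp add: region_def)

lemma regionD: "w \<in> region d p C \<Longrightarrow> I \<in> C \<Longrightarrow> I \<in> initial_bases d p w"
  by (auto simp: region_def)

lemma cell_in_region: "w \<in> region d p (initial_bases d p w)"
  by (simp add: region_def)

lemma mem_region_iff:
  assumes "\<forall>I\<in>C. card I = d"
  shows "w \<in> region d p C \<longleftrightarrow> (\<forall>I\<in>C. \<forall>J\<in>{J. card J = d}. p I - wt w I \<le> p J - wt w J)"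
  using assms unfolding region_def initial_bases_eq by auto

lemma closed_region:
  fixes p :: "'n::finite set \<Rightarrow> real"
  assumes "\<forall>I\<in>C. card I = d"
  shows "closed (region d p C)"
proof -
  have "region d p C = (\<Inter>I\<in>C. \<Inter>J\<in>{J. card J = d}. {w. p I - wt w I \<le> p J - wt w J})"
    by (rule set_eqI) (simp add: mem_region_iff[OF assms])
  moreover have "closed {w. p I - wt w I \<le> p J - wt w J}" for I J
    unfolding wt_def by (intro closed_Collect_le continuous_intros)
  ultimately show ?thesis by (simp add: closed_INT)
qed

lemma convex_region:
  fixes p :: "'n::finite set \<Rightarrow> real"
  assumes "\<forall>I\<in>C. card I = d"
  shows "convex (region d p C)"
proof (rule convexI)
  fix x y and a b :: real
  assume xy: "x \<in> region d p C" "y \<in> region d p C" and ab: "0 \<le> a" "0 \<le> b" "a + b = 1"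
  show "a *\<^sub>R x + b *\<^sub>R y \<in> region d p C"
    unfolding mem_region_iff[OF assms] value_combination[OF ab(3)]
  proof (intro ballI add_mono mult_left_mono ab)
    fix I J :: "'n set" assume I: "I \<in> C" and J: "J \<in> {J. card J = d}"
    show "p I - wt x I \<le> p J - wt x J" "p I - wt y I \<le> p J - wt y J"
      using initial_bases_le[OF regionD[OF xy(1) I]] initial_bases_le[OF regionD[OF xy(2) I]] J by simp_all
  qed
qed

text \<open>Values on the segment are convex combinations with a positive share of the value at
  \<open>w0\<close>, where only the bases of \<open>w0\<close> are optimal. So no further set
  becomes minimal before the end \<open>w1\<close> is reached.\<close>

lemma cell_segment:
  assumes dn: "d \<le> CARD('n)" and w1: "w1 \<in> region d p (initial_bases d p w0)" and s: "0 < s" "s \<le> 1"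
  shows "initial_bases d p (w1 + s *\<^sub>R (w0 - w1 :: real ^ 'n::finite)) = initial_bases d p w0"
proof (intro equalityI subsetI)
  let ?w = "w1 + s *\<^sub>R (w0 - w1)"
  have w: "?w = (1 - s) *\<^sub>R w1 + s *\<^sub>R w0" by (simp add: algebra_simps)
  have f: "p I - wt ?w I = (1 - s) * (p I - wt w1 I) + s * (p I - wt w0 I)" for I
    unfolding w by (rule value_combination) simp
  have in0: "initial_bases d p w0 \<subseteq> initial_bases d p ?w"
  proof
    fix I assume I: "I \<in> initial_bases d p w0"
    have "p I - wt ?w I \<le> p J - wt ?w J" if J: "card J = d" for J
      unfolding f by (intro add_mono mult_left_mono initial_bases_le[OF I J] initial_bases_le[OF regionD[OF w1 I] J]) (use s in simp_all)
    then show "I \<in> initial_bases d p ?w" using initial_bases_card[OF I] by (simp add: initial_bases_eq)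
  qed
  fix I
  show "I \<in> initial_bases d p ?w" if "I \<in> initial_bases d p w0" using that in0 by blast
  assume I: "I \<in> initial_bases d p ?w"
  obtain I0 where I0: "I0 \<in> initial_bases d p w0" using initial_bases_nonempty[OF dn] by blast
  have "p I - wt ?w I \<le> p I0 - wt ?w I0" by (rule initial_bases_le[OF I initial_bases_card[OF I0]])
  moreover have "(1 - s) * (p I0 - wt w1 I0) \<le> (1 - s) * (p I - wt w1 I)"
    by (intro mult_left_mono initial_bases_le[OF regionD[OF w1 I0] initial_bases_card[OF I]]) (use s in simp)
  ultimately have "s * (p I - wt w0 I) \<le> s * (p I0 - wt w0 I0)" unfolding f by linarith
  then have "p I - wt w0 I \<le> p I0 - wt w0 I0" using s(1) by (simp only: mult_le_cancel_left_pos)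
  then show "I \<in> initial_bases d p w0" by (rule initial_basesI[OF I0 initial_bases_card[OF I]])
qed

lemma closure_cell:
  fixes w0 :: "real ^ 'n::finite"
  assumes dn: "d \<le> CARD('n)"
  shows "closure (tropical_cell d p (initial_bases d p w0)) = region d p (initial_bases d p w0)"
proof
  show "closure (tropical_cell d p (initial_bases d p w0)) \<subseteq> region d p (initial_bases d p w0)"
    by (rule closure_minimal) (auto simp: tropical_cell_def region_def initial_bases_card
        intro!: closed_region[unfolded region_def])
  show "region d p (initial_bases d p w0) \<subseteq> closure (tropical_cell d p (initial_bases d p w0))"
  proof
    fix w1 assume w1: "w1 \<in> region d p (initial_bases d p w0)"
    let ?x = "\<lambda>n. w1 + inverse (real (Suc n)) *\<^sub>R (w0 - w1)"
    have "?x \<longlonglongrightarrow> w1 + 0 *\<^sub>R (w0 - w1)" by (intro tendsto_intros LIMSEQ_inverse_real_of_nat)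
    then have l: "?x \<longlonglongrightarrow> w1" by simp
    have "?x n \<in> tropical_cell d p (initial_bases d p w0)" for n
      unfolding tropical_cell_def mem_Collect_eq
      by (rule cell_segment[OF dn w1]) (simp_all add: inverse_le_1_iff)
    then show "w1 \<in> closure (tropical_cell d p (initial_bases d p w0))" unfolding closure_sequential by (intro exI[of _ ?x] conjI allI l)
  qed
qed

lemma region_diff_lineal:
  assumes "w \<in> region d p (initial_bases d p w0)"
  shows "w - w0 \<in> lineal (initial_bases d p w0)"
proof (rule linealI)
  fix I J assume IJ: "I \<in> initial_bases d p w0" "J \<in> initial_bases d p w0"
  show "wt (w - w0) I = wt (w - w0) J"
    using initial_bases_same[OF IJ] initial_bases_same[OF regionD[OF assms IJ(1)] regionD[OF assms IJ(2)]]
    unfolding wt_diff by linarith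
qed

lemma lineal_step:
  fixes w0 :: "real ^ 'n::finite"
  assumes "d \<le> CARD('n)" "v \<in> lineal (initial_bases d p w0)"
  obtains s where "s > 0" "w0 + s *\<^sub>R v \<in> region d p (initial_bases d p w0)"
proof -
  obtain s where s: "s > 0" "initial_bases d p (w0 + s *\<^sub>R v) = max_face (initial_bases d p w0) v"
    by (rule initial_bases_small_step[OF assms(1)])
  have "max_face (initial_bases d p w0) v = initial_bases d p w0" using assms(2) by (simp only: max_face_eq_iff)
  then show thesis using that s by (simp add: region_def)
qed

lemma affine_hull_region:
  fixes w0 :: "real ^ 'n::finite"
  assumes dn: "d \<le> CARD('n)"
  shows "affine hull region d p (initial_bases d p w0) = (+) w0 ` lineal (initial_bases d p w0)"
proof
  let ?F = "region d p (initial_bases d p w0)" and ?V = "lineal (initial_bases d p w0)"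
  show "affine hull ?F \<subseteq> (+) w0 ` ?V"
  proof (rule hull_minimal)
    show "?F \<subseteq> (+) w0 ` ?V"
    proof
      fix w assume "w \<in> ?F"
      then have "w - w0 \<in> ?V" by (rule region_diff_lineal)
      then show "w \<in> (+) w0 ` ?V" by (rule image_eqI[rotated]) simp
    qed
    show "affine ((+) w0 ` ?V)" by (simp only: affine_translation[symmetric] subspace_imp_affine subspace_lineal)
  qed
  show "(+) w0 ` ?V \<subseteq> affine hull ?F"
  proof (rule image_subsetI)
    fix v assume "v \<in> ?V"
    then obtain s where s: "s > 0" "w0 + s *\<^sub>R v \<in> ?F" by (rule lineal_step[OF dn])
    have "(1 - 1 / s) *\<^sub>R w0 + (1 / s) *\<^sub>R (w0 + s *\<^sub>R v) \<in> affine hull ?F"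
      by (rule mem_affine[OF affine_affine_hull]) (use s cell_in_region[of w0 d p] in \<open>simp_all add: hull_inc\<close>)
    moreover have "(1 - 1 / s) *\<^sub>R w0 + (1 / s) *\<^sub>R (w0 + s *\<^sub>R v) = w0 + v" using s(1) by (simp add: algebra_simps)
    ultimately show "w0 + v \<in> affine hull ?F" by simp
  qed
qed

lemma direction_space_region:
  fixes w0 :: "real ^ 'n::finite"
  assumes dn: "d \<le> CARD('n)"
  shows "direction_space (region d p (initial_bases d p w0)) = lineal (initial_bases d p w0)"
    (is "_ = ?V")
  unfolding direction_space_def affine_hull_region[OF dn]
proof (intro equalityI subsetI)
  fix v assume "v \<in> {x - y |x y. x \<in> (+) w0 ` ?V \<and> y \<in> (+) w0 ` ?V}"
  then obtain a b where "a \<in> ?V" "b \<in> ?V" "v = (w0 + a) - (w0 + b)" by blast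
  then show "v \<in> ?V" using subspace_diff[OF subspace_lineal] by simp
next
  fix v assume v: "v \<in> ?V"
  have "v = (w0 + v) - (w0 + 0)" by simp
  moreover have "w0 + v \<in> (+) w0 ` ?V" "w0 + 0 \<in> (+) w0 ` ?V" by (rule imageI[OF v], rule imageI[OF subspace_0[OF subspace_lineal]])
  ultimately show "v \<in> {x - y |x y. x \<in> (+) w0 ` ?V \<and> y \<in> (+) w0 ` ?V}" by blast
qed

lemma aff_dim_region:
  fixes w0 :: "real ^ 'n::finite"
  assumes dn: "d \<le> CARD('n)"
  shows "aff_dim (region d p (initial_bases d p w0)) = int (dim (lineal (initial_bases d p w0)))"
proof -
  have "aff_dim (region d p (initial_bases d p w0)) = aff_dim ((+) w0 ` lineal (initial_bases d p w0))"
    unfolding affine_hull_region[OF dn, symmetric] by (simp only: aff_dim_affine_hull)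
  then show ?thesis by (simp only: aff_dim_translation_eq aff_dim_subspace[OF subspace_lineal])
qed

lemma rel_interior_region:
  fixes w0 :: "real ^ 'n::finite"
  assumes dn: "d \<le> CARD('n)"
  shows "w0 \<in> rel_interior (region d p (initial_bases d p w0))"
proof -
  let ?F = "region d p (initial_bases d p w0)"
  have c: "convex ?F" by (rule convex_region) (simp add: initial_bases_card)
  have ne: "?F \<noteq> {}" using cell_in_region[of w0 d p] by auto
  have "\<exists>e>1. (1 - e) *\<^sub>R x + e *\<^sub>R w0 \<in> ?F" if x: "x \<in> ?F" for x
  proof -
    have "- (x - w0) \<in> lineal (initial_bases d p w0)"
      by (rule subspace_neg[OF subspace_lineal region_diff_lineal[OF x]])
    then obtain s where s: "s > 0" "w0 + s *\<^sub>R (- (x - w0)) \<in> ?F" by (rule lineal_step[OF dn])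
    moreover have "w0 + s *\<^sub>R (- (x - w0)) = (1 - (1 + s)) *\<^sub>R x + (1 + s) *\<^sub>R w0" by (simp add: algebra_simps)
    ultimately show ?thesis by (intro exI[of _ "1 + s"]) simp
  qed
  then show ?thesis unfolding convex_rel_interior_iff[OF c ne] by blast
qed

lemma region_inj:
  assumes "C \<in> cells d p" "C' \<in> cells d p" "region d p C = region d p C'"
  shows "C = C'"
proof -
  obtain w w' where w: "C = initial_bases d p w" "C' = initial_bases d p w'" using assms(1,2) by (auto simp: cells_def)
  have "w \<in> region d p C'" "w' \<in> region d p C" using assms(3) cell_in_region[of w d p] cell_in_region[of w' d p] w by simp_all
  then show ?thesis unfolding region_def w by blast
qed

lemma tropical_faces_eq:
  fixes p :: "'n::finite set \<Rightarrow> real"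
  assumes p: "tropical_pluecker d p"
  shows "tropical_faces d p = region d p ` {C \<in> cells d p. \<Union>C = UNIV}"
proof -
  have dn: "d \<le> CARD('n)" using p by (simp add: tropical_pluecker_def)
  have cl: "closure (tropical_cell d p C) = region d p C" if "C \<in> cells d p" for C
    using that closure_cell[OF dn] by (auto simp: cells_def)
  have ne: "tropical_cell d p C \<noteq> {} \<longleftrightarrow> C \<in> cells d p" for C
    by (auto simp: tropical_cell_def cells_def)
  have L: "region d p C \<subseteq> tropical_linear_space d p \<longleftrightarrow> \<Union>C = UNIV" if "C \<in> cells d p" for C
  proof
    from that obtain w where w: "C = initial_bases d p w" by (auto simp: cells_def)
    assume "region d p C \<subseteq> tropical_linear_space d p"
    then show "\<Union>C = UNIV" using cell_in_region[of w d p] unfolding tropical_linear_space_eq[OF p] w by blast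
  next
    assume U: "\<Union>C = UNIV"
    show "region d p C \<subseteq> tropical_linear_space d p"
    proof
      fix w assume "w \<in> region d p C"
      then have "\<Union>C \<subseteq> \<Union>(initial_bases d p w)" unfolding region_def mem_Collect_eq by (rule Union_mono)
      then show "w \<in> tropical_linear_space d p" unfolding tropical_linear_space_eq[OF p] U by (simp add: top.extremum_unique)
    qed
  qed
  show ?thesis unfolding tropical_faces_def ne
  proof (intro equalityI subsetI)
    fix F assume "F \<in> {closure (tropical_cell d p M) |M. M \<in> cells d p \<and> closure (tropical_cell d p M) \<subseteq> tropical_linear_space d p}"
    then obtain C where C: "C \<in> cells d p" "F = closure (tropical_cell d p C)" "closure (tropical_cell d p C) \<subseteq> tropical_linear_space d p" by blast
    then have "\<Union>C = UNIV" "F = region d p C" using cl[OF C(1)] L[OF C(1)] by simp_all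
    then show "F \<in> region d p ` {C \<in> cells d p. \<Union>C = UNIV}" using C(1) by (intro image_eqI[of _ _ C]) simp_all
  next
    fix F assume "F \<in> region d p ` {C \<in> cells d p. \<Union>C = UNIV}"
    then obtain C where C: "C \<in> cells d p" "\<Union>C = UNIV" "F = region d p C" by (elim imageE CollectE conjE) (rule that)
    then have "F = closure (tropical_cell d p C)" "closure (tropical_cell d p C) \<subseteq> tropical_linear_space d p" using cl[OF C(1)] L[OF C(1)] by simp_all
    then show "F \<in> {closure (tropical_cell d p M) |M. M \<in> cells d p \<and> closure (tropical_cell d p M) \<subseteq> tropical_linear_space d p}"
      using C(1) by blast
  qed
qed

text \<open>The coordinate of a coloop can be raised without limit, whereas without loops and
  coloops \<open>gap\<close> bounds all differences of coordinates. A second coordinate is needed to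
  notice the escape modulo the all-ones vector, whence \<open>n \<ge> 2\<close>.\<close>

lemma bounded_region_iff:
  fixes p :: "'n::finite set \<Rightarrow> real"
  assumes C: "C \<in> cells d p" "\<Union>C = UNIV" and n2: "CARD('n) \<ge> 2"
  shows "bounded_mod_ones (region d p C) \<longleftrightarrow> \<Inter>C = {}"
proof
  assume I: "\<Inter>C = {}"
  let ?K = "real CARD('n) * spread d p"
  show "bounded_mod_ones (region d p C)" unfolding bounded_mod_ones_def
  proof (intro exI ballI)
    fix w assume "w \<in> region d p C"
    then have s: "C \<subseteq> initial_bases d p w" by (simp add: region_def)
    have le: "w $ f - w $ e \<le> ?K" for e f
    proof (rule ccontr)
      assume "\<not> w $ f - w $ e \<le> ?K"
      then have "e \<notin> \<Union>(initial_bases d p w) \<or> f \<in> \<Inter>(initial_bases d p w)" by (intro gap) simp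
      then show False using Union_mono[OF s] Inter_anti_mono[OF s] C(2) I by auto
    qed
    have "norm (w - w $ undefined *\<^sub>R vec 1) \<le> (\<Sum>i\<in>UNIV. \<bar>(w - w $ undefined *\<^sub>R vec 1) $ i\<bar>)" by (rule norm_le_l1_cart)
    also have "\<dots> \<le> (\<Sum>i\<in>(UNIV :: 'n set). ?K)"
    proof (rule sum_mono)
      fix i show "\<bar>(w - w $ undefined *\<^sub>R vec 1) $ i\<bar> \<le> ?K" using le[of i undefined] le[of undefined i] by (simp add: abs_le_iff)
    qed
    finally show "norm (w - w $ undefined *\<^sub>R vec 1) \<le> (\<Sum>i\<in>(UNIV :: 'n set). ?K)" .
  qed
next
  assume "bounded_mod_ones (region d p C)"
  then obtain B where B: "\<And>x. x \<in> region d p C \<Longrightarrow> \<exists>t. norm (x - t *\<^sub>R vec 1) \<le> B" unfolding bounded_mod_ones_def by blast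
  show "\<Inter>C = {}"
  proof (rule ccontr)
    assume "\<Inter>C \<noteq> {}"
    then obtain z where z: "z \<in> \<Inter>C" by (metis ex_in_conv)
    have zI: "z \<in> I" if "I \<in> C" for I by (rule InterD[OF z that])
    obtain z' where z': "z' \<noteq> z"
    proof (rule ccontr)
      assume "\<not> thesis"
      then have "UNIV = {z}" using that by auto
      then have "CARD('n) = card {z}" by simp
      then show False using n2 by simp
    qed
    obtain w where w: "C = initial_bases d p w" using C(1) by (auto simp: cells_def)
    \<comment> \<open>Large enough to put coordinates \<open>z\<close> and \<open>z'\<close> of
      \<open>?x\<close> more than \<open>2 * B\<close> apart, so that no \<open>t\<close> is within
      \<open>B\<close> of both.\<close>
    let ?s = "2 * \<bar>B\<bar> + \<bar>w $ z\<bar> + \<bar>w $ z'\<bar> + 1"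
    let ?x = "w + ?s *\<^sub>R axis z 1"
    have "?x \<in> region d p C"
    proof (rule regionI, rule subsetI)
      fix I assume I: "I \<in> C"
      have "p I - wt ?x I \<le> p J - wt ?x J" if "card J = d" for J
      proof -
        have "p I - wt w I \<le> p J - wt w J" using I that unfolding w by (rule initial_bases_le)
        moreover have "?s \<ge> 0" by simp
        ultimately show ?thesis using zI[OF I] unfolding wt_add wt_scaleR wt_axis by (simp only: if_True) (cases "z \<in> J"; simp)
      qed
      then show "I \<in> initial_bases d p ?x" using I unfolding w by (simp add: initial_bases_eq)
    qed
    then obtain t where t: "norm (?x - t *\<^sub>R vec 1) \<le> B" using B by blast
    have "\<bar>(?x - t *\<^sub>R vec 1) $ z\<bar> \<le> B" "\<bar>(?x - t *\<^sub>R vec 1) $ z'\<bar> \<le> B"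
      using component_le_norm_cart t by (meson order_trans)+
    then have "\<bar>w $ z + ?s - t\<bar> \<le> B" "\<bar>w $ z' - t\<bar> \<le> B" using z' by (simp_all add: axis_def)
    then show False by linarith
  qed
qed

section \<open>Constructible spaces\<close>

lemma heavy_subset:
  fixes q :: "'n::finite set \<Rightarrow> real"
  assumes S: "card S \<le> d" and w: "\<And>f e. f \<in> S \<Longrightarrow> e \<notin> S \<Longrightarrow> w $ f - w $ e > real CARD('n) * spread d q"
    and I: "I \<in> initial_bases d q w"
  shows "S \<subseteq> I"
proof (rule ccontr)
  assume "\<not> S \<subseteq> I"
  then obtain f where f: "f \<in> S" "f \<notin> I" by blast
  have "f \<notin> \<Inter>(initial_bases d q w)" using I f(2) by (metis InterD)
  then have "e \<notin> I" if "e \<notin> S" for e using gap[OF w[OF f(1) that]] I by (metis UnionI)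
  then have "I \<subseteq> S - {f}" using f(2) by blast
  then have "card I \<le> card (S - {f})" by (intro card_mono) simp_all
  also have "\<dots> < card S" using f(1) by (intro psubset_card_mono) auto
  finally show False using S initial_bases_card[OF I] by simp
qed

text \<open>At the point \<open>?w\<close> all sets \<open>S + k\<close> are bases of
  \<open>p\<close> simultaneously: the coordinates in \<open>S\<close> are huge and coordinate
  \<open>k\<close> equals \<open>p\<close> at \<open>S + k\<close>. Hence \<open>?w\<close> lies in
  the space, and the family of \<open>q\<close> at \<open>?w\<close> has no loops. Its sets also
  contain \<open>S\<close>, so each \<open>S + k\<close> is one of them, and the ties for both
  vectors give equal differences.\<close>

lemma pluecker_unique_step:
  fixes p q :: "'n::finite set \<Rightarrow> real"
  assumes p: "tropical_pluecker d p" and q: "\<And>w. w \<in> tropical_linear_space d p \<Longrightarrow> \<Union>(initial_bases d q w) = UNIV"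
    and S: "Suc (card S) = d" and ij: "i \<notin> S" "j \<notin> S"
  shows "q (insert i S) - p (insert i S) = q (insert j S) - p (insert j S)"
proof -
  \<comment> \<open>Exceeds every coordinate outside \<open>S\<close> by more than the thresholds of
    \<open>gap\<close> for both \<open>p\<close> and \<open>q\<close>.\<close>
  let ?K = "real CARD('n) * (spread d p + spread d q) + (\<Sum>k\<in>UNIV. \<bar>p (insert k S)\<bar>) + 1"
  let ?w = "(\<chi> k. if k \<in> S then ?K else p (insert k S)) :: real ^ 'n"
  have big: "?w $ f - ?w $ e > real CARD('n) * spread d p" "?w $ f - ?w $ e > real CARD('n) * spread d q"
    if "f \<in> S" "e \<notin> S" for e f
  proof -
    have "p (insert e S) \<le> (\<Sum>k\<in>UNIV. \<bar>p (insert k S)\<bar>)"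
      using member_le_sum[of e UNIV "\<lambda>k. \<bar>p (insert k S)\<bar>"] by simp
    moreover have "real CARD('n) * spread d p \<ge> 0" "real CARD('n) * spread d q \<ge> 0"
      using spread_pos[of d p] spread_pos[of d q] by simp_all
    ultimately show "?w $ f - ?w $ e > real CARD('n) * spread d p" "?w $ f - ?w $ e > real CARD('n) * spread d q"
      using that by (simp_all add: distrib_left)
  qed
  have wt: "wt ?w (insert e S) = ?K * real (card S) + p (insert e S)" if "e \<notin> S" for e
  proof -
    have "wt ?w (insert e S) = ?w $ e + (\<Sum>k\<in>S. ?w $ k)" unfolding wt_def using that by simp
    also have "(\<Sum>k\<in>S. ?w $ k) = (\<Sum>k\<in>S. ?K)" by (rule sum.cong) simp_all
    finally show ?thesis using that by (simp add: mult.commute)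
  qed
  have form: "\<exists>e. e \<notin> S \<and> I = insert e S" if "S \<subseteq> I" "card I = d" for I
  proof -
    have "card (I - S) = 1" using that S by (simp add: card_Diff_subset)
    then obtain e where "I - S = {e}" by (rule card_1_singletonE)
    then show ?thesis using that(1) by (intro exI[of _ e]) blast
  qed
  have sp: "S \<subseteq> I" if "I \<in> initial_bases d p ?w" for I using S big(1) that by (intro heavy_subset[where w = ?w and q = p and d = d]) simp_all
  have sq: "S \<subseteq> I" if "I \<in> initial_bases d q ?w" for I using S big(2) that by (intro heavy_subset[where w = ?w and q = q and d = d]) simp_all
  have dn: "d \<le> CARD('n)" using p by (simp add: tropical_pluecker_def)
  obtain I where I: "I \<in> initial_bases d p ?w" using initial_bases_nonempty[OF dn] by blast
  obtain e0 where e0: "e0 \<notin> S" "I = insert e0 S" using form[OF sp[OF I] initial_bases_card[OF I]] by blast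
  have all: "insert e S \<in> initial_bases d p ?w" if "e \<notin> S" for e
  proof (rule initial_basesI[OF I])
    show "card (insert e S) = d" using S that by simp
    show "p (insert e S) - wt ?w (insert e S) \<le> p I - wt ?w I" unfolding e0(2) wt[OF that] wt[OF e0(1)] by simp
  qed
  have "\<Union>(initial_bases d p ?w) = UNIV"
  proof -
    have "e \<in> \<Union>(initial_bases d p ?w)" for e
    proof (cases "e \<in> S")
      case True
      then show ?thesis using sp[OF I] by (intro UnionI[OF I]) blast
    next
      case False
      show ?thesis by (rule UnionI[OF all[OF False]]) simp
    qed
    then show ?thesis by auto
  qed
  then have "?w \<in> tropical_linear_space d p" unfolding tropical_linear_space_eq[OF p] by simp
  then have U: "\<Union>(initial_bases d q ?w) = UNIV" by (rule q)
  have allq: "insert e S \<in> initial_bases d q ?w" if "e \<notin> S" for e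
  proof -
    have "e \<in> \<Union>(initial_bases d q ?w)" unfolding U by simp
    then obtain I where I: "I \<in> initial_bases d q ?w" "e \<in> I" by (elim UnionE) (rule that)
    obtain e' where "e' \<notin> S" "I = insert e' S" using form[OF sq[OF I(1)] initial_bases_card[OF I(1)]] by blast
    then have "I = insert e S" using I(2) that by auto
    then show ?thesis using I(1) by simp
  qed
  have "q (insert i S) - wt ?w (insert i S) = q (insert j S) - wt ?w (insert j S)"
    by (rule initial_bases_same[OF allq[OF ij(1)] allq[OF ij(2)]])
  then show ?thesis unfolding wt[OF ij(1)] wt[OF ij(2)] by linarith
qed

text \<open>The tropical linear space determines the vector up to a constant. The hypothesis on \<open>q\<close> is weak
  enough to apply to a dual or stable intersection that is not known to be a Pluecker vector.\<close>

lemma pluecker_unique: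
  fixes p q :: "'n::finite set \<Rightarrow> real"
  assumes p: "tropical_pluecker d p" and q: "\<And>w. w \<in> tropical_linear_space d p \<Longrightarrow> \<Union>(initial_bases d q w) = UNIV"
  shows "initial_bases d q = initial_bases d p"
proof -
  have dn: "d \<le> CARD('n)" using p by (simp add: tropical_pluecker_def)
  obtain I0 :: "'n set" where I0: "card I0 = d" using obtain_subset_with_card_n[OF dn] by metis
  \<comment> \<open>Any \<open>I\<close> is led to \<open>I0\<close> by single exchanges, each of
    which preserves \<open>q - p\<close>.\<close>
  have c: "q I - p I = q I0 - p I0" if "card I = d" for I
    using that
  proof (induction "card (I0 - I)" arbitrary: I rule: less_induct)
    case less
    show ?case
    proof (cases "I0 \<subseteq> I")
      case True
      then have "I0 = I" using I0 less.prems by (intro card_subset_eq) simp_all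
      then show ?thesis by simp
    next
      case False
      then obtain a where a: "a \<in> I0" "a \<notin> I" by blast
      have "\<not> I \<subseteq> I0"
      proof
        assume "I \<subseteq> I0"
        then have "I = I0" using I0 less.prems by (intro card_subset_eq) simp_all
        then show False using a by simp
      qed
      then obtain b where b: "b \<in> I" "b \<notin> I0" by blast
      let ?S = "I - {b}"
      have cS: "Suc (card ?S) = d" using b(1) less.prems card_Suc_Diff1[of I b] by simp
      have "I0 - insert a ?S \<subset> I0 - I" using a b by blast
      then have "card (I0 - insert a ?S) < card (I0 - I)" by (intro psubset_card_mono) simp_all
      moreover have "card (insert a ?S) = d" using a cS by simp
      ultimately have "q (insert a ?S) - p (insert a ?S) = q I0 - p I0" by (rule less.hyps)
      moreover have "q (insert a ?S) - p (insert a ?S) = q (insert b ?S) - p (insert b ?S)"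
        by (rule pluecker_unique_step[OF p q cS]) (use a in simp_all)
      moreover have "insert b ?S = I" using b(1) by blast
      ultimately show ?thesis by simp
    qed
  qed
  have e: "q I = p I + (q I0 - p I0)" if "card I = d" for I using c[OF that] by simp
  show ?thesis
  proof (rule ext, rule set_eqI)
    fix w I
    show "I \<in> initial_bases d q w \<longleftrightarrow> I \<in> initial_bases d p w"
      unfolding initial_bases_eq mem_Collect_eq by (simp add: e cong: conj_cong)
  qed
qed

text \<open>The weight of a complement is the constant \<open>wt w UNIV\<close> minus the weight of
  the set, so the dual vector at \<open>w\<close> is minimized by the complements of the bases of
  \<open>p\<close> at \<open>- w\<close>.\<close>

lemma initial_bases_dual:
  fixes p :: "'n::finite set \<Rightarrow> real"
  assumes "d \<le> CARD('n)"
  shows "initial_bases (CARD('n) - d) (dual_pluecker p) w = uminus ` initial_bases d p (- w)"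
proof (rule set_eqI)
  fix I :: "'n set"
  have c: "card (- J) = d \<longleftrightarrow> card J = CARD('n) - d" for J :: "'n set"
    using assms card_mono[of UNIV J] unfolding card_Compl by auto
  have all: "(\<forall>J. P (- J)) \<longleftrightarrow> (\<forall>J. P J)" for P :: "'n set \<Rightarrow> bool" by (metis double_complement)
  have "I \<in> uminus ` initial_bases d p (- w) \<longleftrightarrow> - I \<in> initial_bases d p (- w)"
    by (metis double_complement image_iff)
  also have "\<dots> \<longleftrightarrow> card (- I) = d \<and> (\<forall>J. card (- J) = d \<longrightarrow> p (- I) - wt (- w) (- I) \<le> p (- J) - wt (- w) (- J))"
    unfolding initial_bases_eq mem_Collect_eq
    by (subst all[of "\<lambda>J. card J = d \<longrightarrow> p (- I) - wt (- w) (- I) \<le> p J - wt (- w) J", symmetric]) (rule refl)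
  also have "\<dots> \<longleftrightarrow> I \<in> initial_bases (CARD('n) - d) (dual_pluecker p) w"
    unfolding initial_bases_eq mem_Collect_eq dual_pluecker_def c wt_uminus wt_compl by simp
  finally show "I \<in> initial_bases (CARD('n) - d) (dual_pluecker p) w \<longleftrightarrow> I \<in> uminus ` initial_bases d p (- w)" ..
qed

lemma sp_singletons:
  fixes A :: "'n set"
  assumes "finite A" "A \<noteq> {}"
  shows "sp ((\<lambda>j. {j}) ` A)"
  using assms
proof (induction rule: finite_ne_induct)
  case (singleton x)
  show ?case using sp.single[of "{x}"] by simp
next
  case (insert x A)
  let ?B = "(\<lambda>j. {j}) ` insert x A"
  obtain y where y: "y \<in> A" using insert.hyps by blast
  have xy: "x \<noteq> y" using y insert.hyps by blast
  have "ppair ?B x y"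
  proof (rule ppairI[OF xy])
    show "x \<in> \<Union>?B" by auto
    fix J assume "J \<in> ?B"
    then obtain j where J: "J = {j}" by auto
    show "y \<notin> J" if "x \<in> J" using that xy J by simp
    show "insert y (J - {x}) \<in> ?B" if "x \<in> J" using that J y by simp
    show "insert x (J - {y}) \<in> ?B" if "y \<in> J" using that J y by simp
  qed
  moreover have "del x ?B = (\<lambda>j. {j}) ` A" using insert.hyps by auto
  ultimately show ?case using insert.IH sp.parallel by metis
qed

text \<open>The complements are singletons, and singletons form a single parallel class. This is the
  case of hyperplanes.\<close>

lemma sp_corank_one:
  fixes B :: "'n::finite set set"
  assumes "B \<noteq> {}" "\<And>I. I \<in> B \<Longrightarrow> card I = CARD('n) - 1"
  shows "sp B"
proof -
  let ?A = "{j. - {j} \<in> B}"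
  have e: "uminus ` B = (\<lambda>j. {j}) ` ?A"
  proof (intro equalityI subsetI)
    fix K assume "K \<in> uminus ` B"
    then obtain I where I: "I \<in> B" "K = - I" by (elim imageE) (rule that)
    have "CARD('n) \<ge> 1" by (simp add: Suc_leI)
    then have "card (- I) = 1" unfolding card_Compl assms(2)[OF I(1)] by simp
    then obtain j where j: "- I = {j}" by (rule card_1_singletonE)
    then have "- {j} = I" by (metis double_complement)
    then show "K \<in> (\<lambda>j. {j}) ` ?A" using I j by simp
  next
    fix K assume "K \<in> (\<lambda>j. {j}) ` ?A"
    then obtain j where "- {j} \<in> B" "K = - (- {j})" by auto
    then show "K \<in> uminus ` B" by blast
  qed
  have "?A \<noteq> {}" using assms(1) e by auto
  then have "sp (uminus ` B)" unfolding e by (intro sp_singletons) simp_all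
  then have "sp (uminus ` uminus ` B)" by (rule sp_dual)
  then show ?thesis by simp
qed

text \<open>If \<open>x\<close> is a loop at \<open>w\<close>, raise \<open>w_x\<close> until sets
  through \<open>x\<close> draw level; the family at \<open>w\<close> is the deletion of
  \<open>x\<close> from the new family, which has fewer loops. This must happen: for
  \<open>d \<ge> 1\<close> a basis contains some \<open>e\<close>, and by \<open>gap\<close> a large
  enough \<open>w_x\<close> would make \<open>e\<close> a loop or \<open>x\<close> a coloop.\<close>

lemma sp_of_loopfree:
  fixes p :: "'n::finite set \<Rightarrow> real"
  assumes dn: "d \<le> CARD('n)" and d: "d \<ge> 1" and sp: "\<And>w. \<Union>(initial_bases d p w) = UNIV \<Longrightarrow> sp (initial_bases d p w)"
  shows "sp (initial_bases d p w)"
proof (induction "card (- \<Union>(initial_bases d p w))" arbitrary: w rule: less_induct)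
  case less
  show ?case
  proof (cases "\<Union>(initial_bases d p w) = UNIV")
    case True
    then show ?thesis by (rule sp)
  next
    case False
    then obtain x where x: "x \<notin> \<Union>(initial_bases d p w)" by blast
    have xI: "x \<notin> I" if "I \<in> initial_bases d p w" for I using x that by blast
    obtain I0 where I0: "I0 \<in> initial_bases d p w" using initial_bases_nonempty[OF dn] by blast
    let ?v = "axis x 1 :: real ^ 'n"
    have v: "?v \<in> lineal (initial_bases d p w)" by (rule linealI) (simp add: wt_axis xI)
    have "\<not> (\<forall>s\<ge>0. initial_bases d p w \<subseteq> initial_bases d p (w + s *\<^sub>R ?v))"
    proof
      assume h: "\<forall>s\<ge>0. initial_bases d p w \<subseteq> initial_bases d p (w + s *\<^sub>R ?v)"
      have "I0 \<noteq> {}" using initial_bases_card[OF I0] d by auto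
      then obtain e where e: "e \<in> I0" by blast
      then have ex: "e \<noteq> x" using xI[OF I0] by blast
      let ?s = "real CARD('n) * spread d p + \<bar>w $ x\<bar> + \<bar>w $ e\<bar> + 1"
      have "real CARD('n) * spread d p \<ge> 0" using spread_pos[of d p] by simp
      then have s: "?s \<ge> 0" by simp
      have in': "I0 \<in> initial_bases d p (w + ?s *\<^sub>R ?v)" using h s I0 by blast
      have "(w + ?s *\<^sub>R ?v) $ x - (w + ?s *\<^sub>R ?v) $ e > real CARD('n) * spread d p" using ex by (simp add: axis_def)
      then have "e \<notin> \<Union>(initial_bases d p (w + ?s *\<^sub>R ?v)) \<or> x \<in> \<Inter>(initial_bases d p (w + ?s *\<^sub>R ?v))" by (rule gap)
      then show False using UnionI[OF in' e] by (elim disjE) (erule (1) notE, erule notE[OF xI[OF I0] InterD[OF _ in']])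
    qed
    then obtain s where s: "s \<ge> 0" "initial_bases d p w \<subset> initial_bases d p (w + s *\<^sub>R ?v)"
      using initial_bases_move[OF I0 v] by blast
    let ?w = "w + s *\<^sub>R ?v"
    have I0': "I0 \<in> initial_bases d p ?w" using s(2) I0 by blast
    have e: "initial_bases d p w = del x (initial_bases d p ?w)"
    proof (intro equalityI subsetI)
      fix I assume "I \<in> initial_bases d p w"
      then show "I \<in> del x (initial_bases d p ?w)" using s(2) xI by blast
    next
      fix I assume "I \<in> del x (initial_bases d p ?w)"
      then have I: "I \<in> initial_bases d p ?w" "x \<notin> I" by simp_all
      have "p I - wt ?w I = p I0 - wt ?w I0" by (rule initial_bases_same[OF I(1) I0'])
      then have "p I - wt w I = p I0 - wt w I0" using I(2) xI[OF I0] by (simp add: wt_add wt_scaleR wt_axis)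
      then show "I \<in> initial_bases d p w" by (intro initial_basesI[OF I0 initial_bases_card[OF I(1)]]) simp
    qed
    obtain I1 where I1: "I1 \<in> initial_bases d p ?w" "I1 \<notin> initial_bases d p w" using s(2) by blast
    then have "x \<in> I1" using e by blast
    then have "x \<in> \<Union>(initial_bases d p ?w)" by (rule UnionI[OF I1(1)])
    moreover have "\<Union>(initial_bases d p w) \<subseteq> \<Union>(initial_bases d p ?w)" using s(2) by (intro Union_mono) blast
    ultimately have "- \<Union>(initial_bases d p ?w) \<subset> - \<Union>(initial_bases d p w)" using x by blast
    then have "card (- \<Union>(initial_bases d p ?w)) < card (- \<Union>(initial_bases d p w))" by (intro psubset_card_mono) simp_all
    then have "sp (initial_bases d p ?w)" by (rule less.hyps)
    then show ?thesis unfolding e by (rule sp_del[OF _ I0' xI[OF I0]])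
  qed
qed

section \<open>Stable intersection of vectors and transversality\<close>

lemma stable_intersection_exists:
  fixes p p' :: "'n::finite set \<Rightarrow> real"
  assumes d: "d \<le> CARD('n)" "d' \<le> CARD('n)" "CARD('n) \<le> d + d'"
  obtains q where
    "\<forall>I I'. card I = d \<longrightarrow> card I' = d' \<longrightarrow> I \<union> I' = UNIV \<longrightarrow> q (I \<inter> I') \<le> p I + p' I'"
    "\<forall>J. card J = d + d' - CARD('n) \<longrightarrow>
      (\<exists>I I'. card I = d \<and> card I' = d' \<and> I \<union> I' = UNIV \<and> I \<inter> I' = J \<and> q J = p I + p' I')"
proof -
  let ?P = "\<lambda>J. {(I, I'). card I = d \<and> card I' = d' \<and> I \<union> I' = UNIV \<and> I \<inter> I' = J}"
  let ?Q = "\<lambda>J. (\<lambda>(I, I'). p I + p' I') ` ?P J"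
  define q where "q = (\<lambda>J. Min (?Q J))"
  have fin: "finite (?Q J)" for J by simp
  have le: "q (I \<inter> I') \<le> p I + p' I'" if "card I = d" "card I' = d'" "I \<union> I' = UNIV" for I I'
    unfolding q_def
  proof (rule Min_le[OF fin])
    show "p I + p' I' \<in> ?Q (I \<inter> I')" by (rule image_eqI[of _ _ "(I, I')"]) (use that in simp_all)
  qed
  have at: "\<exists>I I'. card I = d \<and> card I' = d' \<and> I \<union> I' = UNIV \<and> I \<inter> I' = J \<and> q J = p I + p' I'"
    if J: "card J = d + d' - CARD('n)" for J
  proof -
    have "CARD('n) - d' \<le> card (- J)" unfolding card_Compl J using d by linarith
    then obtain A where A: "A \<subseteq> - J" "card A = CARD('n) - d'" by (rule obtain_subset_with_card_n)
    have "card (J \<union> A) = card J + card A" using A(1) by (intro card_Un_disjoint) auto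
    then have 1: "card (J \<union> A) = d" unfolding J A(2) using d by linarith
    have 2: "card (- A) = d'" unfolding card_Compl A(2) using d by linarith
    have "(J \<union> A, - A) \<in> ?P J" using 1 2 A(1) by auto
    then have "?Q J \<noteq> {}" by blast
    then have "q J \<in> ?Q J" unfolding q_def by (rule Min_in[OF fin])
    then obtain I I' where "(I, I') \<in> ?P J" "q J = p I + p' I'" by (elim imageE) (auto intro: that)
    then show ?thesis by (intro exI[of _ I] exI[of _ I']) simp
  qed
  show thesis by (rule that[of q]) (use le at in blast)+
qed

text \<open>For covering pairs the weights of \<open>I\<close> and \<open>I'\<close> add up to a
  constant plus the weight of \<open>I \<inter> I'\<close>, so minimizing \<open>q\<close> means
  minimizing the sum of the two values over covering pairs. A nonempty meet shows that both minima
  can be attained at once, hence must be.\<close>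

lemma initial_bases_stable_intersection:
  fixes p p' q :: "'n::finite set \<Rightarrow> real"
  assumes le0: "\<forall>I I'. card I = d \<longrightarrow> card I' = d' \<longrightarrow> I \<union> I' = UNIV \<longrightarrow> q (I \<inter> I') \<le> p I + p' I'"
    and at0: "\<forall>J. card J = d + d' - CARD('n) \<longrightarrow>
      (\<exists>I I'. card I = d \<and> card I' = d' \<and> I \<union> I' = UNIV \<and> I \<inter> I' = J \<and> q J = p I + p' I')"
    and ne: "meet (initial_bases d p w) (initial_bases d' p' w) \<noteq> {}"
  shows "initial_bases (d + d' - CARD('n)) q w = meet (initial_bases d p w) (initial_bases d' p' w)"
proof (intro equalityI subsetI)
  let ?M = "initial_bases d p w" and ?M' = "initial_bases d' p' w"
  note le = le0[rule_format] and at = at0[rule_format]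
  have c: "card (I \<inter> I') = d + d' - CARD('n)" if "card I = d" "card I' = d'" "I \<union> I' = UNIV" for I I' :: "'n set"
    using card_Un_Int[of I I'] that by simp
  have wtJ: "wt w I + wt w I' = wt w UNIV + wt w (I \<inter> I')" if "I \<union> I' = UNIV" for I I'
    using sum.union_inter[of I I' "\<lambda>i. w $ i"] that unfolding wt_def by simp
  fix J
  {
    assume "J \<in> meet ?M ?M'"
    then obtain I I' where I: "I \<in> ?M" "I' \<in> ?M'" "J = I \<inter> I'" "I \<union> I' = UNIV" by (rule meetE)
    note cI = initial_bases_card[OF I(1)] initial_bases_card[OF I(2)]
    have "q J - wt w J \<le> q J2 - wt w J2" if J2: "card J2 = d + d' - CARD('n)" for J2
    proof -
      obtain I2 I2' where I2: "card I2 = d" "card I2' = d'" "I2 \<union> I2' = UNIV" "I2 \<inter> I2' = J2" "q J2 = p I2 + p' I2'"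
        using at[OF J2] by blast
      show ?thesis
        using le[OF cI I(4)] wtJ[OF I(4)] wtJ[OF I2(3)] I2(4,5) I(3) initial_bases_le[OF I(1) I2(1)] initial_bases_le[OF I(2) I2(2)]
        by simp
    qed
    then show "J \<in> initial_bases (d + d' - CARD('n)) q w" using c[OF cI I(4)] I(3) by (simp add: initial_bases_eq)
  }
  assume J: "J \<in> initial_bases (d + d' - CARD('n)) q w"
  obtain J0 where "J0 \<in> meet ?M ?M'" using ne by blast
  then obtain I0 I0' where I0: "I0 \<in> ?M" "I0' \<in> ?M'" "J0 = I0 \<inter> I0'" "I0 \<union> I0' = UNIV" by (rule meetE)
  note cI0 = initial_bases_card[OF I0(1)] initial_bases_card[OF I0(2)]
  obtain I I' where I: "card I = d" "card I' = d'" "I \<union> I' = UNIV" "I \<inter> I' = J" "q J = p I + p' I'"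
    using at[OF initial_bases_card[OF J]] by blast
  have "q J - wt w J \<le> q (I0 \<inter> I0') - wt w (I0 \<inter> I0')" by (rule initial_bases_le[OF J c[OF cI0 I0(4)]])
  then have *: "(p I - wt w I) + (p' I' - wt w I') \<le> (p I0 - wt w I0) + (p' I0' - wt w I0')"
    using le[OF cI0 I0(4)] wtJ[OF I0(4)] wtJ[OF I(3)] I(4,5) by simp
  have **: "p I0 - wt w I0 \<le> p I - wt w I" "p' I0' - wt w I0' \<le> p' I' - wt w I'"
    by (rule initial_bases_le[OF I0(1) I(1)], rule initial_bases_le[OF I0(2) I(2)])
  have "I \<in> ?M" by (rule initial_basesI[OF I0(1) I(1)]) (use * ** in linarith)
  moreover have "I' \<in> ?M'" by (rule initial_basesI[OF I0(2) I(2)]) (use * ** in linarith)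
  ultimately show "J \<in> meet ?M ?M'" using meetI[OF _ _ I(3)] I(4) by blast
qed

text \<open>The point \<open>w\<close> lies in the relative interior of the closure of its own cell
  for either vector, so the transversality condition applies to these two faces.\<close>

lemma transverse_lineal_sum:
  fixes p p' :: "'n::finite set \<Rightarrow> real"
  assumes p: "tropical_pluecker d p" "tropical_pluecker d' p'" and t: "meet_transversely d p d' p'"
    and w: "w \<in> tropical_linear_space d p" "w \<in> tropical_linear_space d' p'"
  shows "{v + v' | v v'. v \<in> lineal (initial_bases d p w) \<and> v' \<in> lineal (initial_bases d' p' w)} = UNIV"
proof -
  let ?M = "initial_bases d p w" and ?M' = "initial_bases d' p' w"
  have dn: "d \<le> CARD('n)" "d' \<le> CARD('n)" using p by (simp_all add: tropical_pluecker_def)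
  have "region d p ?M \<in> tropical_faces d p" unfolding tropical_faces_eq[OF p(1)]
    by (rule imageI) (simp add: cells_def loopfree_of_tropical_linear_space[OF dn(1) w(1)])
  moreover have "region d' p' ?M' \<in> tropical_faces d' p'" unfolding tropical_faces_eq[OF p(2)]
    by (rule imageI) (simp add: cells_def loopfree_of_tropical_linear_space[OF dn(2) w(2)])
  moreover have "rel_interior (region d p ?M) \<inter> rel_interior (region d' p' ?M') \<noteq> {}"
    using IntI[OF rel_interior_region[OF dn(1)] rel_interior_region[OF dn(2)], of w p p'] by (metis empty_iff)
  ultimately have "span (direction_space (region d p ?M) \<union> direction_space (region d' p' ?M')) = UNIV"
    using t unfolding meet_transversely_def by blast
  then have "span (lineal ?M \<union> lineal ?M') = UNIV" unfolding direction_space_region[OF dn(1)] direction_space_region[OF dn(2)] .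
  moreover have "span (lineal ?M) = lineal ?M" "span (lineal ?M') = lineal ?M'" by (simp_all only: span_eq_iff subspace_lineal)
  ultimately show ?thesis by (simp only: span_Un)
qed

text \<open>The statement ranges over all vectors \<open>p\<close> that present the set, because
  \<open>constructible\<close> refers only to the set. In the dual and intersection cases
  \<open>pluecker_unique\<close> identifies the families of \<open>p\<close> with those of the dual
  vector or of the stable intersection.\<close>

theorem constructible_sp:
  fixes L :: "(real ^ 'n::finite) set"
  assumes "constructible d L" "tropical_pluecker d p" "L = tropical_linear_space d p"
  shows "sp (initial_bases d p w)"
  using assms
proof (induction arbitrary: p w rule: constructible.induct)
  case (hyperplane p0)
  show ?case by (intro sp_corank_one initial_bases_nonempty diff_le_self) (rule initial_bases_card)
next
  case (dual d p0)
  have dn: "d \<le> CARD('n)" using dual.hyps(1) by (simp add: tropical_pluecker_def)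
  have "initial_bases (CARD('n) - d) (dual_pluecker p0) = initial_bases (CARD('n) - d) p"
  proof (rule pluecker_unique[OF dual.prems(1)])
    fix w assume "w \<in> tropical_linear_space (CARD('n) - d) p"
    then have "w \<in> tropical_linear_space (CARD('n) - d) (dual_pluecker p0)" using dual.prems(2) by simp
    then show "\<Union>(initial_bases (CARD('n) - d) (dual_pluecker p0) w) = UNIV" by (intro loopfree_of_tropical_linear_space) simp_all
  qed
  then have "initial_bases (CARD('n) - d) p w = uminus ` initial_bases d p0 (- w)" using initial_bases_dual[OF dn] by metis
  then show ?case using sp_dual[OF dual.IH[OF dual.hyps(1) refl]] by simp
next
  case (transverse_intersection d p1 d' p2)
  note p1 = transverse_intersection.hyps(1) and p2 = transverse_intersection.hyps(2)
  have dn: "d \<le> CARD('n)" "d' \<le> CARD('n)" using p1 p2 by (simp_all add: tropical_pluecker_def)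
  let ?d = "d + d' - CARD('n)"
  have dn'': "?d \<le> CARD('n)" using dn by simp
  show ?case
  \<comment> \<open>\<open>sp_of_loopfree\<close> requires positive rank; in rank zero the only
    family is \<open>{{}}\<close>.\<close>
  proof (cases "?d = 0")
    case True
    have "I = {}" if "I \<in> initial_bases ?d p w" for I using initial_bases_card[OF that] True by simp
    then have "initial_bases ?d p w = {{}}" using initial_bases_nonempty[OF dn'', of p w] by blast
    then show ?thesis using sp.single by metis
  next
    case False
    obtain q where
      q1: "\<forall>I I'. card I = d \<longrightarrow> card I' = d' \<longrightarrow> I \<union> I' = UNIV \<longrightarrow> q (I \<inter> I') \<le> p1 I + p2 I'" and
      q2: "\<forall>J. card J = ?d \<longrightarrow>
        (\<exists>I I'. card I = d \<and> card I' = d' \<and> I \<union> I' = UNIV \<and> I \<inter> I' = J \<and> q J = p1 I + p2 I')"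
      by (rule stable_intersection_exists[OF dn transverse_intersection.hyps(5)])
    have *: "sp (initial_bases ?d q w) \<and> \<Union>(initial_bases ?d q w) = UNIV" if "w \<in> tropical_linear_space ?d p" for w
    proof -
      have w: "w \<in> tropical_linear_space d p1" "w \<in> tropical_linear_space d' p2"
        using that transverse_intersection.prems(2) by blast+
      have m: "sp (meet (initial_bases d p1 w) (initial_bases d' p2 w)) \<and>
        \<Union>(meet (initial_bases d p1 w) (initial_bases d' p2 w)) = UNIV"
      proof (rule meet_sp)
        show "sp (initial_bases d p1 w)" "sp (initial_bases d' p2 w)"
          using transverse_intersection.IH p1 p2 by simp_all
        show "\<Union>(initial_bases d p1 w) = UNIV" "\<Union>(initial_bases d' p2 w) = UNIV"
          by (rule loopfree_of_tropical_linear_space[OF dn(1) w(1)], rule loopfree_of_tropical_linear_space[OF dn(2) w(2)])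
        show "{v + v' | v v'. v \<in> lineal (initial_bases d p1 w) \<and> v' \<in> lineal (initial_bases d' p2 w)} = UNIV"
          by (rule transverse_lineal_sum[OF p1 p2 transverse_intersection.hyps(6) w])
      qed (simp_all add: initial_bases_card)
      then have "meet (initial_bases d p1 w) (initial_bases d' p2 w) \<noteq> {}" by (intro sp_nonempty) blast
      from initial_bases_stable_intersection[OF q1 q2 this] show ?thesis using m by simp
    qed
    have e: "initial_bases ?d q = initial_bases ?d p"
      by (rule pluecker_unique[OF transverse_intersection.prems(1)]) (use * in blast)
    show ?thesis
    proof (rule sp_of_loopfree[OF dn''])
      show "?d \<ge> 1" using False by simp
      fix w assume "\<Union>(initial_bases ?d p w) = UNIV"
      then have "w \<in> tropical_linear_space ?d p" unfolding tropical_linear_space_eq[OF transverse_intersection.prems(1)] by simp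
      then show "sp (initial_bases ?d p w)" using * e by simp
    qed
  qed
qed

section \<open>Counting bounded faces\<close>

text \<open>With \<open>a = d - i\<close>, \<open>b = n - d - i\<close> and \<open>j = i - 1\<close>
  one has \<open>a + b = n - 2i\<close> and \<open>a + b + j = n - i - 1\<close>, so the trinomial
  coefficient is the stated product. Outside this range one of the two binomials vanishes.\<close>

lemma delannoy_coeff_eq_binom:
  assumes n: "n \<ge> 2" "d \<le> n" and i: "i \<ge> 1"
  shows "delannoy_coeff d (n - d) i = binom (int n - 2 * int i) (int d - int i) * binom (int n - int i - 1) (int i - 1)"
proof -
  obtain j where j: "i = Suc j" using i by (cases i) simp_all
  have nats: "nat (int n - 2 * int i) = n - 2 * i" "nat (int n - int i - 1) = n - i - 1" "nat (int i - 1) = j"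
    using j by linarith+
  have b: "binom (int n - int i - 1) (int i - 1) = (n - i - 1) choose j"
    unfolding binom_def nats using j by simp
  consider "i \<le> d" "i \<le> n - d" | "d < i" | "i \<le> d" "n - d < i" by linarith
  then show ?thesis
  proof cases
    case 1
    have "nat (int d - int i) = d - i" using 1(1) by linarith
    then have "binom (int n - 2 * int i) (int d - int i) = (n - 2 * i) choose (d - i)"
      unfolding binom_def nats using 1(1) by simp
    moreover have "d - Suc j + (n - d - Suc j) = n - 2 * i" "n - 2 * i + j = n - i - 1" using 1 j n(2) by linarith+
    ultimately show ?thesis unfolding b using 1 j by (simp add: delannoy_coeff_def tri_def)
  next
    case 2
    then show ?thesis using j by (simp add: delannoy_coeff_def binom_def)
  next
    case 3
    have d: "nat (int d - int i) = d - i" using 3(1) by linarith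
    have "delannoy_coeff d (n - d) i = 0" using 3 j by (simp add: delannoy_coeff_def)
    moreover have "((n - 2 * i) choose (d - i)) * ((n - i - 1) choose j) = 0"
    proof (cases "d = i")
      case True
      \<comment> \<open>The first binomial is \<open>1\<close> here, so the second must vanish. For
        \<open>n = i\<close> the truncated difference \<open>n - i - 1\<close> is \<open>0\<close>,
        and it is \<open>n \<ge> 2\<close> that makes \<open>j\<close> positive.\<close>
      then have "n - i - 1 < j" using 3 j n by linarith
      then show ?thesis by (simp add: binomial_eq_0)
    next
      case False
      then have "n - 2 * i < d - i" using 3 by linarith
      then show ?thesis by (simp add: binomial_eq_0)
    qed
    ultimately show ?thesis unfolding b unfolding binom_def d nats using 3(1) by simp
  qed
qed

lemma card_bounded_faces:
  fixes p :: "'n::finite set \<Rightarrow> real"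
  assumes p: "tropical_pluecker d p" and n2: "CARD('n) \<ge> 2"
  shows "card {F \<in> tropical_faces d p. aff_dim F = int i \<and> bounded_mod_ones F} =
    card {C \<in> cells d p. \<Inter>C = {} \<and> \<Union>C = UNIV \<and> dim (lineal C) = i}"
proof -
  have dn: "d \<le> CARD('n)" using p by (simp add: tropical_pluecker_def)
  have dim: "aff_dim (region d p C) = int (dim (lineal C))" if "C \<in> cells d p" for C
    using that aff_dim_region[OF dn] by (auto simp: cells_def)
  let ?A = "{C \<in> cells d p. \<Inter>C = {} \<and> \<Union>C = UNIV \<and> dim (lineal C) = i}"
  have "{F \<in> tropical_faces d p. aff_dim F = int i \<and> bounded_mod_ones F} = region d p ` ?A"
    unfolding tropical_faces_eq[OF p]
  proof (intro equalityI subsetI)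
    fix F assume "F \<in> {F \<in> region d p ` {C \<in> cells d p. \<Union>C = UNIV}. aff_dim F = int i \<and> bounded_mod_ones F}"
    then obtain C where C: "C \<in> cells d p" "\<Union>C = UNIV" "F = region d p C" "aff_dim F = int i" "bounded_mod_ones F"
      by (elim imageE CollectE conjE) (rule that)
    then have "C \<in> ?A" using dim[OF C(1)] bounded_region_iff[OF C(1,2) n2] by simp
    then show "F \<in> region d p ` ?A" unfolding C(3) by (rule imageI)
  next
    fix F assume "F \<in> region d p ` ?A"
    then obtain C where C: "C \<in> cells d p" "\<Inter>C = {}" "\<Union>C = UNIV" "dim (lineal C) = i" "F = region d p C"
      by (elim imageE CollectE conjE) (rule that)
    have "F \<in> region d p ` {C \<in> cells d p. \<Union>C = UNIV}" unfolding C(5) by (rule imageI) (simp add: C)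
    moreover have "aff_dim F = int i" "bounded_mod_ones F" using dim[OF C(1)] bounded_region_iff[OF C(1,3) n2] C by simp_all
    ultimately show "F \<in> {F \<in> region d p ` {C \<in> cells d p. \<Union>C = UNIV}. aff_dim F = int i \<and> bounded_mod_ones F}" by simp
  qed
  moreover have "inj_on (region d p) ?A" by (rule inj_onI) (rule region_inj[of _ d p], simp_all)
  ultimately show ?thesis by (simp add: card_image)
qed

lemma bounded_mod_ones_one_dim:
  fixes F :: "(real ^ 'n::finite) set"
  assumes "CARD('n) = 1"
  shows "bounded_mod_ones F"
proof -
  obtain z :: 'n where z: "UNIV = {z}" using assms by (rule card_1_singletonE)
  have "x - (x $ z) *\<^sub>R vec 1 = 0" for x :: "real ^ 'n"
  proof (rule vec_eq_iff[THEN iffD2], rule allI)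
    fix i :: 'n have "i = z" using z by blast
    then show "(x - (x $ z) *\<^sub>R vec 1) $ i = 0 $ i" by simp
  qed
  then show ?thesis unfolding bounded_mod_ones_def by (metis norm_zero order_refl)
qed

text \<open>A one-element ground set is treated directly: every set is then bounded modulo the
  all-ones vector, and boundedness no longer detects coloops.\<close>

theorem mainTheorem1:
  fixes p :: "'n::finite set \<Rightarrow> real" and L :: "(real ^ 'n) set" and d i :: nat
  assumes "tropical_pluecker d p"
    and "L = tropical_linear_space d p"
    and "constructible d L"
    and "i \<ge> 1"
  shows "card {F \<in> tropical_faces d p. aff_dim F = int i \<and> bounded_mod_ones F} =
         binom (int CARD('n) - 2 * int i) (int d - int i) *
         binom (int CARD('n) - int i - 1) (int i - 1)"
proof (cases "CARD('n) \<ge> 2")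
  case True
  have dn: "d \<le> CARD('n)" using assms(1) by (simp add: tropical_pluecker_def)
  show ?thesis
    unfolding card_bounded_faces[OF assms(1) True] card_interior_cells[OF dn constructible_sp[OF assms(3,1,2)]]
    by (rule delannoy_coeff_eq_binom[OF True dn assms(4)])
next
  case False
  moreover have "CARD('n) \<noteq> 0" by simp
  ultimately have n1: "CARD('n) = 1" by linarith
  have dn: "d \<le> CARD('n)" using assms(1) by (simp add: tropical_pluecker_def)
  have UN: "A = UNIV" if "card A = 1" for A :: "'n set" using that n1 by (metis card_subset_eq finite subset_UNIV)
  have d01: "d = 0 \<or> d = 1" using dn n1 by linarith
  \<comment> \<open>In one dimension the whole line is the only face, and it occurs only for
    \<open>d = 1\<close>; this matches the product of binomials, which is \<open>1\<close> for
    \<open>d = i = 1\<close> by the conventions of \<open>binom\<close>.\<close>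
  have faces: "tropical_faces d p = (if d = 1 then {UNIV} else {})"
  proof (cases "d = 1")
    case True
    have "initial_bases d p w = {UNIV}" for w
      using initial_bases_nonempty[OF dn, of p w] UN initial_bases_card[of _ d p w] True by blast
    then have "cells d p = {{UNIV}}" "region d p {UNIV} = UNIV" by (auto simp: cells_def region_def)
    then show ?thesis unfolding tropical_faces_eq[OF assms(1)] using True by auto
  next
    case False
    then have d0: "d = 0" using d01 by simp
    have "\<Union>C \<noteq> UNIV" if C: "C \<in> cells d p" for C
    proof -
      have "I = {}" if "I \<in> C" for I using cell_card[OF C that] d0 by simp
      then have "\<Union>C = {}" by blast
      then show ?thesis using empty_not_UNIV by (simp only: not_False_eq_True)
    qed
    then show ?thesis unfolding tropical_faces_eq[OF assms(1)] using False by auto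
  qed
  have "aff_dim (UNIV :: (real ^ 'n) set) = 1" using n1 by simp
  then have "{F \<in> tropical_faces d p. aff_dim F = int i \<and> bounded_mod_ones F} = (if d = 1 \<and> i = 1 then {UNIV} else {})"
    unfolding faces using bounded_mod_ones_one_dim[OF n1] by auto
  then show ?thesis using d01 assms(4) n1 by (auto simp: binom_def)
qed

end
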